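(* Let $k\in(0,1)$, $k'=\sqrt{1-k^2}$, $K=K(k)$ and $K'=K(k')$. Then for every integer $n\ge 0$ we have $$\frac{1}{2}\int_{\mathbb{R}} \frac{x^n\,dx}{\cos(\sqrt{x}K)+\cosh(\sqrt{x}K')}=(-1)^n\,\frac{d^{2n+1}}{du^{2n+1}}\left.\frac{\operatorname{sn}(u,k)}{\operatorname{cd}(u,k)}\right|_{u=0}.$$
   Context: For $k\in(0,1)$, $K(k)=\frac{\pi}{2}\,{}_2F_1(\tfrac12,\tfrac12;1;k^2)=\int_0^{\pi/2}\frac{d\theta}{\sqrt{1-k^2\sin^2\theta}}$ is the complete elliptic integral of the first kind with modulus $k$. $\operatorname{sn}(u,k),\operatorname{cn}(u,k),\operatorname{dn}(u,k)$ are the Jacobi elliptic functions with modulus $k$: the meromorphic functions of $u\in\mathbb{C}$ determined by $\operatorname{sn}'=\operatorname{cn}\operatorname{dn}$, $\operatorname{cn}'=-\operatorname{sn}\operatorname{dn}$, $\operatorname{dn}'=-k^2\operatorname{sn}\operatorname{cn}$, with $\operatorname{sn}(0,k)=0$, $\operatorname{cn}(0,k)=\operatorname{dn}(0,k)=1$. Moreover $\operatorname{cd}(u,k)=\operatorname{cn}(u,k)/\operatorname{dn}(u,k)$. The integral runs over the whole real line. For $x<0$, $\sqrt{x}=i\sqrt{|x|}$ (the functions of $\sqrt{x}$ appearing in the integrand are even in $\sqrt{x}$, so the choice of square root is irrelevant). *)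

theory Defs
  imports "HOL-Complex_Analysis.Complex_Analysis"
begin

definition elliptic_K :: "real \<Rightarrow> real" where
  "elliptic_K k = integral {0..pi/2} (\<lambda>\<theta>. 1 / sqrt (1 - k\<^sup>2 * (sin \<theta>)\<^sup>2))"

text \<open>
  The triple (sn, cn, dn) of modulus \<open>k\<close>. Being \<open>nicely\<close> meromorphic only fixes the otherwise
  arbitrary function values on the discrete set of singularities: removable singularities are
  filled in, and the value at a pole is 0. The condition \<open>\<not> is_pole s 0\<close> is needed because of the
  latter, to make \<open>s 0 = 0\<close> mean that \<open>s\<close> is regular and vanishes at 0.
\<close>
definition is_jacobi_triple ::
  "real \<Rightarrow> (complex \<Rightarrow> complex) \<Rightarrow> (complex \<Rightarrow> complex) \<Rightarrow> (complex \<Rightarrow> complex) \<Rightarrow> bool" where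
  "is_jacobi_triple k s c d \<longleftrightarrow>
     s nicely_meromorphic_on UNIV \<and> c nicely_meromorphic_on UNIV \<and> d nicely_meromorphic_on UNIV \<and>
     (\<forall>u. \<not> is_pole s u \<and> \<not> is_pole c u \<and> \<not> is_pole d u \<longrightarrow>
        (s has_field_derivative c u * d u) (at u) \<and>
        (c has_field_derivative - s u * d u) (at u) \<and>
        (d has_field_derivative - (of_real k)\<^sup>2 * s u * c u) (at u)) \<and>
     \<not> is_pole s 0 \<and> s 0 = 0 \<and> c 0 = 1 \<and> d 0 = 1"

text \<open>
  The description below is proper: \<open>is_jacobi_triple_unique\<close> and \<open>is_jacobi_triple_exists\<close> show
  that there is exactly one such triple for every real \<open>k\<close>, so that the functions defined from it
  do have the defining properties (\<open>is_jacobi_triple_jacobi\<close>).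
\<close>
definition jacobi_triple ::
  "real \<Rightarrow> (complex \<Rightarrow> complex) \<times> (complex \<Rightarrow> complex) \<times> (complex \<Rightarrow> complex)" where
  "jacobi_triple k = (THE (s, c, d). is_jacobi_triple k s c d)"

definition jacobi_sn :: "complex \<Rightarrow> real \<Rightarrow> complex" where
  "jacobi_sn u k = fst (jacobi_triple k) u"

definition jacobi_cn :: "complex \<Rightarrow> real \<Rightarrow> complex" where
  "jacobi_cn u k = fst (snd (jacobi_triple k)) u"

definition jacobi_dn :: "complex \<Rightarrow> real \<Rightarrow> complex" where
  "jacobi_dn u k = snd (snd (jacobi_triple k)) u"

definition jacobi_cd :: "complex \<Rightarrow> real \<Rightarrow> complex" where
  "jacobi_cd u k = jacobi_cn u k / jacobi_dn u k"

definition jacobi_ode ::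
  "real \<Rightarrow> (complex \<Rightarrow> complex) \<Rightarrow> (complex \<Rightarrow> complex) \<Rightarrow> (complex \<Rightarrow> complex) \<Rightarrow> complex \<Rightarrow> bool" where
  "jacobi_ode k s c d u \<longleftrightarrow>
     (s has_field_derivative c u * d u) (at u) \<and>
     (c has_field_derivative - s u * d u) (at u) \<and>
     (d has_field_derivative - (of_real k)\<^sup>2 * s u * c u) (at u)"

lemma eventually_deriv_imp_analytic:
  fixes f :: "complex \<Rightarrow> complex"
  assumes "eventually (\<lambda>u. (f has_field_derivative f' u) (at u)) (nhds z)"
  shows "f analytic_on {z}"
proof -
  obtain S where S: "open S" "z \<in> S" "\<forall>u\<in>S. (f has_field_derivative f' u) (at u)"
    using assms by (auto simp: eventually_nhds)
  then have "f holomorphic_on S"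
    by (auto simp: holomorphic_on_open)
  then show ?thesis using S by (auto simp: analytic_at)
qed

lemma eventually_analytic_nhds:
  fixes f :: "complex \<Rightarrow> complex"
  assumes "f analytic_on {z}"
  shows "eventually (\<lambda>u. f analytic_on {u}) (nhds z)"
proof -
  obtain S where S: "open S" "z \<in> S" "f holomorphic_on S"
    using assms by (auto simp: analytic_at)
  then show ?thesis
    by (intro eventually_mono[OF eventually_nhds_in_open[OF S(1,2)]]) (auto simp: analytic_at)
qed

lemma eventually_at_eventually_nhds:
  fixes z :: "'a :: t1_space"
  assumes "eventually P (at z)"
  shows "eventually (\<lambda>u. eventually P (nhds u)) (at z)"
proof -
  obtain S where S: "open S" "z \<in> S" "\<And>u. u \<in> S \<Longrightarrow> u \<noteq> z \<Longrightarrow> P u"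
    using assms by (auto simp: eventually_at_topological)
  have "eventually P (nhds u)" if "u \<in> S" "u \<noteq> z" for u
    by (rule eventually_mono[OF eventually_nhds_in_open[of "S - {z}" u]]) (use S that in auto)
  then show ?thesis
    using S by (auto simp: eventually_at_topological)
qed

lemma jacobi_ode_higher_deriv:
  assumes "eventually (jacobi_ode k s c d) (nhds 0)"
  shows "(deriv ^^ Suc n) s 0 = (\<Sum>i=0..n. of_nat (n choose i) * (deriv ^^ i) c 0 * (deriv ^^ (n-i)) d 0)"
    and "(deriv ^^ Suc n) c 0 = - (\<Sum>i=0..n. of_nat (n choose i) * (deriv ^^ i) s 0 * (deriv ^^ (n-i)) d 0)"
    and "(deriv ^^ Suc n) d 0 = - (of_real k)\<^sup>2 * (\<Sum>i=0..n. of_nat (n choose i) * (deriv ^^ i) s 0 * (deriv ^^ (n-i)) c 0)"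
proof -
  have an: "s analytic_on {0}" "c analytic_on {0}" "d analytic_on {0}"
    using assms unfolding jacobi_ode_def eventually_conj_iff by (auto dest: eventually_deriv_imp_analytic)
  have ev: "eventually (\<lambda>u. deriv s u = c u * d u) (nhds 0)"
           "eventually (\<lambda>u. deriv c u = (-1) * (s u * d u)) (nhds 0)"
           "eventually (\<lambda>u. deriv d u = (- (of_real k)\<^sup>2) * (s u * c u)) (nhds 0)"
    using assms by (auto simp: jacobi_ode_def mult.assoc elim!: eventually_mono intro!: DERIV_imp_deriv)
  have cm: "(deriv ^^ n) (\<lambda>u. a * (f u * g u)) 0 = a * (deriv ^^ n) (\<lambda>u. f u * g u) 0"
    if "f analytic_on {0}" "g analytic_on {0}" for a and f g :: "complex \<Rightarrow> complex"
    using that by (intro higher_deriv_cmult') (auto intro!: analytic_intros)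
  show "(deriv ^^ Suc n) s 0 = (\<Sum>i=0..n. of_nat (n choose i) * (deriv ^^ i) c 0 * (deriv ^^ (n-i)) d 0)"
    unfolding funpow_Suc_right o_def
    by (subst higher_deriv_cong_ev[OF ev(1) refl], subst higher_deriv_mult_at) (use an in auto)
  show "(deriv ^^ Suc n) c 0 = - (\<Sum>i=0..n. of_nat (n choose i) * (deriv ^^ i) s 0 * (deriv ^^ (n-i)) d 0)"
    unfolding funpow_Suc_right o_def
    by (subst higher_deriv_cong_ev[OF ev(2) refl], subst cm, use an in simp, use an in simp,
        subst higher_deriv_mult_at) (use an in auto)
  show "(deriv ^^ Suc n) d 0 = - (of_real k)\<^sup>2 * (\<Sum>i=0..n. of_nat (n choose i) * (deriv ^^ i) s 0 * (deriv ^^ (n-i)) c 0)"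
    unfolding funpow_Suc_right o_def
    by (subst higher_deriv_cong_ev[OF ev(3) refl], subst cm, use an in simp, use an in simp,
        subst higher_deriv_mult_at) (use an in auto)
qed

lemma analytic_eqI_higher_deriv:
  fixes f g :: "complex \<Rightarrow> complex"
  assumes "f analytic_on {z}" "g analytic_on {z}" "\<And>n. (deriv ^^ n) f z = (deriv ^^ n) g z"
  shows "eventually (\<lambda>u. f u = g u) (nhds z)"
proof -
  obtain r where r: "r > 0" "f holomorphic_on ball z r"
    using assms(1) by (auto simp: analytic_on_def)
  obtain r' where r': "r' > 0" "g holomorphic_on ball z r'"
    using assms(2) by (auto simp: analytic_on_def)
  have "f w = g w" if "w \<in> ball z (min r r')" for w
    by (rule holomorphic_fun_eq_on_ball[OF _ _ that assms(3)])
       (use r r' in \<open>auto intro: holomorphic_on_subset\<close>)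
  moreover have "eventually (\<lambda>w. w \<in> ball z (min r r')) (nhds z)"
    using r r' by (intro eventually_nhds_in_open) auto
  ultimately show ?thesis by (auto elim: eventually_mono)
qed

lemma jacobi_ode_unique_nhds:
  assumes 1: "eventually (jacobi_ode k s c d) (nhds 0)" "s 0 = 0" "c 0 = 1" "d 0 = 1"
    and 2: "eventually (jacobi_ode k s' c' d') (nhds 0)" "s' 0 = 0" "c' 0 = 1" "d' 0 = 1"
  shows "eventually (\<lambda>u. s u = s' u \<and> c u = c' u \<and> d u = d' u) (nhds 0)"
proof -
  have an: "s analytic_on {0}" "c analytic_on {0}" "d analytic_on {0}"
    using 1(1) unfolding jacobi_ode_def eventually_conj_iff by (auto dest: eventually_deriv_imp_analytic)
  have an': "s' analytic_on {0}" "c' analytic_on {0}" "d' analytic_on {0}"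
    using 2(1) unfolding jacobi_ode_def eventually_conj_iff by (auto dest: eventually_deriv_imp_analytic)
  have *: "(deriv ^^ n) s 0 = (deriv ^^ n) s' 0 \<and> (deriv ^^ n) c 0 = (deriv ^^ n) c' 0 \<and>
           (deriv ^^ n) d 0 = (deriv ^^ n) d' 0" for n
  proof (induction n rule: less_induct)
    case (less n)
    show ?case
    proof (cases n)
      case 0
      then show ?thesis using 1 2 by simp
    next
      case (Suc m)
      have "(deriv ^^ i) s 0 = (deriv ^^ i) s' 0" "(deriv ^^ i) c 0 = (deriv ^^ i) c' 0"
           "(deriv ^^ i) d 0 = (deriv ^^ i) d' 0" if "i \<le> m" for i
        using less[of i] that Suc by auto
      then show ?thesis
        unfolding Suc jacobi_ode_higher_deriv[OF 1(1)] jacobi_ode_higher_deriv[OF 2(1)]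
        by (auto intro!: sum.cong)
    qed
  qed
  show ?thesis
    using an an' * by (simp add: eventually_conj_iff analytic_eqI_higher_deriv)
qed

lemma nicely_meromorphic_remove_sings:
  assumes "f nicely_meromorphic_on A" "z \<in> A"
  shows "remove_sings f z = f z"
  using assms unfolding nicely_meromorphic_on_def by (metis remove_sings_at_pole remove_sings_eqI)

lemma nicely_meromorphic_eqI:
  assumes f: "f nicely_meromorphic_on A" and g: "g nicely_meromorphic_on A"
    and A: "open A" "connected A" "z \<in> A"
    and ev: "eventually (\<lambda>u. f u = g u) (at z)" and w: "w \<in> A"
  shows "f w = g w"
proof -
  have fg: "(\<lambda>u. f u - g u) meromorphic_on A"
    using f g by (auto simp: nicely_meromorphic_on_def intro!: meromorphic_intros)
  then have iso: "isolated_singularity_at (\<lambda>u. f u - g u) v" if "v \<in> A" for v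
    using that by (auto simp: meromorphic_on_altdef)
  define h where "h = remove_sings (\<lambda>u. f u - g u)"
  have h: "h nicely_meromorphic_on A"
    unfolding h_def by (rule remove_sings_nicely_meromorphic[OF fg])
  have "eventually (\<lambda>u. h u = 0) (at z)"
    using ev eventually_remove_sings_eq_at[OF iso[OF A(3)]] unfolding h_def
    by eventually_elim simp
  then have "frequently (\<lambda>u. h u = 0) (at z)"
    by (intro eventually_frequently) auto
  then have h0: "h v = 0" if "v \<in> A" for v
    using frequently_eq_meromorphic_imp_constant[OF _ h A] that by blast
  have "eventually (\<lambda>u. u \<in> A) (at w)"
    using A w by (intro eventually_at_in_open') auto
  then have "eventually (\<lambda>u. f u = g u) (at w)"
    using eventually_remove_sings_eq_at[OF iso[OF w]]
    by eventually_elim (use h0 in \<open>auto simp: h_def\<close>)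
  then have "remove_sings f w = remove_sings g w"
    by (rule remove_sings_cong) simp
  then show ?thesis
    using nicely_meromorphic_remove_sings f g w by metis
qed

lemma is_jacobi_triple_ode_nhds:
  assumes "is_jacobi_triple k s c d"
  shows "eventually (jacobi_ode k s c d) (nhds 0)"
proof -
  have nm: "s nicely_meromorphic_on UNIV" "c nicely_meromorphic_on UNIV" "d nicely_meromorphic_on UNIV"
    and np: "\<not> is_pole s 0" and "c 0 = 1" "d 0 = 1"
    using assms by (auto simp: is_jacobi_triple_def)
  then have "\<not> is_pole c 0" "\<not> is_pole d 0"
    unfolding nicely_meromorphic_on_def
    by (metis UNIV_I remove_sings_at_pole remove_sings_eqI zero_neq_one)+
  then have an: "s analytic_on {0}" "c analytic_on {0}" "d analytic_on {0}"
    using nm np by (auto intro: nicely_meromorphic_on_imp_analytic_at)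
  have "eventually (\<lambda>u. s analytic_on {u} \<and> c analytic_on {u} \<and> d analytic_on {u}) (nhds 0)"
    using an by (simp add: eventually_conj_iff eventually_analytic_nhds)
  then show ?thesis
  proof eventually_elim
    case (elim u)
    then have "\<not> is_pole s u" "\<not> is_pole c u" "\<not> is_pole d u"
      by (auto dest: analytic_at_imp_no_pole)
    then show ?case
      using assms by (auto simp: is_jacobi_triple_def jacobi_ode_def)
  qed
qed

lemma is_jacobi_triple_unique:
  assumes 1: "is_jacobi_triple k s c d" and 2: "is_jacobi_triple k s' c' d'"
  shows "s = s' \<and> c = c' \<and> d = d'"
proof -
  have "eventually (\<lambda>u. s u = s' u \<and> c u = c' u \<and> d u = d' u) (nhds 0)"
    by (rule jacobi_ode_unique_nhds[OF is_jacobi_triple_ode_nhds[OF 1] _ _ _ is_jacobi_triple_ode_nhds[OF 2]])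
       (use 1 2 in \<open>auto simp: is_jacobi_triple_def\<close>)
  then have "eventually (\<lambda>u. s u = s' u \<and> c u = c' u \<and> d u = d' u) (at 0)"
    by (auto simp: eventually_at_filter elim: eventually_mono)
  then have ev: "eventually (\<lambda>u. s u = s' u) (at 0)" "eventually (\<lambda>u. c u = c' u) (at 0)"
                "eventually (\<lambda>u. d u = d' u) (at 0)"
    by (auto simp: eventually_conj_iff)
  have "s w = s' w" "c w = c' w" "d w = d' w" for w
    by (rule nicely_meromorphic_eqI[of _ UNIV _ 0]; use 1 2 ev in \<open>auto simp: is_jacobi_triple_def\<close>)+
  then show ?thesis by auto
qed

text \<open>
  Existence: the system is first solved near 0 by inverting the elliptic integral of the first
  kind. The duplication formulas then turn a meromorphic solution on a disc into
  one on the disc of twice the radius. Derivatives and the quadratic identities are only required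
  off a discrete set.
\<close>
definition jacobi_on ::
  "real \<Rightarrow> real \<Rightarrow> (complex \<Rightarrow> complex) \<Rightarrow> (complex \<Rightarrow> complex) \<Rightarrow> (complex \<Rightarrow> complex) \<Rightarrow> bool" where
  "jacobi_on k r s c d \<longleftrightarrow>
     s meromorphic_on ball 0 r \<and> c meromorphic_on ball 0 r \<and> d meromorphic_on ball 0 r \<and>
     (\<forall>z\<in>ball 0 r. eventually (\<lambda>u. jacobi_ode k s c d u \<and> (s u)\<^sup>2 + (c u)\<^sup>2 = 1 \<and>
                        (of_real k)\<^sup>2 * (s u)\<^sup>2 + (d u)\<^sup>2 = 1) (at z)) \<and>
     eventually (\<lambda>u. jacobi_ode k s c d u \<and> (s u)\<^sup>2 + (c u)\<^sup>2 = 1 \<and>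
                        (of_real k)\<^sup>2 * (s u)\<^sup>2 + (d u)\<^sup>2 = 1) (nhds 0) \<and>
     s 0 = 0 \<and> c 0 = 1 \<and> d 0 = 1"

lemma jacobi_on_local: "\<exists>r s c d. r > 0 \<and> jacobi_on k r s c d"
proof -
  define R where "R = 1 / (1 + \<bar>k\<bar>)"
  define a where "a = (complex_of_real k)\<^sup>2"
  have R: "0 < R" "R \<le> 1" "\<bar>k\<bar> * R < 1"
    by (auto simp: R_def field_simps)
  define p where "p = (\<lambda>x. csqrt (1 - x\<^sup>2))"
  define q where "q = (\<lambda>x. csqrt (1 - a * x\<^sup>2))"
  have re: "Re (1 - x\<^sup>2) > 0" "Re (1 - a * x\<^sup>2) > 0" if "x \<in> ball 0 R" for x
  proof -
    have "norm x < R" using that by simp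
    then have "norm x < 1" "\<bar>k\<bar> * norm x \<le> \<bar>k\<bar> * R"
      using R by (auto intro!: mult_left_mono)
    then have "norm x < 1" "\<bar>k\<bar> * norm x < 1"
      using R by linarith+
    then have "(norm x)\<^sup>2 < 1" "(\<bar>k\<bar> * norm x)\<^sup>2 < 1"
      by (simp_all add: abs_square_less_1 abs_mult)
    then have "norm (x\<^sup>2) < 1" "norm (a * x\<^sup>2) < 1"
      by (simp_all add: a_def norm_mult norm_power power_mult_distrib)
    then show "Re (1 - x\<^sup>2) > 0" "Re (1 - a * x\<^sup>2) > 0"
      using complex_Re_le_cmod[of "x\<^sup>2"] complex_Re_le_cmod[of "a * x\<^sup>2"] by auto
  qed
  then have nn: "1 - x\<^sup>2 \<notin> \<real>\<^sub>\<le>\<^sub>0" "1 - a * x\<^sup>2 \<notin> \<real>\<^sub>\<le>\<^sub>0" if "x \<in> ball 0 R" for x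
    using that by (auto simp: complex_nonpos_Reals_iff not_le)
  then have nz: "p x \<noteq> 0" "q x \<noteq> 0" if "x \<in> ball 0 R" for x
    using nn[OF that] by (auto simp: p_def q_def simp del: right_minus_eq)
  have hol: "(\<lambda>x. 1 / (p x * q x)) holomorphic_on ball 0 R"
    using nn nz unfolding p_def q_def by (intro holomorphic_intros) auto
  obtain F0 where F0: "\<And>x. x \<in> ball 0 R \<Longrightarrow> (F0 has_field_derivative 1 / (p x * q x)) (at x within ball 0 R)"
    using holomorphic_convex_primitive'[OF convex_ball open_ball hol] by blast
  define F where "F = (\<lambda>x. F0 x - F0 0)"
  have F: "(F has_field_derivative 1 / (p x * q x)) (at x)" if "x \<in> ball 0 R" for x
  proof -
    have "(F0 has_field_derivative 1 / (p x * q x)) (at x)"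
      using F0[OF that] at_within_open[OF that open_ball] by simp
    from DERIV_diff[OF this DERIV_const[of "F0 0"]] show ?thesis by (simp add: F_def)
  qed
  have Fhol: "F holomorphic_on ball 0 R"
    using F by (subst holomorphic_on_open) blast+
  have dF: "deriv F x = 1 / (p x * q x)" if "x \<in> ball 0 R" for x
    using F[OF that] by (rule DERIV_imp_deriv)
  have R0: "(0::complex) \<in> ball 0 R" using R by simp
  have dF0: "deriv F 0 \<noteq> 0" using dF[OF R0] nz[OF R0] by simp
  obtain \<rho> where \<rho>: "\<rho> > 0" "ball (0::complex) \<rho> \<subseteq> ball 0 R" "inj_on F (ball 0 \<rho>)"
    by (rule has_complex_derivative_locally_injective[OF Fhol R0 open_ball dF0]) (rule that)
  define B where "B = ball (0::complex) \<rho>"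
  have B: "open B" "0 \<in> B" "B \<subseteq> ball 0 R" "inj_on F B"
    using \<rho> unfolding B_def by simp_all
  have FB: "F holomorphic_on B" using Fhol B by (auto intro: holomorphic_on_subset)
  obtain s where s: "s holomorphic_on F ` B" "\<And>z. z \<in> B \<Longrightarrow> deriv F z * deriv s (F z) = 1"
      "\<And>z. z \<in> B \<Longrightarrow> s (F z) = z"
    by (rule holomorphic_has_inverse[OF FB B(1,4)]) (rule that)
  have op: "open (F ` B)" by (rule open_mapping_thm3[OF FB B(1,4)])
  have s0: "s 0 = 0" using s(3)[OF B(2)] by (simp add: F_def)
  have "0 \<in> F ` B" using B by (auto simp: F_def intro!: image_eqI[of _ _ 0])
  then obtain r where r: "r > 0" "ball (0::complex) r \<subseteq> F ` B"
    using op by (auto simp: open_contains_ball)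
  define c where "c = (\<lambda>u. p (s u))"
  define d where "d = (\<lambda>u. q (s u))"
  have sB: "s u \<in> ball 0 R" if u: "u \<in> ball 0 r" for u
  proof -
    obtain z where "z \<in> B" "u = F z" using u r(2) by blast
    then show ?thesis using s(3)[of z] B(3) by auto
  qed
  have ds: "(s has_field_derivative c u * d u) (at u)" if u: "u \<in> ball 0 r" for u
  proof -
    obtain z where z: "z \<in> B" "u = F z" using u r(2) by blast
    have "z \<in> ball 0 R" using z B by auto
    then have "deriv s u = p z * q z"
      using s(2)[OF z(1)] dF[of z] nz[of z] z by (simp add: field_simps)
    then have "deriv s u = c u * d u" using s(3)[OF z(1)] z by (simp add: c_def d_def)
    moreover have "(s has_field_derivative deriv s u) (at u)"
      using s(1) op z by (auto intro: holomorphic_derivI)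
    ultimately show ?thesis by simp
  qed
  have ode: "jacobi_ode k s c d u" if u: "u \<in> ball 0 r" for u
  proof -
    note x = sB[OF u]
    have "(p has_field_derivative - s u / p (s u)) (at (s u))"
      unfolding p_def
      by (rule derivative_eq_intros refl | rule nn[OF x])+ (simp add: field_simps)
    from DERIV_chain2[OF this ds[OF u]] have "(c has_field_derivative - s u * d u) (at u)"
      using nz[OF x] by (simp add: c_def)
    moreover have "(q has_field_derivative - a * s u / q (s u)) (at (s u))"
      unfolding q_def
      by (rule derivative_eq_intros refl | rule nn[OF x])+ (simp add: field_simps)
    from DERIV_chain2[OF this ds[OF u]] have "(d has_field_derivative - a * s u * c u) (at u)"
      using nz[OF x] by (simp add: d_def mult.assoc)
    ultimately show ?thesis using ds[OF u] by (simp add: jacobi_ode_def a_def)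
  qed
  have id: "(s u)\<^sup>2 + (c u)\<^sup>2 = 1" "(of_real k)\<^sup>2 * (s u)\<^sup>2 + (d u)\<^sup>2 = 1" for u
    by (auto simp: c_def d_def p_def q_def a_def)
  have an: "s analytic_on ball 0 r" "c analytic_on ball 0 r" "d analytic_on ball 0 r"
    using ode unfolding jacobi_ode_def
    by (subst analytic_on_open, simp, subst holomorphic_on_open, simp, blast)+
  have ev: "eventually (\<lambda>u. jacobi_ode k s c d u \<and> (s u)\<^sup>2 + (c u)\<^sup>2 = 1 \<and>
               (of_real k)\<^sup>2 * (s u)\<^sup>2 + (d u)\<^sup>2 = 1) (nhds z)" if "z \<in> ball 0 r" for z
    by (rule eventually_mono[OF eventually_nhds_in_open[OF open_ball that]]) (use ode id in blast)
  then have ev': "eventually (\<lambda>u. jacobi_ode k s c d u \<and> (s u)\<^sup>2 + (c u)\<^sup>2 = 1 \<and>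
               (of_real k)\<^sup>2 * (s u)\<^sup>2 + (d u)\<^sup>2 = 1) (at z)" if "z \<in> ball 0 r" for z
    using that at_within_le_nhds filter_leD by blast
  have "c 0 = 1" "d 0 = 1"
    by (simp_all add: c_def d_def p_def q_def s0)
  then have "jacobi_on k r s c d"
    unfolding jacobi_on_def using an ev[of 0] ev' r s0 by (simp add: analytic_on_imp_meromorphic_on)
  then show ?thesis using r by blast
qed

lemma jacobi_on_double:
  assumes P: "jacobi_on k r s c d" and r: "r > 0"
  shows "\<exists>s c d. jacobi_on k (2 * r) s c d"
proof -
  define a where "a = (complex_of_real k)\<^sup>2"
  define \<Delta> where "\<Delta> = (\<lambda>u. 1 - a * s u ^ 4)"
  define S where "S = (\<lambda>u. 2 * s (u/2) * c (u/2) * d (u/2) / \<Delta> (u/2))"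
  define C where "C = (\<lambda>u. (c (u/2) ^ 2 - s (u/2) ^ 2 * d (u/2) ^ 2) / \<Delta> (u/2))"
  define D where "D = (\<lambda>u. (d (u/2) ^ 2 - a * s (u/2) ^ 2 * c (u/2) ^ 2) / \<Delta> (u/2))"
  define Q where "Q = (\<lambda>s c d u. jacobi_ode k s c d u \<and> (s u)\<^sup>2 + (c u)\<^sup>2 = 1 \<and> a * (s u)\<^sup>2 + (d u)\<^sup>2 = 1)"
  have mer: "s meromorphic_on ball 0 r" "c meromorphic_on ball 0 r" "d meromorphic_on ball 0 r"
    and ev: "\<And>z. z \<in> ball 0 r \<Longrightarrow> eventually (Q s c d) (at z)"
    and ev0: "eventually (Q s c d) (nhds 0)" and init: "s 0 = 0" "c 0 = 1" "d 0 = 1"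
    using P unfolding jacobi_on_def Q_def a_def by auto
  have step: "Q S C D u" if q: "Q s c d (u/2)" and nz: "\<Delta> (u/2) \<noteq> 0" for u
  proof -
    define v where "v = u/2"
    define x y z where "x = s v" and "y = c v" and "z = d v"
    note xyz = x_def[symmetric] y_def[symmetric] z_def[symmetric]
    have y2: "y\<^sup>2 = 1 - x\<^sup>2" and z2: "z\<^sup>2 = 1 - a * x\<^sup>2"
      using q unfolding Q_def v_def[symmetric] xyz by (auto simp: algebra_simps)
    have Dn: "1 - a * x ^ 4 \<noteq> 0" using nz by (simp add: \<Delta>_def x_def v_def)
    have half: "((\<lambda>u. f (u/2)) has_field_derivative f' / 2) (at u)"
      if "(f has_field_derivative f') (at v)" for f :: "complex \<Rightarrow> complex" and f'
    proof -
      have "((\<lambda>u. u / 2) has_field_derivative 1 / 2) (at u)"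
        by (auto intro!: derivative_eq_intros)
      from DERIV_chain2[OF that[unfolded v_def] this] show ?thesis by simp
    qed
    have "(s has_field_derivative y * z) (at v)" "(c has_field_derivative - x * z) (at v)"
         "(d has_field_derivative - a * x * y) (at v)"
      using q unfolding Q_def v_def[symmetric] xyz jacobi_ode_def a_def by auto
    note dd = this[THEN half]
    have sv: "s (u/2) = x" "c (u/2) = y" "d (u/2) = z"
      by (simp_all add: x_def y_def z_def v_def)
    have D0: "((\<lambda>u. 1 - a * s (u/2) ^ 4) has_field_derivative -2*a*x^3*y*z) (at u)"
      by (rule derivative_eq_intros dd refl)+ (simp add: sv)
    have N1: "((\<lambda>u. 2 * s (u/2) * c (u/2) * d (u/2)) has_field_derivative
                y^2*z^2 - x^2*z^2 - a*x^2*y^2) (at u)"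
      by (rule derivative_eq_intros dd refl)+ (simp add: sv algebra_simps power2_eq_square)
    have N2: "((\<lambda>u. c (u/2) ^ 2 - s (u/2) ^ 2 * d (u/2) ^ 2) has_field_derivative
                - x*y*z - x*y*z^3 + a*x^3*y*z) (at u)"
      by (rule derivative_eq_intros dd refl)+
         (simp add: sv algebra_simps power2_eq_square power3_eq_cube)
    have N3: "((\<lambda>u. d (u/2) ^ 2 - a * s (u/2) ^ 2 * c (u/2) ^ 2) has_field_derivative
                - a*x*y*z - a*x*z*y^3 + a*x^3*y*z) (at u)"
      by (rule derivative_eq_intros dd refl)+
         (simp add: sv algebra_simps power2_eq_square power3_eq_cube)
    have nz': "1 - a * s (u/2) ^ 4 \<noteq> 0"
      unfolding sv by (rule Dn)
    note S' = DERIV_divide[OF N1 D0 nz', unfolded sv]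
    note C' = DERIV_divide[OF N2 D0 nz', unfolded sv]
    note D' = DERIV_divide[OF N3 D0 nz', unfolded sv]
    have vals: "S u = 2*x*y*z / (1 - a*x^4)" "C u = (y^2-x^2*z^2) / (1 - a*x^4)" 
               "D u = (z^2-a*x^2*y^2) / (1 - a*x^4)"
      by (simp_all add: S_def C_def D_def \<Delta>_def sv)
    have z3: "z^3 = z * (1 - a*x^2)" and y3: "y^3 = y * (1 - x^2)"
      using y2 z2 by (auto simp: power3_eq_cube power2_eq_square)
    have e1: "(y^2*z^2 - x^2*z^2 - a*x^2*y^2) * (1 - a*x^4) - (2*x*y*z) * (-2*a*x^3*y*z)
        = (y^2-x^2*z^2) * (z^2-a*x^2*y^2)"
      using y2 z2 by algebra
    have e2: "(- x*y*z - x*y*z^3 + a*x^3*y*z) * (1 - a*x^4) - (y^2-x^2*z^2) * (-2*a*x^3*y*z)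
        = - (2*x*y*z) * (z^2-a*x^2*y^2)"
      unfolding z3 y2 z2 by algebra
    have e3: "(- a*x*y*z - a*x*z*y^3 + a*x^3*y*z) * (1 - a*x^4) - (z^2-a*x^2*y^2) * (-2*a*x^3*y*z)
        = - a * (2*x*y*z) * (y^2-x^2*z^2)"
      unfolding y3 y2 z2 by algebra
    have e4: "(2*x*y*z)^2 + (y^2-x^2*z^2)^2 = (1 - a*x^4)^2"
      using y2 z2 by algebra
    have e5: "a*(2*x*y*z)^2 + (z^2-a*x^2*y^2)^2 = (1 - a*x^4)^2"
      using y2 z2 by algebra
    have "jacobi_ode k S C D u"
      unfolding jacobi_ode_def vals a_def[symmetric]
      using S' C' D' unfolding e1 e2 e3
      by (simp add: S_def C_def D_def \<Delta>_def)
    moreover have "(S u)\<^sup>2 + (C u)\<^sup>2 = 1"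
      unfolding vals power_divide add_divide_distrib[symmetric] e4 using Dn by simp
    moreover have "a * (S u)\<^sup>2 + (D u)\<^sup>2 = 1"
      unfolding vals power_divide times_divide_eq_right add_divide_distrib[symmetric] e5 using Dn by simp
    ultimately show ?thesis by (simp add: Q_def)
  qed
  have mer\<Delta>: "\<Delta> meromorphic_on ball 0 r"
    unfolding \<Delta>_def by (intro meromorphic_intros mer)
  have an: "s analytic_on {0}"
    using ev0 unfolding Q_def jacobi_ode_def eventually_conj_iff by (auto dest: eventually_deriv_imp_analytic)
  then have "isCont \<Delta> 0"
    unfolding \<Delta>_def by (intro continuous_intros) (auto dest: analytic_at_imp_isCont)
  moreover have "\<Delta> 0 \<noteq> 0" by (simp add: \<Delta>_def init)
  ultimately have \<Delta>0: "eventually (\<lambda>u. \<Delta> u \<noteq> 0) (nhds 0)"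
    using tendsto_imp_eventually_ne[of \<Delta> "\<Delta> 0" "nhds 0" 0] by (simp add: isCont_def tendsto_at_iff_tendsto_nhds)
  then have "eventually (\<lambda>u. \<Delta> u \<noteq> 0) (at 0)"
    by (auto simp: eventually_at_filter elim: eventually_mono)
  moreover have "(\<forall>\<^sub>\<approx>u\<in>ball 0 r. \<Delta> u = 0) \<or> (\<forall>\<^sub>\<approx>u\<in>ball 0 r. \<Delta> u \<noteq> 0)"
    by (rule meromorphic_imp_constant_or_avoid[OF mer\<Delta>]) auto
  ultimately have \<Delta>ev: "eventually (\<lambda>u. \<Delta> u \<noteq> 0) (at z)" if "z \<in> ball 0 r" for z
  proof -
    have "\<not> (\<forall>\<^sub>\<approx>u\<in>ball 0 r. \<Delta> u = 0)"
    proof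
      assume "\<forall>\<^sub>\<approx>u\<in>ball 0 r. \<Delta> u = 0"
      then have "eventually (\<lambda>u. \<Delta> u = 0) (at 0)"
        using r by (auto simp: eventually_cosparse_open_eq)
      with \<open>eventually (\<lambda>u. \<Delta> u \<noteq> 0) (at 0)\<close> have "eventually (\<lambda>u. False) (at (0::complex))"
        by eventually_elim simp
      then show False by simp
    qed
    then show ?thesis
      using \<open>_ \<or> _\<close> that by (auto simp: eventually_cosparse_open_eq)
  qed
  have halfat: "filterlim (\<lambda>u::complex. u/2) (at (z/2)) (at z)" for z
    unfolding filterlim_at by (auto intro!: tendsto_intros simp: eventually_at_filter)
  have halfnh: "filterlim (\<lambda>u::complex. u/2) (nhds 0) (nhds 0)"
    by (auto intro!: tendsto_eq_intros filterlim_ident)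
  have evQ: "eventually (Q S C D) (at z)" if "z \<in> ball 0 (2*r)" for z
  proof -
    have "z/2 \<in> ball 0 r" using that by (simp add: norm_divide)
    then have "eventually (\<lambda>v. Q s c d v \<and> \<Delta> v \<noteq> 0) (at (z/2))"
      using ev \<Delta>ev by (simp add: eventually_conj_iff)
    then have "eventually (\<lambda>u. Q s c d (u/2) \<and> \<Delta> (u/2) \<noteq> 0) (at z)"
      using eventually_compose_filterlim[OF _ halfat] by blast
    then show ?thesis by eventually_elim (use step in auto)
  qed
  have "eventually (\<lambda>v. Q s c d v \<and> \<Delta> v \<noteq> 0) (nhds 0)"
    using ev0 \<Delta>0 by (simp add: eventually_conj_iff)
  then have "eventually (\<lambda>u. Q s c d (u/2) \<and> \<Delta> (u/2) \<noteq> 0) (nhds 0)"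
    using eventually_compose_filterlim[OF _ halfnh] by blast
  then have evQ0: "eventually (Q S C D) (nhds 0)"
    by eventually_elim (use step in auto)
  have mh: "(\<lambda>u. f (u/2)) meromorphic_on ball 0 (2*r)" if "f meromorphic_on ball 0 r" for f :: "complex \<Rightarrow> complex"
    by (rule meromorphic_on_compose[OF that]) (auto intro!: analytic_intros simp: norm_divide)
  have "S meromorphic_on ball 0 (2*r)" "C meromorphic_on ball 0 (2*r)" "D meromorphic_on ball 0 (2*r)"
    unfolding S_def C_def D_def by (intro meromorphic_intros mh mer mer\<Delta>)+
  then have "jacobi_on k (2*r) S C D"
    unfolding jacobi_on_def a_def[symmetric] using evQ evQ0
    by (auto simp: Q_def S_def C_def D_def \<Delta>_def init)
  then show ?thesis by blast
qed

lemma jacobi_on_remove_sings: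
  assumes "jacobi_on k r s c d" "r > 0"
  shows "jacobi_on k r (remove_sings s) (remove_sings c) (remove_sings d)"
proof -
  define Q where "Q = (\<lambda>s c d u. jacobi_ode k s c d u \<and> (s u)\<^sup>2 + (c u)\<^sup>2 = 1 \<and> (of_real k)\<^sup>2 * (s u)\<^sup>2 + (d u)\<^sup>2 = 1)"
  have step: "Q (remove_sings s) (remove_sings c) (remove_sings d) u"
    if q: "eventually (Q s c d) (nhds u)" for u
  proof -
    have an: "s analytic_on {u}" "c analytic_on {u}" "d analytic_on {u}"
      using q unfolding Q_def jacobi_ode_def eventually_conj_iff by (auto dest: eventually_deriv_imp_analytic)
    have "Q s c d u" using q by (rule eventually_nhds_x_imp_x)
    then show ?thesis
      using an unfolding Q_def jacobi_ode_def
      by (simp add: DERIV_cong_ev[OF refl eventually_remove_sings_eq_nhds refl])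
  qed
  have m: "s meromorphic_on ball 0 r" "c meromorphic_on ball 0 r" "d meromorphic_on ball 0 r"
    and ev: "\<And>z. z \<in> ball 0 r \<Longrightarrow> eventually (Q s c d) (at z)"
    and ev0: "eventually (Q s c d) (nhds 0)" and init: "s 0 = 0" "c 0 = 1" "d 0 = 1"
    using assms unfolding jacobi_on_def Q_def by auto
  have 1: "eventually (Q (remove_sings s) (remove_sings c) (remove_sings d)) (at z)" if "z \<in> ball 0 r" for z
  proof -
    have "eventually (\<lambda>u. eventually (Q s c d) (nhds u)) (at z)"
      using ev[OF that] by (rule eventually_at_eventually_nhds)
    then show ?thesis by eventually_elim (rule step)
  qed
  have 2: "eventually (Q (remove_sings s) (remove_sings c) (remove_sings d)) (nhds 0)"
  proof -
    have "eventually (\<lambda>u. eventually (Q s c d) (nhds u)) (nhds 0)"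
      using ev0 by (simp add: eventually_eventually)
    then show ?thesis by eventually_elim (rule step)
  qed
  have "s analytic_on {0}" "c analytic_on {0}" "d analytic_on {0}"
    using ev0 unfolding Q_def jacobi_ode_def eventually_conj_iff by (auto dest: eventually_deriv_imp_analytic)
  then show ?thesis
    using 1 2 m init unfolding jacobi_on_def Q_def by (auto intro!: meromorphic_intros)
qed

lemma is_jacobi_triple_exists: "\<exists>s c d. is_jacobi_triple k s c d"
proof -
  obtain r s0 c0 d0 where r: "r > 0" and base: "jacobi_on k r s0 c0 d0"
    using jacobi_on_local by blast
  have "\<exists>s c d. jacobi_on k (2 ^ n * r) s c d" for n
  proof (induction n)
    case 0
    then show ?case using base by auto
  next
    case (Suc n)
    then show ?case using jacobi_on_double[of k "2^n * r"] r by (auto simp: mult.assoc)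
  qed
  then have "\<exists>t. jacobi_on k (2 ^ n * r) (fst t) (fst (snd t)) (snd (snd t))" for n
    by (metis fst_conv snd_conv)
  then obtain t where t: "\<And>n. jacobi_on k (2 ^ n * r) (fst (t n)) (fst (snd (t n))) (snd (snd (t n)))"
    by metis
  define S where "S = (\<lambda>n. remove_sings (fst (t n)))"
  define C where "C = (\<lambda>n. remove_sings (fst (snd (t n))))"
  define D where "D = (\<lambda>n. remove_sings (snd (snd (t n))))"
  define B where "B = (\<lambda>n::nat. ball (0::complex) (2 ^ n * r))"
  have J: "jacobi_on k (2 ^ n * r) (S n) (C n) (D n)" for n
    unfolding S_def C_def D_def using t r by (intro jacobi_on_remove_sings) auto
  have nm: "S n nicely_meromorphic_on B n" "C n nicely_meromorphic_on B n" "D n nicely_meromorphic_on B n" for n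
    unfolding S_def C_def D_def B_def using t[of n]
    by (auto simp: jacobi_on_def intro!: remove_sings_nicely_meromorphic)
  have Bmono: "B m \<subseteq> B n" if "m \<le> n" for m n
    using that r unfolding B_def by (intro subset_ball) (auto intro: power_increasing)
  have B: "open (B n)" "connected (B n)" "0 \<in> B n" for n using r by (auto simp: B_def)
  have agree: "S m u = S n u \<and> C m u = C n u \<and> D m u = D n u" if "m \<le> n" "u \<in> B m" for m n u
  proof -
    have "eventually (\<lambda>u. S m u = S n u \<and> C m u = C n u \<and> D m u = D n u) (nhds 0)"
      by (rule jacobi_ode_unique_nhds[of k]) (use J[of m] J[of n] in \<open>auto simp: jacobi_on_def elim: eventually_mono\<close>)
    then have "eventually (\<lambda>u. S m u = S n u \<and> C m u = C n u \<and> D m u = D n u) (at 0)"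
      by (auto simp: eventually_at_filter elim: eventually_mono)
    then have ev: "eventually (\<lambda>u. S m u = S n u) (at 0)" "eventually (\<lambda>u. C m u = C n u) (at 0)"
                "eventually (\<lambda>u. D m u = D n u) (at 0)"
      by (auto simp: eventually_conj_iff)
    have "S n nicely_meromorphic_on B m" "C n nicely_meromorphic_on B m" "D n nicely_meromorphic_on B m"
      using nm Bmono[OF that(1)] by (auto intro: nicely_meromorphic_on_subset)
    then show ?thesis
      using nicely_meromorphic_eqI[OF _ _ B(1,2,3) _ that(2)] nm[of m] ev by metis
  qed
  have cover: "\<exists>n. u \<in> B n" for u
  proof -
    obtain n where "norm u / r < 2 ^ n" using real_arch_pow[of 2] by auto
    then show ?thesis using r by (auto simp: B_def field_simps)
  qed
  define N where "N = (\<lambda>u. LEAST n. u \<in> B n)"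
  define s c d where "s = (\<lambda>u. S (N u) u)" and "c = (\<lambda>u. C (N u) u)" and "d = (\<lambda>u. D (N u) u)"
  have eq: "s u = S n u" "c u = C n u" "d u = D n u" if "u \<in> B n" for u n
  proof -
    have "u \<in> B (N u)" "N u \<le> n"
      unfolding N_def using that by (auto intro: LeastI Least_le)
    then show "s u = S n u" "c u = C n u" "d u = D n u"
      using agree[of "N u" n u] by (auto simp: s_def c_def d_def)
  qed
  have evn: "eventually (\<lambda>u. s u = S n u) (nhds z)" "eventually (\<lambda>u. c u = C n u) (nhds z)"
            "eventually (\<lambda>u. d u = D n u) (nhds z)" if "z \<in> B n" for z n
    using eventually_nhds_in_open[OF B(1) that] by (auto elim!: eventually_mono simp: eq)
  have loc: "f nicely_meromorphic_on UNIV"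
    if f: "\<And>n. F n nicely_meromorphic_on B n" "\<And>z n. z \<in> B n \<Longrightarrow> eventually (\<lambda>u. f u = F n u) (nhds z)" 
    for f and F :: "nat \<Rightarrow> complex \<Rightarrow> complex"
  proof -
    have "f meromorphic_on {z} \<and> (is_pole f z \<and> f z = 0 \<or> f \<midarrow>z\<rightarrow> f z)" for z
    proof -
      obtain n where n: "z \<in> B n" using cover by blast
      have e: "eventually (\<lambda>u. f u = F n u) (at z)" and ez: "f z = F n z"
        using f(2)[OF n] by (auto simp: eventually_at_filter elim: eventually_mono dest: eventually_nhds_x_imp_x)
      have "F n meromorphic_on {z}"
        using f(1)[of n] n unfolding nicely_meromorphic_on_def by (auto intro: meromorphic_on_subset)
      then have "f meromorphic_on {z}"
        using e by (subst meromorphic_on_cong[of _ f "F n"]) auto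
      moreover have "is_pole f z \<longleftrightarrow> is_pole (F n) z"
        by (rule is_pole_cong[OF e refl])
      moreover have "f \<midarrow>z\<rightarrow> f z \<longleftrightarrow> F n \<midarrow>z\<rightarrow> F n z"
        unfolding ez by (rule tendsto_cong[OF e])
      ultimately show ?thesis using f(1)[of n] n ez by (auto simp: nicely_meromorphic_on_def)
    qed
    note * = this
    have "f meromorphic_on UNIV"
      by (subst meromorphic_on_meromorphic_at) (use * in blast)
    then show ?thesis
      unfolding nicely_meromorphic_on_def using * by blast
  qed
  have snm: "s nicely_meromorphic_on UNIV" and cnm: "c nicely_meromorphic_on UNIV"
    and dnm: "d nicely_meromorphic_on UNIV"
    by (rule loc[of S s, OF nm(1) evn(1)], assumption, rule loc[of C c, OF nm(2) evn(2)], assumption,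
        rule loc[of D d, OF nm(3) evn(3)], assumption)
  have ode: "jacobi_ode k s c d u" if np: "\<not> is_pole s u" "\<not> is_pole c u" "\<not> is_pole d u" for u
  proof -
    obtain n where n: "u \<in> B n" using cover by blast
    have an: "s analytic_on {u}" "c analytic_on {u}" "d analytic_on {u}"
      using nicely_meromorphic_on_imp_analytic_at[OF snm UNIV_I np(1)]
        nicely_meromorphic_on_imp_analytic_at[OF cnm UNIV_I np(2)]
        nicely_meromorphic_on_imp_analytic_at[OF dnm UNIV_I np(3)] by auto
    have "eventually (\<lambda>v. v \<in> B n) (at u)"
      using B(1) n by (intro eventually_at_in_open') auto
    moreover have "eventually (jacobi_ode k (S n) (C n) (D n)) (at u)"
      using J[of n] n unfolding jacobi_on_def B_def eventually_conj_iff by blast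
    ultimately have evode: "eventually (jacobi_ode k s c d) (at u)"
    proof eventually_elim
      case (elim v)
      then show ?case
        unfolding jacobi_ode_def eq[OF elim(1)] DERIV_cong_ev[OF refl evn(1)[OF elim(1)] refl]
          DERIV_cong_ev[OF refl evn(2)[OF elim(1)] refl] DERIV_cong_ev[OF refl evn(3)[OF elim(1)] refl]
        by blast
    qed
    have lim: "deriv f u = g u"
      if "f analytic_on {u}" "g analytic_on {u}" "eventually (\<lambda>v. (f has_field_derivative g v) (at v)) (at u)"
      for f g :: "complex \<Rightarrow> complex"
    proof -
      have "isCont (deriv f) u" "isCont g u"
        using that by (auto intro!: analytic_at_imp_isCont analytic_deriv)
      then have "deriv f \<midarrow>u\<rightarrow> deriv f u" "g \<midarrow>u\<rightarrow> g u" by (auto simp: isCont_def)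
      moreover have "eventually (\<lambda>v. deriv f v = g v) (at u)"
        using that(3) by eventually_elim (rule DERIV_imp_deriv)
      ultimately show ?thesis by (metis LIM_unique tendsto_cong)
    qed
    have fd: "(f has_field_derivative deriv f u) (at u)" if "f analytic_on {u}" for f :: "complex \<Rightarrow> complex"
      using that analytic_on_imp_differentiable_at[of f "{u}" u] by (simp add: field_differentiable_derivI)
    have "deriv s u = c u * d u"
      by (rule lim)
         (use an evode in \<open>unfold jacobi_ode_def eventually_conj_iff, auto intro!: analytic_intros\<close>)
    moreover have "deriv c u = - s u * d u"
      by (rule lim)
         (use an evode in \<open>unfold jacobi_ode_def eventually_conj_iff, auto intro!: analytic_intros\<close>)
    moreover have "deriv d u = - (of_real k)\<^sup>2 * s u * c u"
      by (rule lim)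
         (use an evode in \<open>unfold jacobi_ode_def eventually_conj_iff, auto intro!: analytic_intros\<close>)
    ultimately show ?thesis
      unfolding jacobi_ode_def using fd[OF an(1)] fd[OF an(2)] fd[OF an(3)] by simp
  qed
  have "s 0 = 0" "c 0 = 1" "d 0 = 1"
    using eq[OF B(3), of 0] J[of 0] by (auto simp: jacobi_on_def)
  moreover have "\<not> is_pole s 0"
  proof -
    have "S 0 analytic_on {0}"
      using J[of 0] unfolding jacobi_on_def jacobi_ode_def eventually_conj_iff by (auto dest: eventually_deriv_imp_analytic)
    then have "\<not> is_pole (S 0) 0" by (rule analytic_at_imp_no_pole)
    moreover have "eventually (\<lambda>u. s u = S 0 u) (at 0)"
      using evn(1)[OF B(3), of 0] by (auto simp: eventually_at_filter elim: eventually_mono)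
    ultimately show ?thesis using is_pole_cong[of s "S 0" 0 0] by simp
  qed
  ultimately have "is_jacobi_triple k s c d"
    unfolding is_jacobi_triple_def using snm cnm dnm ode[unfolded jacobi_ode_def] by blast
  then show ?thesis by blast
qed

theorem is_jacobi_triple_jacobi:
  "is_jacobi_triple k (\<lambda>u. jacobi_sn u k) (\<lambda>u. jacobi_cn u k) (\<lambda>u. jacobi_dn u k)"
proof -
  obtain s c d where J: "is_jacobi_triple k s c d"
    using is_jacobi_triple_exists by blast
  have "jacobi_triple k = (s, c, d)"
    unfolding jacobi_triple_def
  proof (rule the_equality)
    show "case (s, c, d) of (s, c, d) \<Rightarrow> is_jacobi_triple k s c d"
      using J by simp
  next
    fix t assume t: "case t of (s, c, d) \<Rightarrow> is_jacobi_triple k s c d"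
    obtain s' c' d' where "t = (s', c', d')" by (cases t)
    with t is_jacobi_triple_unique[OF J, of s' c' d'] show "t = (s, c, d)" by simp
  qed
  then show ?thesis
    using J by (simp add: jacobi_sn_def jacobi_cn_def jacobi_dn_def)
qed

end

theory Submission
  imports Defs
begin

text \<open>
  The function \<open>F = sn dn / cn\<close> satisfies \<open>F'\<^sup>2 = 1 + 2(1 - 2k\<^sup>2)F\<^sup>2 + F\<^sup>4\<close>, \<open>F(0) = 0\<close>, \<open>F'(0) = 1\<close>, and
  is determined by this. Uniqueness alone gives \<open>F(u + K) = -1/F(u)\<close> and \<open>F(u + iK') = 1/F(u)\<close>, and
  that \<open>F(p + u) = \<plusminus>1/F(u)\<close> at every pole \<open>p\<close>. Hence with \<open>\<alpha> = K + iK'\<close> the poles are the points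
  \<open>w j l = (j + 1/2)\<alpha> + (l + 1/2)cnj \<alpha>\<close>, with residue \<open>-(-1)\<^bsup>j+l\<^esup>\<close>, and integrating
  \<open>F(z)/z\<^bsup>2n+2\<^esup>\<close> over growing rhombi with sides parallel to \<open>\<alpha>\<close> and \<open>cnj \<alpha>\<close> gives
  \<open>F\<^bsup>(2n+1)\<^esup>(0)/(2n+1)!\<close> as the limit of the sums of \<open>(-1)\<^bsup>j+l\<^esup>/(w j l)\<^bsup>2n+2\<^esup>\<close> over
  \<open>-N \<le> j, l < N\<close>.

  On the other side, \<open>cosh(yK) + cos(yK') = 2 cosh(\<alpha>y/2) cosh(cnj \<alpha> y/2)\<close>, so on each half line
  the integrand expands into a double geometric series in \<open>y = \<surd>\<bar>x\<bar>\<close>. Its square partial sums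
  are at most 4 times its sum, so dominated convergence applies, and integrating
  the terms \<open>x\<^bsup>n\<^esup> exp(-w y)\<close> yields the same lattice sum, one half line giving the right and left
  quadrants of the lattice and the other one the upper and lower quadrants.
\<close>

section \<open>Uniqueness for a quartic differential equation\<close>

text \<open>\<open>F\<close> is the tangent of half the amplitude at the doubled argument, so
  \<open>F (K/2) = tan (pi/4) = 1\<close>; this is how the elliptic integral enters. The value 1 is
  fixed under inversion, and reflection in K/2 produces the half period. The quartic is even,
  palindromic and real, and x -> i x exchanges k and k'; hence sign change, inversion, conjugation
  and the imaginary transformation all act on solutions. The equation gives F' only up to sign, and
  uniqueness fails where F' = 0. Solutions are therefore compared only at points with nonzero slope:
  at 0, at K/2, and at poles after inversion. The obstacle is n = 0, where the lattice sum of 1/w^2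
  does not converge absolutely, so both sides must be exhausted in the same way. Squares in (j, l)
  serve both: they are exactly the lattice points inside a rhombus whose boundary avoids all poles,
  and the square partial sums of the double series factor into two geometric sums with a uniform
  bound.\<close>

text \<open>
  The difference \<open>h = f - g\<close> solves the linear equation \<open>h' = R h\<close>, where \<open>R\<close> is regular
  because \<open>f' + g'\<close> does not vanish at \<open>z\<close>.
\<close>
lemma quartic_ode_unique:
  fixes f g q :: "complex \<Rightarrow> complex"
  assumes an: "f analytic_on {z}" "g analytic_on {z}" "q analytic_on {z}"
    and init: "f z = g z" "deriv f z = deriv g z" "deriv f z \<noteq> 0"
    and f: "eventually (\<lambda>u. (deriv f u)\<^sup>2 = (1 + c * (f u)\<^sup>2 + (f u)^4) * q u) (nhds z)"
    and g: "eventually (\<lambda>u. (deriv g u)\<^sup>2 = (1 + c * (g u)\<^sup>2 + (g u)^4) * q u) (nhds z)"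
  shows "eventually (\<lambda>u. f u = g u) (nhds z)"
proof -
  define s where "s = (\<lambda>u. deriv f u + deriv g u)"
  define R where "R = (\<lambda>u. (f u + g u) * (c + (f u)\<^sup>2 + (g u)\<^sup>2) * q u / s u)"
  have sz: "s z \<noteq> 0" using init by (simp add: s_def)
  have san: "s analytic_on {z}" unfolding s_def by (intro analytic_intros an)
  have "eventually (\<lambda>u. s u \<noteq> 0) (nhds z)"
    using analytic_at_imp_isCont[OF san] sz
    by (auto simp: isCont_def intro: tendsto_imp_eventually_ne[of s] dest: tendsto_imp_eventually_ne
        simp: eventually_nhds_conv_at)
  moreover have "R analytic_on {z}"
    unfolding R_def by (intro analytic_intros an san) (use sz in auto)
  ultimately have "eventually (\<lambda>u. f analytic_on {u} \<and> g analytic_on {u} \<and> R analytic_on {u} \<and> s u \<noteq> 0 \<and>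
      (deriv f u)\<^sup>2 = (1 + c * (f u)\<^sup>2 + (f u)^4) * q u \<and>
      (deriv g u)\<^sup>2 = (1 + c * (g u)\<^sup>2 + (g u)^4) * q u) (nhds z)"
    using f g an by (simp add: eventually_conj_iff eventually_analytic_nhds)
  then obtain r where r: "r > 0" and *: "\<And>u. u \<in> ball z r \<Longrightarrow> f analytic_on {u} \<and> g analytic_on {u} \<and> R analytic_on {u} \<and> s u \<noteq> 0 \<and>
      (deriv f u)\<^sup>2 = (1 + c * (f u)\<^sup>2 + (f u)^4) * q u \<and>
      (deriv g u)\<^sup>2 = (1 + c * (g u)\<^sup>2 + (g u)^4) * q u"
    unfolding eventually_nhds_metric by (auto simp: dist_commute)
  have "R holomorphic_on ball z r"
    using * by (intro analytic_imp_holomorphic) (metis analytic_on_analytic_at)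
  then obtain B where B: "\<And>u. u \<in> ball z r \<Longrightarrow> (B has_field_derivative R u) (at u within ball z r)"
    using holomorphic_convex_primitive'[OF convex_ball open_ball] by blast
  \<comment> \<open>\<open>exp (- B u)\<close> is the integrating factor of h' = R h; the product is
    constant on the ball and vanishes at \<open>z\<close>.\<close>
  have "((\<lambda>u. (f u - g u) * exp (- B u)) has_field_derivative 0) (at u)"
    if u: "u \<in> ball z r" for u
  proof -
    have df: "(f has_field_derivative deriv f u) (at u within ball z r)"
      and dg: "(g has_field_derivative deriv g u) (at u within ball z r)"
      using *[OF u] by (meson analytic_on_imp_differentiable_at field_differentiable_derivI has_field_derivative_at_within singletonI)+
    have "(deriv f u - deriv g u) * s u = (deriv f u)\<^sup>2 - (deriv g u)\<^sup>2"
      by (simp add: s_def algebra_simps power2_eq_square)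
    also have "\<dots> = (f u - g u) * ((f u + g u) * (c + (f u)\<^sup>2 + (g u)\<^sup>2) * q u)"
      using *[OF u] by (simp add: algebra_simps power2_eq_square power4_eq_xxxx)
    also have "\<dots> = (f u - g u) * R u * s u"
      using *[OF u] by (simp add: R_def)
    finally have "deriv f u - deriv g u = (f u - g u) * R u" using *[OF u] by auto
    moreover have "((\<lambda>u. (f u - g u) * exp (- B u)) has_field_derivative
        ((deriv f u - deriv g u) - (f u - g u) * R u) * exp (- B u)) (at u within ball z r)"
      by (rule derivative_eq_intros df dg B u refl)+ (simp add: algebra_simps)
    ultimately show ?thesis using at_within_open[OF u open_ball] by simp
  qed
  then have "(\<lambda>u. (f u - g u) * exp (- B u)) constant_on ball z r"
    by (intro has_field_derivative_0_imp_constant_on) auto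
  then obtain C where C: "\<And>u. u \<in> ball z r \<Longrightarrow> (f u - g u) * exp (- B u) = C"
    by (auto simp: constant_on_def)
  have "C = 0" using C[of z] r init by simp
  then have "f u = g u" if "u \<in> ball z r" for u
    using C[OF that] by simp
  then show ?thesis
    using r by (auto simp: eventually_nhds_metric dist_commute)
qed

section \<open>Solutions normalised at the origin and their symmetries\<close>

definition sdc_poly :: "real \<Rightarrow> complex \<Rightarrow> complex" where
  "sdc_poly k x = 1 + 2 * (1 - 2 * (of_real k)\<^sup>2) * x\<^sup>2 + x ^ 4"

text \<open>The slope 1 at 0 selects a branch of the square root. Asking for the equation only near
  0 keeps verification local; \<open>is_sdc_ode\<close> extends it. Nice meromorphy also fixes the
  values at poles, so equal germs at 0 give equal functions.\<close>

definition is_sdc :: "real \<Rightarrow> (complex \<Rightarrow> complex) \<Rightarrow> bool" where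
  "is_sdc k F \<longleftrightarrow> F nicely_meromorphic_on UNIV \<and> F analytic_on {0} \<and> F 0 = 0 \<and> deriv F 0 = 1 \<and>
     eventually (\<lambda>u. (deriv F u)\<^sup>2 = sdc_poly k (F u)) (nhds 0)"

lemma nicely_meromorphic_eqI_nhds:
  fixes f g :: "complex \<Rightarrow> complex"
  assumes "f nicely_meromorphic_on UNIV" "g nicely_meromorphic_on UNIV"
    and "eventually (\<lambda>u. f u = g u) (nhds z)"
  shows "f = g"
  using nicely_meromorphic_eqI[OF assms(1,2) open_UNIV connected_UNIV UNIV_I] assms(3)
  by (auto simp: eventually_nhds_conv_at)

lemma is_sdc_unique:
  assumes "is_sdc k F" "is_sdc k G"
  shows "F = G"
proof (rule nicely_meromorphic_eqI_nhds)
  show "eventually (\<lambda>u. F u = G u) (nhds 0)"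
    by (rule quartic_ode_unique[where q = "\<lambda>_. 1" and c = "2 * (1 - 2 * (of_real k)\<^sup>2)"])
       (use assms in \<open>auto simp: is_sdc_def sdc_poly_def\<close>)
qed (use assms in \<open>auto simp: is_sdc_def\<close>)

lemma filterlim_affine_at:
  fixes a c z :: complex
  assumes "a \<noteq> 0"
  shows "filterlim (\<lambda>v. a * v + c) (at (a * z + c)) (at z)"
  unfolding filterlim_at using assms
  by (intro conjI tendsto_intros) (simp add: eventually_at_filter)

lemma nicely_meromorphic_affine:
  assumes "F nicely_meromorphic_on UNIV" "a \<noteq> 0"
  shows "(\<lambda>v. F (a * v + c)) nicely_meromorphic_on UNIV"
proof -
  have "(\<lambda>v. F (a * v + c)) meromorphic_on UNIV"
    by (rule meromorphic_on_compose[of F UNIV "\<lambda>v. a * v + c" UNIV])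
       (use assms in \<open>auto simp: nicely_meromorphic_on_def intro!: analytic_intros\<close>)
  moreover have "is_pole (\<lambda>v. F (a * v + c)) z" if "is_pole F (a * z + c)" for z
    using filterlim_compose[OF that[unfolded is_pole_def] filterlim_affine_at[OF assms(2)]]
    by (simp add: is_pole_def)
  moreover have "(\<lambda>v. F (a * v + c)) \<midarrow>z\<rightarrow> F (a * z + c)" if "F \<midarrow>a * z + c\<rightarrow> F (a * z + c)" for z
    using filterlim_compose[OF that filterlim_affine_at[OF assms(2)]] .
  ultimately show ?thesis
    using assms(1) by (auto simp: nicely_meromorphic_on_def)
qed

lemma analytic_deriv_affine:
  fixes f :: "complex \<Rightarrow> complex"
  assumes "f analytic_on {a * z + c}"
  shows "(\<lambda>v. f (a * v + c)) analytic_on {z}"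
    and "deriv (\<lambda>v. f (a * v + c)) z = a * deriv f (a * z + c)"
proof -
  show "(\<lambda>v. f (a * v + c)) analytic_on {z}"
    by (rule analytic_on_compose_gen[of "\<lambda>v. a * v + c" "{z}" f "{a * z + c}", unfolded o_def])
       (use assms in \<open>auto intro!: analytic_intros\<close>)
  have "(f has_field_derivative deriv f (a * z + c)) (at (a * z + c))"
    using assms by (meson analytic_on_imp_differentiable_at field_differentiable_derivI singletonI)
  moreover have "((\<lambda>v. a * v + c) has_field_derivative a) (at z)"
    by (auto intro!: derivative_eq_intros)
  ultimately have "((\<lambda>v. f (a * v + c)) has_field_derivative deriv f (a * z + c) * a) (at z)"
    by (rule DERIV_chain2)
  then show "deriv (\<lambda>v. f (a * v + c)) z = a * deriv f (a * z + c)"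
    by (simp add: DERIV_imp_deriv)
qed

text \<open>The condition \<open>a * b = 1\<close> preserves the slope at 0. It is applied with a =
  -1 for oddness and a = i for the imaginary transformation.\<close>

lemma is_sdc_scale:
  assumes "is_sdc k F" "a * b = 1" "a \<noteq> 0" "\<And>x. sdc_poly k x = sdc_poly k' (b * x)"
  shows "is_sdc k' (\<lambda>u. b * F (a * u))"
proof -
  have nm: "(\<lambda>u. F (a * u)) nicely_meromorphic_on UNIV"
    using nicely_meromorphic_affine[of F a 0] assms by (simp add: is_sdc_def)
  have an: "F analytic_on {0}" using assms by (simp add: is_sdc_def)
  have *: "(\<lambda>u. F (a * u)) analytic_on {u} \<and> deriv (\<lambda>u. b * F (a * u)) u = deriv F (a * u)"
    if "F analytic_on {a * u}" for u
    using analytic_deriv_affine[of F a u 0] that assms(2) by (simp add: deriv_cmult') (simp add: mult.commute mult.assoc[symmetric])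
  have "eventually (\<lambda>u. F analytic_on {u} \<and> (deriv F u)\<^sup>2 = sdc_poly k (F u)) (nhds 0)"
    using an assms(1) by (simp add: is_sdc_def eventually_conj_iff eventually_analytic_nhds)
  moreover have "filterlim (\<lambda>u. a * u) (nhds 0) (nhds 0)"
    by (auto intro!: tendsto_eq_intros filterlim_ident)
  ultimately have "eventually (\<lambda>u. F analytic_on {a * u} \<and> (deriv F (a * u))\<^sup>2 = sdc_poly k (F (a * u))) (nhds 0)"
    by (rule eventually_compose_filterlim)
  then have "eventually (\<lambda>u. (deriv (\<lambda>u. b * F (a * u)) u)\<^sup>2 = sdc_poly k' (b * F (a * u))) (nhds 0)"
    by eventually_elim (use * assms(4) in auto)
  then show ?thesis
    using nm *[of 0] assms(1) an unfolding is_sdc_def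
    by (simp add: nicely_meromorphic_on_cmult_left analytic_on_mult)
qed

lemma is_sdc_odd:
  assumes "is_sdc k F"
  shows "F (- u) = - F u"
proof -
  have "is_sdc k (\<lambda>u. (-1) * F ((-1) * u))"
    by (rule is_sdc_scale[OF assms]) (auto simp: sdc_poly_def)
  from fun_cong[OF is_sdc_unique[OF this assms], of u] have "- F (- u) = F u" by simp
  then show ?thesis by (metis minus_minus)
qed

text \<open>Jacobi's imaginary transformation: x -> -i x reverses the sign of the quadratic term,
  and 1 - 2k^2 = -(1 - 2k'^2).\<close>

lemma is_sdc_imaginary:
  assumes "is_sdc k F" "k\<^sup>2 + k'\<^sup>2 = 1"
  shows "is_sdc k' (\<lambda>u. - \<i> * F (\<i> * u))"
proof (rule is_sdc_scale[OF assms(1)])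
  have "complex_of_real (k\<^sup>2 + k'\<^sup>2) = 1" unfolding assms(2) by simp
  then have *: "(of_real k')\<^sup>2 = 1 - (complex_of_real k)\<^sup>2"
    by (simp add: algebra_simps)
  then show "sdc_poly k x = sdc_poly k' (- \<i> * x)" for x
    unfolding sdc_poly_def * by (simp add: power_mult_distrib algebra_simps)
qed auto

text \<open>Identity theorem for the defect \<open>D\<close> of the equation. Analyticity at
  \<open>u\<close> excludes poles, where \<open>F u\<close> is only the default value 0.\<close>

lemma is_sdc_ode:
  assumes "is_sdc k F" "F analytic_on {u}"
  shows "(deriv F u)\<^sup>2 = sdc_poly k (F u)"
proof -
  define D where "D = (\<lambda>u. (deriv F u)\<^sup>2 - sdc_poly k (F u))"
  have "D meromorphic_on UNIV"
    using assms unfolding D_def sdc_poly_def is_sdc_def nicely_meromorphic_on_def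
    by (auto intro!: meromorphic_intros)
  then have nm: "remove_sings D nicely_meromorphic_on UNIV"
    by (rule remove_sings_nicely_meromorphic)
  have D: "remove_sings D u = D u" if "F analytic_on {u}" for u
    using that unfolding D_def sdc_poly_def
    by (intro remove_sings_at_analytic) (auto intro!: analytic_intros)
  have "eventually (\<lambda>u. F analytic_on {u} \<and> (deriv F u)\<^sup>2 = sdc_poly k (F u)) (nhds 0)"
    using assms(1) by (simp add: is_sdc_def eventually_conj_iff eventually_analytic_nhds)
  then have "eventually (\<lambda>u. remove_sings D u = 0) (nhds 0)"
  proof eventually_elim
    case (elim u)
    then show ?case using D[of u] by (simp add: D_def)
  qed
  then have "remove_sings D = (\<lambda>_. 0)"
    by (intro nicely_meromorphic_eqI_nhds[OF nm]) auto
  then show ?thesis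
    using D[OF assms(2)] by (simp add: D_def fun_eq_iff)
qed

section \<open>Conjugation, half periods and poles\<close>

lemma analytic_deriv_cnj_cnj:
  assumes "f analytic_on {cnj z}"
  shows "(\<lambda>v. cnj (f (cnj v))) analytic_on {z}"
    and "deriv (\<lambda>v. cnj (f (cnj v))) z = cnj (deriv f (cnj z))"
proof -
  have der: "((\<lambda>v. cnj (f (cnj v))) has_field_derivative cnj (deriv f (cnj v))) (at v)"
    if "f analytic_on {cnj v}" for v
    using has_field_derivative_cnj_cnj[of f "deriv f (cnj v)" v] that
    by (simp add: o_def analytic_on_imp_differentiable_at field_differentiable_derivI)
  have "eventually (\<lambda>v. f analytic_on {cnj v}) (nhds z)"
    by (rule eventually_compose_filterlim[OF eventually_analytic_nhds[OF assms]])
       (auto intro!: tendsto_eq_intros filterlim_ident)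
  then have "eventually (\<lambda>v. ((\<lambda>v. cnj (f (cnj v))) has_field_derivative cnj (deriv f (cnj v))) (at v)) (nhds z)"
    by eventually_elim (rule der)
  then show "(\<lambda>v. cnj (f (cnj v))) analytic_on {z}"
    by (rule eventually_deriv_imp_analytic)
  show "deriv (\<lambda>v. cnj (f (cnj v))) z = cnj (deriv f (cnj z))"
    by (rule DERIV_imp_deriv[OF der[OF assms]])
qed

lemma nicely_meromorphic_cnj_cnj:
  assumes "F nicely_meromorphic_on UNIV"
  shows "(\<lambda>v. cnj (F (cnj v))) nicely_meromorphic_on UNIV"
proof (rule nicely_meromorphic_onI_open)
  define pts where "pts = {z. is_pole F (cnj z)}"
  show "(\<lambda>v. cnj (F (cnj v))) analytic_on UNIV - pts"
  proof (subst analytic_on_analytic_at, intro ballI)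
    fix z assume "z \<in> UNIV - pts"
    then have "F analytic_on {cnj z}"
      using assms by (intro nicely_meromorphic_on_imp_analytic_at) (auto simp: pts_def)
    then show "(\<lambda>v. cnj (F (cnj v))) analytic_on {z}"
      by (rule analytic_deriv_cnj_cnj)
  qed
  fix z
  have cnj_at: "filterlim cnj (at (cnj z)) (at z)"
    unfolding filterlim_at
    by (intro conjI tendsto_intros) (simp add: eventually_at_filter)
  show "is_pole (\<lambda>v. cnj (F (cnj v))) z \<and> cnj (F (cnj z)) = 0" if "z \<in> pts"
  proof
    have p: "is_pole F (cnj z)" using that by (simp add: pts_def)
    then have "filterlim (\<lambda>v. F (cnj v)) at_infinity (at z)"
      using cnj_at unfolding is_pole_def by (rule filterlim_compose)
    then show "is_pole (\<lambda>v. cnj (F (cnj v))) z"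
      unfolding is_pole_def filterlim_at_infinity_conv_norm_at_top by simp
    show "cnj (F (cnj z)) = 0"
      using p assms is_pole_zero_at_nicely_mero by fastforce
  qed
  have "isolated_singularity_at F (cnj z)"
    using assms by (auto simp: nicely_meromorphic_on_def meromorphic_on_altdef)
  then obtain r where r: "r > 0" "F analytic_on ball (cnj z) r - {cnj z}"
    by (auto simp: isolated_singularity_at_def)
  have "(\<lambda>v. cnj (F (cnj v))) analytic_on ball z r - {z}"
  proof (subst analytic_on_analytic_at, intro ballI)
    fix w assume "w \<in> ball z r - {z}"
    then have "cnj w \<in> ball (cnj z) r - {cnj z}"
      by (auto simp: dist_norm simp flip: complex_cnj_diff)
    then have "F analytic_on {cnj w}"
      using r(2) by (auto intro: analytic_on_subset)
    then show "(\<lambda>v. cnj (F (cnj v))) analytic_on {w}"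
      by (rule analytic_deriv_cnj_cnj)
  qed
  then show "isolated_singularity_at (\<lambda>v. cnj (F (cnj v))) z"
    using r by (auto simp: isolated_singularity_at_def)
qed auto

text \<open>The quartic has real coefficients, so the conjugated function solves the same problem
  and uniqueness applies.\<close>

lemma is_sdc_cnj:
  assumes "is_sdc k F"
  shows "F (cnj u) = cnj (F u)"
proof -
  have nm: "F nicely_meromorphic_on UNIV" and an: "F analytic_on {0}"
    using assms by (auto simp: is_sdc_def)
  have ode: "eventually (\<lambda>u. F analytic_on {u} \<and> (deriv F u)\<^sup>2 = sdc_poly k (F u)) (nhds 0)"
    using assms by (simp add: is_sdc_def eventually_conj_iff eventually_analytic_nhds)
  have "eventually (\<lambda>u. F analytic_on {cnj u} \<and> (deriv F (cnj u))\<^sup>2 = sdc_poly k (F (cnj u))) (nhds 0)"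
    by (rule eventually_compose_filterlim[OF ode])
       (auto intro!: tendsto_eq_intros filterlim_ident)
  then have "eventually (\<lambda>u. (deriv (\<lambda>v. cnj (F (cnj v))) u)\<^sup>2 = sdc_poly k (cnj (F (cnj u)))) (nhds 0)"
  proof eventually_elim
    case (elim u)
    then have "(deriv (\<lambda>v. cnj (F (cnj v))) u)\<^sup>2 = cnj (sdc_poly k (F (cnj u)))"
      by (simp add: analytic_deriv_cnj_cnj flip: complex_cnj_power)
    then show ?case by (simp add: sdc_poly_def)
  qed
  then have "is_sdc k (\<lambda>v. cnj (F (cnj v)))"
    using assms analytic_deriv_cnj_cnj[of F 0] an unfolding is_sdc_def
    by (simp add: nicely_meromorphic_cnj_cnj)
  from fun_cong[OF is_sdc_unique[OF this assms], of u] show ?thesis by (metis complex_cnj_cnj)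
qed

text \<open>The quartic is palindromic. Since (1/F)'^2 = F'^2 / F^4, this is exactly what makes 1/F
  satisfy the equation of \<open>F\<close>.\<close>

lemma sdc_poly_inverse:
  "x \<noteq> 0 \<Longrightarrow> sdc_poly k (inverse x) = sdc_poly k x / x ^ 4"
  by (simp add: sdc_poly_def field_simps power2_eq_square power4_eq_xxxx)

lemma is_sdc_inverse_ode:
  assumes F: "is_sdc k F" "F analytic_on {a * v + c}" "F (a * v + c) \<noteq> 0"
  shows "(\<lambda>v. inverse (F (a * v + c))) analytic_on {v}"
    and "deriv (\<lambda>v. inverse (F (a * v + c))) v = - a * deriv F (a * v + c) / (F (a * v + c))\<^sup>2"
    and "(deriv (\<lambda>v. inverse (F (a * v + c))) v)\<^sup>2 = a\<^sup>2 * sdc_poly k (inverse (F (a * v + c)))"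
proof -
  note an = analytic_deriv_affine[OF F(2)]
  show "(\<lambda>v. inverse (F (a * v + c))) analytic_on {v}"
    using an F(3) by (intro analytic_on_inverse) auto
  have "((\<lambda>v. F (a * v + c)) has_field_derivative a * deriv F (a * v + c)) (at v)"
    using an by (metis analytic_on_imp_differentiable_at field_differentiable_derivI singletonI)
  from DERIV_inverse'[OF this F(3)]
  show *: "deriv (\<lambda>v. inverse (F (a * v + c))) v = - a * deriv F (a * v + c) / (F (a * v + c))\<^sup>2"
    by (intro DERIV_imp_deriv) (simp add: field_simps power2_eq_square)
  show "(deriv (\<lambda>v. inverse (F (a * v + c))) v)\<^sup>2 = a\<^sup>2 * sdc_poly k (inverse (F (a * v + c)))"
    unfolding * sdc_poly_inverse[OF F(3)] is_sdc_ode[OF F(1,2), symmetric]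
    by (simp add: power_divide power_mult_distrib)
qed

text \<open>
  Nicely meromorphic functions vanish at their poles and \<open>inverse 0 = 0\<close>, so identities of this kind
  hold at the zeros and poles of \<open>F\<close> as well.
\<close>
lemma is_sdc_half_period:
  assumes F: "is_sdc k F" "k\<^sup>2 \<noteq> 1" and h: "F analytic_on {h}" "F h = 1"
  shows "F (2 * h + v) = - inverse (F v)"
proof -
  \<comment> \<open>Reflection in \<open>h\<close>: F(h + v) and 1/F(h - v) have the same value 1
    and, as inversion has derivative -1 at 1, the same slope at v = 0. Evaluating their equality at
    h + v and using oddness gives the claim.\<close>
  define f where "f = (\<lambda>v. F (1 * v + h))"
  define g where "g = (\<lambda>v. inverse (F ((-1) * v + h)))"
  have nm: "f nicely_meromorphic_on UNIV" "g nicely_meromorphic_on UNIV"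
    unfolding f_def g_def using F(1) unfolding is_sdc_def
    by (intro nicely_meromorphic_on_inverse nicely_meromorphic_affine; simp)+
  have ev: "eventually (\<lambda>u. F analytic_on {u} \<and> F u \<noteq> 0) (nhds h)"
  proof -
    have "eventually (\<lambda>u. F u \<noteq> 0) (nhds h)"
      using analytic_at_imp_isCont[OF h(1)] h(2)
      using tendsto_imp_eventually_ne[of F "F h" "at h" 0] by (simp add: isCont_def eventually_nhds_conv_at)
    then show ?thesis using h by (simp add: eventually_conj_iff eventually_analytic_nhds)
  qed
  have "eventually (\<lambda>v. f v = g v) (nhds 0)"
  proof (rule quartic_ode_unique[where q = "\<lambda>_. 1" and c = "2 * (1 - 2 * (of_real k)\<^sup>2)"])
    \<comment> \<open>The quartic at 1 is 4 - 4k^2. Its not vanishing is what allows uniqueness at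
      \<open>h\<close>.\<close>
    have D: "(deriv F h)\<^sup>2 = 4 - 4 * (of_real k)\<^sup>2"
      using is_sdc_ode[OF F(1) h(1)] h(2) by (simp add: sdc_poly_def)
    have "deriv F h \<noteq> 0"
    proof
      assume "deriv F h = 0"
      then have "complex_of_real (k\<^sup>2) = of_real 1" using D by simp
      then show False using F(2) unfolding of_real_eq_iff by simp
    qed
    moreover have df: "deriv f 0 = deriv F h"
      unfolding f_def using analytic_deriv_affine(2)[of F 1 0 h] h by simp
    ultimately show "deriv f 0 \<noteq> 0" by simp
    show "deriv f 0 = deriv g 0"
      unfolding df unfolding g_def using is_sdc_inverse_ode(2)[OF F(1), of "-1" 0 h] h by simp
    show "f analytic_on {0}"
      unfolding f_def using analytic_deriv_affine(1)[of F 1 0 h] h by simp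
    show "g analytic_on {0}"
      unfolding g_def using is_sdc_inverse_ode(1)[OF F(1), of "-1" 0 h] h by simp
    have "eventually (\<lambda>v. F analytic_on {1 * v + h} \<and> F (1 * v + h) \<noteq> 0) (nhds 0)"
      by (rule eventually_compose_filterlim[OF ev])
         (auto intro!: tendsto_eq_intros filterlim_ident)
    then show "eventually (\<lambda>u. (deriv f u)\<^sup>2 = (1 + 2 * (1 - 2 * (of_real k)\<^sup>2) * (f u)\<^sup>2 + (f u)^4) * 1) (nhds 0)"
    proof eventually_elim
      case (elim u)
      then show ?case
        unfolding f_def using analytic_deriv_affine(2)[of F 1 u h] is_sdc_ode[OF F(1), of "1 * u + h"]
        by (simp add: sdc_poly_def)
    qed
    have "eventually (\<lambda>v. F analytic_on {(-1) * v + h} \<and> F ((-1) * v + h) \<noteq> 0) (nhds 0)"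
      by (rule eventually_compose_filterlim[OF ev])
         (auto intro!: tendsto_eq_intros filterlim_ident)
    then show "eventually (\<lambda>u. (deriv g u)\<^sup>2 = (1 + 2 * (1 - 2 * (of_real k)\<^sup>2) * (g u)\<^sup>2 + (g u)^4) * 1) (nhds 0)"
    proof eventually_elim
      case (elim u)
      then show ?case
        unfolding g_def using is_sdc_inverse_ode(3)[OF F(1), of "-1" u h]
        by (simp add: sdc_poly_def)
    qed
  qed (auto simp: f_def g_def h)
  then have "f = g" by (rule nicely_meromorphic_eqI_nhds[OF nm])
  from fun_cong[OF this, of "h + v"] show ?thesis
    by (simp add: f_def g_def is_sdc_odd[OF F(1)] algebra_simps)
qed

text \<open>Near a pole, v -> 1/F(p + v) extends by 0 and satisfies the equation, so its slope
  \<open>e\<close> at 0 has e^2 = 1. After multiplication by \<open>e\<close> it is normalised like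
  \<open>F\<close> and hence equals \<open>F\<close>.\<close>

lemma is_sdc_pole:
  assumes F: "is_sdc k F" "is_pole F p"
  shows "(\<forall>v. F (p + v) = inverse (F v)) \<or> (\<forall>v. F (p + v) = - inverse (F v))"
proof -
  define g where "g = (\<lambda>v. inverse (F (1 * v + p)))"
  have nmF: "F nicely_meromorphic_on UNIV" using F by (simp add: is_sdc_def)
  then have nm: "g nicely_meromorphic_on UNIV"
    unfolding g_def by (intro nicely_meromorphic_on_inverse nicely_meromorphic_affine) auto
  \<comment> \<open>The default value at the pole and \<open>inverse 0 = 0\<close> give g(0) = 0,
    which is also the limit of \<open>g\<close> at 0.\<close>
  have Fp: "F p = 0" using is_pole_zero_at_nicely_mero[OF nmF F(2)] by simp
  have at0: "filterlim (\<lambda>v. 1 * v + p) (at p) (at 0)"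
    using filterlim_affine_at[of 1 p 0] by simp
  have "filterlim F at_infinity (at p)" using F(2) by (simp add: is_pole_def)
  then have "filterlim (\<lambda>v. F (1 * v + p)) at_infinity (at 0)"
    using at0 by (rule filterlim_compose)
  then have g0: "(g \<longlongrightarrow> 0) (at 0)"
    unfolding g_def by (rule filterlim_compose[OF tendsto_inverse_0])
  then have "\<not> is_pole g 0"
    unfolding is_pole_def using not_tendsto_and_filterlim_at_infinity[OF _ g0] by auto
  then have gan: "g analytic_on {0}"
    using nm by (intro nicely_meromorphic_on_imp_analytic_at) auto
  have "eventually (\<lambda>u. F u \<noteq> 0) (at p)"
    using F(2) by (rule non_zero_neighbour_pole)
  moreover have "eventually (\<lambda>u. F analytic_on {u}) (at p)"
  proof -
    have "isolated_singularity_at F p"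
      using nmF by (auto simp: nicely_meromorphic_on_def meromorphic_on_altdef)
    then obtain r where "r > 0" "F analytic_on ball p r - {p}"
      by (auto simp: isolated_singularity_at_def)
    then show ?thesis
      by (auto simp: eventually_at dist_commute intro!: exI[of _ r] intro: analytic_on_subset)
  qed
  ultimately have "eventually (\<lambda>u. F analytic_on {u} \<and> F u \<noteq> 0) (at p)"
    by (rule eventually_conj[rotated])
  then have "eventually (\<lambda>v. F analytic_on {1 * v + p} \<and> F (1 * v + p) \<noteq> 0) (at 0)"
    using at0 by (rule eventually_compose_filterlim)
  then have ode_at: "eventually (\<lambda>v. (deriv g v)\<^sup>2 = sdc_poly k (g v)) (at 0)"
  proof eventually_elim
    case (elim v)
    then show ?case using is_sdc_inverse_ode(3)[OF F(1), of 1 v p] by (simp add: g_def)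
  qed
  \<comment> \<open>At v = 0 itself the inverse rule is not applicable, because \<open>F\<close> has
    a pole there; the equation is obtained by continuity.\<close>
  have "(\<lambda>v. (deriv g v)\<^sup>2 - sdc_poly k (g v)) analytic_on {0}"
    unfolding sdc_poly_def using gan by (auto intro!: analytic_intros)
  then have "((\<lambda>v. (deriv g v)\<^sup>2 - sdc_poly k (g v)) \<longlongrightarrow> (deriv g 0)\<^sup>2 - sdc_poly k (g 0)) (at 0)"
    by (auto dest: analytic_at_imp_isCont simp: isCont_def)
  moreover have "((\<lambda>v. (deriv g v)\<^sup>2 - sdc_poly k (g v)) \<longlongrightarrow> 0) (at 0)"
    using ode_at by (intro tendsto_eventually) (auto elim: eventually_mono)
  ultimately have ode0: "(deriv g 0)\<^sup>2 = sdc_poly k (g 0)"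
    using tendsto_unique[of "at (0::complex)"] by fastforce
  then have ode: "eventually (\<lambda>v. (deriv g v)\<^sup>2 = sdc_poly k (g v)) (nhds 0)"
    using ode_at by (simp add: eventually_nhds_conv_at)
  define e where "e = deriv g 0"
  have g00: "g 0 = 0" by (simp add: g_def Fp)
  have e2: "e\<^sup>2 = 1" using ode0 g00 by (simp add: e_def sdc_poly_def)
  have "eventually (\<lambda>v. g analytic_on {v}) (nhds 0)"
    using gan by (rule eventually_analytic_nhds)
  then have "eventually (\<lambda>v. (deriv (\<lambda>v. e * g v) v)\<^sup>2 = sdc_poly k (e * g v)) (nhds 0)"
    using ode
  proof eventually_elim
    case (elim v)
    have "e ^ 4 = 1" using e2 by (simp add: power4_eq_xxxx power2_eq_square)
    then show ?case using elim e2 by (simp add: deriv_cmult' power_mult_distrib sdc_poly_def)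
  qed
  moreover have "deriv (\<lambda>v. e * g v) 0 = 1"
    using gan e2 by (simp add: deriv_cmult' power2_eq_square flip: e_def)
  ultimately have "is_sdc k (\<lambda>v. e * g v)"
    using nm gan g00 by (auto simp: is_sdc_def intro!: analytic_on_mult)
  then have eq: "F = (\<lambda>v. e * g v)" by (rule is_sdc_unique[OF F(1)])
  have *: "F v = e * inverse (F (p + v))" for v
  proof -
    have "F v = e * g v" by (rule fun_cong[OF eq])
    also have "g v = inverse (F (p + v))" by (simp add: g_def add.commute)
    finally show ?thesis .
  qed
  have "e = 1 \<or> e = -1" using e2 by (rule power2_eq_1_iff[THEN iffD1])
  then show ?thesis
  proof
    assume "e = 1"
    then have "F (p + v) = inverse (F v)" for v using *[of v] by simp
    then show ?thesis by blast
  next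
    assume "e = -1"
    then have "F (p + v) = - inverse (F v)" for v using *[of v] by simp
    then show ?thesis by blast
  qed
qed

section \<open>Inverting the elliptic integral\<close>

lemma filterlim_at_of_deriv_nonzero:
  fixes f :: "complex \<Rightarrow> complex"
  assumes "(f has_field_derivative D) (at z)" "D \<noteq> 0"
  shows "filterlim f (at (f z)) (at z)"
  unfolding filterlim_at
proof
  show "(f \<longlongrightarrow> f z) (at z)"
    using DERIV_isCont[OF assms(1)] by (simp add: isCont_def)
  have "((\<lambda>w. (f w - f z) / (w - z)) \<longlongrightarrow> D) (at z)"
    using assms(1) by (simp add: has_field_derivative_iff)
  from tendsto_imp_eventually_ne[OF this assms(2)]
  show "eventually (\<lambda>x. f x \<in> UNIV \<and> f x \<noteq> f z) (at z)"
    by eventually_elim auto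
qed

text \<open>For s = sin(z/2) and c = cos(z/2) the term \<open>2 * s * c\<close> is sin z and
  \<open>1 / (2 * c\<^sup>2)\<close> is the derivative of tan(z/2). The quartic in s/c is ((s^2 +
  c^2)^2 - a (2sc)^2) / c^4.\<close>

lemma half_angle_quartic:
  fixes s c a :: complex
  assumes "s\<^sup>2 + c\<^sup>2 = 1" "c \<noteq> 0" "1 - a * (2 * s * c)\<^sup>2 \<noteq> 0"
  shows "(1 / (2 * c\<^sup>2))\<^sup>2 = (1 + 2 * (1 - 2 * a) * (s / c)\<^sup>2 + (s / c) ^ 4) * (1 / (4 * (1 - a * (2 * s * c)\<^sup>2)))"
proof -
  have "1 + 2 * (1 - 2 * a) * (s / c)\<^sup>2 + (s / c) ^ 4 = ((s\<^sup>2 + c\<^sup>2)\<^sup>2 - a * (2 * s * c)\<^sup>2) / c ^ 4"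
    using assms(2) by (simp add: field_simps power2_eq_square power4_eq_xxxx)
  also have "\<dots> = (1 - a * (2 * s * c)\<^sup>2) / c ^ 4" by (simp add: assms(1))
  finally show ?thesis
    using assms(2,3) by (simp add: field_simps power2_eq_square power4_eq_xxxx)
qed

text \<open>
  Both \<open>F \<circ> \<Psi>\<close> and \<open>tan (z/2)\<close> solve \<open>y'\<^sup>2 = (1 + 2(1 - 2k\<^sup>2)y\<^sup>2 + y\<^sup>4) q(z)\<close> with
  \<open>q(z) = 1 / (4(1 - k\<^sup>2 sin\<^sup>2 z))\<close>.
\<close>
lemma is_sdc_tan_half:
  fixes \<Psi> :: "complex \<Rightarrow> complex"
  assumes F: "is_sdc k F"
    and S: "open S" "connected S" "0 \<in> S"
    and nz: "\<And>z. z \<in> S \<Longrightarrow> 1 - (of_real k)\<^sup>2 * (sin z)\<^sup>2 \<noteq> 0" "\<And>z. z \<in> S \<Longrightarrow> cos (z / 2) \<noteq> 0"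
    and r: "\<And>z. z \<in> S \<Longrightarrow> (r z)\<^sup>2 = 1 / (1 - (of_real k)\<^sup>2 * (sin z)\<^sup>2)" "r 0 = 1"
    and \<Psi>: "\<And>z. z \<in> S \<Longrightarrow> (\<Psi> has_field_derivative r z / 2) (at z)" "\<Psi> 0 = 0"
    and w: "w \<in> S"
  shows "F analytic_on {\<Psi> w}" "F (\<Psi> w) = tan (w / 2)"
proof -
  define y where "y = (\<lambda>z. F (\<Psi> z))"
  define T where "T = (\<lambda>z::complex. tan (z / 2))"
  have nmF: "F nicely_meromorphic_on UNIV" and an: "F analytic_on {0}" using F by (auto simp: is_sdc_def)
  have \<Psi>an: "\<Psi> analytic_on S"
    using \<Psi>(1) S(1) by (subst analytic_on_open) (auto simp: holomorphic_on_open)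
  have ym: "y meromorphic_on S"
    unfolding y_def using nmF \<Psi>an
    by (intro meromorphic_on_compose[of F UNIV \<Psi> S]) (auto simp: nicely_meromorphic_on_def)
  have dT: "(T has_field_derivative 1 / (2 * (cos (z/2))\<^sup>2)) (at z)" if "z \<in> S" for z
  proof -
    have "((\<lambda>z. z / 2) has_field_derivative 1 / 2) (at z)"
      by (auto intro!: derivative_eq_intros)
    from DERIV_chain2[OF DERIV_tan[OF nz(2)[OF that]] this] show ?thesis
      by (simp add: T_def field_simps)
  qed
  have Tan: "T analytic_on S"
    using dT S(1) by (subst analytic_on_open) (auto simp: holomorphic_on_open)
  have dy: "(y has_field_derivative deriv F (\<Psi> z) * (r z / 2)) (at z)"
    if "z \<in> S" "F analytic_on {\<Psi> z}" for z
  proof -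
    have "(F has_field_derivative deriv F (\<Psi> z)) (at (\<Psi> z))"
      using that by (simp add: analytic_on_imp_differentiable_at field_differentiable_derivI)
    from DERIV_chain2[OF this \<Psi>(1)[OF that(1)]] show ?thesis by (simp add: y_def)
  qed
  have evS: "eventually (\<lambda>z. z \<in> S) (nhds 0)" using S by (intro eventually_nhds_in_open) auto
  have "(\<Psi> \<longlongrightarrow> \<Psi> 0) (nhds 0)"
    using DERIV_isCont[OF \<Psi>(1)[OF S(3)]] by (simp only: isCont_def tendsto_at_iff_tendsto_nhds)
  then have "(\<Psi> \<longlongrightarrow> 0) (nhds 0)" by (simp only: \<Psi>(2))
  from eventually_compose_filterlim[OF eventually_analytic_nhds[OF an] this]
  have evF: "eventually (\<lambda>z. F analytic_on {\<Psi> z}) (nhds 0)" .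
  have y0: "y analytic_on {0}"
  proof (rule eventually_deriv_imp_analytic)
    show "eventually (\<lambda>z. (y has_field_derivative deriv F (\<Psi> z) * (r z / 2)) (at z)) (nhds 0)"
      using evS evF by eventually_elim (rule dy)
  qed
  have yT: "eventually (\<lambda>z. y z = T z) (nhds 0)"
  proof (rule quartic_ode_unique[where q = "\<lambda>z. 1 / (4 * (1 - (of_real k)\<^sup>2 * (sin z)\<^sup>2))"
        and c = "2 * (1 - 2 * (of_real k)\<^sup>2)"])
    show "T analytic_on {0}" using Tan S(3) by (auto intro: analytic_on_subset)
    show "(\<lambda>z. 1 / (4 * (1 - (of_real k)\<^sup>2 * (sin z)\<^sup>2))) analytic_on {0}"
      by (intro analytic_intros) auto
    have y': "deriv y 0 = 1 / 2"
      using DERIV_imp_deriv[OF dy[OF S(3)]] an F by (simp add: \<Psi>(2) r(2) is_sdc_def)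
    moreover have "deriv T 0 = 1 / 2"
      using DERIV_imp_deriv[OF dT[OF S(3)]] by simp
    ultimately show "deriv y 0 = deriv T 0" by (simp only:)
    show "deriv y 0 \<noteq> 0" unfolding y' by simp
    show "y 0 = T 0" using F by (simp add: y_def T_def \<Psi>(2) is_sdc_def)
    show "eventually (\<lambda>u. (deriv y u)\<^sup>2 = (1 + 2 * (1 - 2 * (of_real k)\<^sup>2) * (y u)\<^sup>2 + (y u)^4) *
        (1 / (4 * (1 - (of_real k)\<^sup>2 * (sin u)\<^sup>2)))) (nhds 0)"
      using evS evF
    proof eventually_elim
      case (elim u)
      have "(deriv y u)\<^sup>2 = (deriv F (\<Psi> u))\<^sup>2 * (r u)\<^sup>2 / 4"
        unfolding DERIV_imp_deriv[OF dy[OF elim]] by (simp add: power_mult_distrib power_divide)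
      then show ?case
        using is_sdc_ode[OF F elim(2)] r(1)[OF elim(1)] by (simp add: sdc_poly_def y_def)
    qed
    show "eventually (\<lambda>u. (deriv T u)\<^sup>2 = (1 + 2 * (1 - 2 * (of_real k)\<^sup>2) * (T u)\<^sup>2 + (T u)^4) *
        (1 / (4 * (1 - (of_real k)\<^sup>2 * (sin u)\<^sup>2)))) (nhds 0)"
      using evS
    proof eventually_elim
      case (elim u)
      have "sin u = 2 * sin (u/2) * cos (u/2)" using sin_double[of "u/2"] by simp
      then show ?case
        using half_angle_quartic[of "sin (u/2)" "cos (u/2)" "(of_real k)\<^sup>2"] nz[OF elim]
          DERIV_imp_deriv[OF dT[OF elim]]
        by (simp only: T_def tan_def) simp
    qed
  qed fact+
  \<comment> \<open>A priori \<Psi> may run into poles of \<open>F\<close>, so \<open>y\<close> is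
    known only to be meromorphic on \<open>S\<close>; the identity theorem is applied after removing
    singularities.\<close>
  have nm: "remove_sings y nicely_meromorphic_on S"
    by (rule remove_sings_nicely_meromorphic[OF ym])
  have Tnm: "T nicely_meromorphic_on S"
    by (rule analytic_on_imp_nicely_meromorphic_on[OF Tan])
  have "eventually (\<lambda>z. y analytic_on {z}) (nhds 0)"
    by (rule eventually_analytic_nhds[OF y0])
  then have "eventually (\<lambda>z. remove_sings y z = T z) (nhds 0)"
    using yT by eventually_elim simp
  then have rT: "remove_sings y z = T z" if "z \<in> S" for z
    using nicely_meromorphic_eqI[OF nm Tnm S _ that] by (simp add: eventually_nhds_conv_at)
  have "isolated_singularity_at y w"
    using ym w by (auto simp: meromorphic_on_altdef)
  from eventually_remove_sings_eq_at[OF this] eventually_at_in_open'[OF S(1) w]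
  have "eventually (\<lambda>z. y z = T z) (at w)"
    by eventually_elim (simp add: rT)
  moreover have "(T \<longlongrightarrow> T w) (at w)"
    using DERIV_isCont[OF dT[OF w]] by (simp add: isCont_def)
  ultimately have yw: "(y \<longlongrightarrow> T w) (at w)"
    by (simp add: tendsto_cong)
  have "r w \<noteq> 0" using r(1)[OF w] nz(1)[OF w] by auto
  then have \<Psi>w: "filterlim \<Psi> (at (\<Psi> w)) (at w)"
    by (intro filterlim_at_of_deriv_nonzero[OF \<Psi>(1)[OF w]]) simp
  \<comment> \<open>\<Psi> avoids the value \<Psi> w in a punctured neighbourhood of
    \<open>w\<close>, so a pole there would make \<open>y\<close> unbounded near \<open>w\<close>,
    although it tends to \<open>T w\<close>.\<close>
  have np: "\<not> is_pole F (\<Psi> w)"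
  proof
    assume "is_pole F (\<Psi> w)"
    then have "filterlim y at_infinity (at w)"
      unfolding y_def is_pole_def using \<Psi>w by (rule filterlim_compose)
    then show False using not_tendsto_and_filterlim_at_infinity[OF _ yw] by auto
  qed
  then show "F analytic_on {\<Psi> w}"
    using nmF by (intro nicely_meromorphic_on_imp_analytic_at) auto
  have "(F \<longlongrightarrow> F (\<Psi> w)) (at (\<Psi> w))"
    using nmF np by (auto simp: nicely_meromorphic_on_def)
  then have "(y \<longlongrightarrow> F (\<Psi> w)) (at w)"
    unfolding y_def using \<Psi>w by (rule filterlim_compose)
  then show "F (\<Psi> w) = tan (w / 2)"
    using tendsto_unique[OF _ _ yw] by (simp add: T_def)
qed

text \<open>Legendre's incomplete elliptic integral of the first kind, with amplitude
  \<phi>.\<close>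

definition elliptic_F :: "real \<Rightarrow> real \<Rightarrow> real" where
  "elliptic_F k \<phi> = integral {0..\<phi>} (\<lambda>\<theta>. 1 / sqrt (1 - k\<^sup>2 * (sin \<theta>)\<^sup>2))"

lemma elliptic_integrand_pos:
  assumes "k\<^sup>2 < (1::real)"
  shows "0 < 1 - k\<^sup>2 * (sin \<theta>)\<^sup>2"
proof -
  have "k\<^sup>2 * (sin \<theta>)\<^sup>2 \<le> k\<^sup>2 * 1"
    by (intro mult_left_mono) (auto simp: abs_square_le_1)
  then show ?thesis using assms by linarith
qed

lemma elliptic_integrand_continuous:
  assumes "k\<^sup>2 < (1::real)"
  shows "continuous_on A (\<lambda>\<theta>. 1 / sqrt (1 - k\<^sup>2 * (sin \<theta>)\<^sup>2))"
proof (intro continuous_intros ballI)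
  fix \<theta> show "sqrt (1 - k\<^sup>2 * (sin \<theta>)\<^sup>2) \<noteq> 0"
    using elliptic_integrand_pos[OF assms, of \<theta>] by (metis less_irrefl real_sqrt_eq_0_iff)
qed

text \<open>\<open>is_sdc_tan_half\<close> works on a connected open set carrying a primitive. A
  thin convex neighbourhood of [0, pi/2] supplies both, and on the real segment the primitive is the
  elliptic integral.\<close>

lemma is_sdc_elliptic_F:
  assumes F: "is_sdc k F" and k: "k\<^sup>2 < 1" and \<theta>: "\<theta> \<in> {0..pi/2}"
  shows "F analytic_on {of_real (elliptic_F k \<theta> / 2)}" "F (of_real (elliptic_F k \<theta> / 2)) = of_real (tan (\<theta> / 2))"
proof -
  define h where "h = (\<lambda>z::complex. 1 - (of_real k)\<^sup>2 * (sin z)\<^sup>2)"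
  define A where "A = closed_segment (0::complex) (of_real (pi/2))"
  define U where "U = h -` (- \<real>\<^sub>\<le>\<^sub>0) \<inter> (\<lambda>z. cos (z / 2)) -` (- {0})"
  have inA: "of_real t \<in> A" if "t \<in> {0..pi/2}" for t
    using that of_real_closed_segment[of t 0 "pi/2", where 'a = complex] unfolding A_def
    by (simp add: closed_segment_eq_real_ivl)
  have A_real: "\<exists>t\<in>{0..pi/2}. z = of_real t" if "z \<in> A" for z
    using that unfolding A_def by (auto simp: closed_segment_def scaleR_conv_of_real intro!: bexI[of _ "_ * (pi/2)"] mult_left_le_one_le)
  have h_real: "h (of_real t) = of_real (1 - k\<^sup>2 * (sin t)\<^sup>2)" for t
    by (simp add: h_def sin_of_real)
  have oU: "open U" unfolding U_def h_def
    by (intro open_Int open_vimage) (auto intro!: continuous_intros)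
  have AU: "A \<subseteq> U"
  proof
    fix z assume "z \<in> A"
    then obtain t where t: "t \<in> {0..pi/2}" "z = of_real t" using A_real by blast
    have "cos (z / 2) = of_real (cos (t / 2))" using t(2) by (simp add: cos_of_real[symmetric])
    moreover have "cos (t / 2) > 0"
      using t(1) pi_gt_zero unfolding atLeastAtMost_iff by (intro cos_gt_zero_pi) linarith+
    moreover have "h z \<notin> \<real>\<^sub>\<le>\<^sub>0"
      unfolding t(2) h_real nonpos_Reals_of_real_iff using elliptic_integrand_pos[OF k, of t] by simp
    ultimately show "z \<in> U" by (auto simp: U_def)
  qed
  have "compact A" unfolding A_def by (rule compact_segment)
  then obtain e where e: "e > 0" "(\<Union>x\<in>A. ball x e) \<subseteq> U"
    using compact_subset_open_imp_ball_epsilon_subset[OF _ oU AU] by metis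
  \<comment> \<open>The Minkowski sum of a segment and a ball is convex; \<open>e\<close> is small
    enough to keep it in \<open>U\<close>, where the principal square root of \<open>h\<close> is
    holomorphic.\<close>
  define S where "S = (\<Union>x\<in>A. \<Union>y\<in>ball 0 e. {x + y})"
  have S: "open S" "convex S"
    unfolding S_def A_def by (rule open_sums, simp) (intro convex_sums convex_closed_segment convex_ball)
  have AS: "A \<subseteq> S" using e(1) unfolding S_def by (auto intro!: bexI[of _ 0])
  have SU: "S \<subseteq> U"
  proof
    fix z assume "z \<in> S"
    then obtain x y where "x \<in> A" "y \<in> ball 0 e" "z = x + y" by (auto simp: S_def)
    then have "z \<in> ball x e" by (simp add: dist_norm)
    then show "z \<in> U" using e(2) \<open>x \<in> A\<close> by blast
  qed
  have S0: "0 \<in> S" using AS by (auto simp: A_def)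
  define r where "r = (\<lambda>z. 1 / csqrt (h z))"
  have hU: "h z \<notin> \<real>\<^sub>\<le>\<^sub>0" "h z \<noteq> 0" "cos (z / 2) \<noteq> 0" if "z \<in> S" for z
    using that SU by (auto simp: U_def)
  have "r holomorphic_on S"
    unfolding r_def using hU by (auto intro!: holomorphic_intros simp: h_def)
  then obtain Q where Q: "\<And>z. z \<in> S \<Longrightarrow> (Q has_field_derivative r z) (at z within S)"
    using holomorphic_convex_primitive'[OF S(2,1)] by blast
  have Q': "(Q has_field_derivative r z) (at z)" if "z \<in> S" for z
    using Q[OF that] by (simp only: at_within_open[OF that S(1)])
  define \<Psi> where "\<Psi> = (\<lambda>z. (Q z - Q 0) / 2)"
  have \<Psi>': "(\<Psi> has_field_derivative r z / 2) (at z)" if "z \<in> S" for z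
    using DERIV_cdivide[OF DERIV_diff[OF Q'[OF that] DERIV_const[of "Q 0"]], of 2] by (simp add: \<Psi>_def)
  have r0: "r 0 = 1" by (simp add: r_def h_def)
  have r2: "(r z)\<^sup>2 = 1 / (1 - (of_real k)\<^sup>2 * (sin z)\<^sup>2)" for z
    by (simp add: r_def h_def power_divide)
  have \<theta>S: "of_real \<theta> \<in> S" using inA[OF \<theta>] AS by blast
  have hnz: "1 - (of_real k)\<^sup>2 * (sin z)\<^sup>2 \<noteq> 0" if "z \<in> S" for z
    using hU(2)[OF that] by (simp add: h_def)
  note * = is_sdc_tan_half[OF F S(1) convex_connected[OF S(2)] S0 hnz hU(3) r2 r0 \<Psi>' _ \<theta>S]
  have \<Psi>\<theta>: "\<Psi> (of_real \<theta>) = of_real (elliptic_F k \<theta> / 2)"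
  proof -
    have "((\<lambda>t. of_real (1 / sqrt (1 - k\<^sup>2 * (sin t)\<^sup>2))) has_integral Q (of_real \<theta>) - Q (of_real 0)) {0..\<theta>}"
    proof (rule fundamental_theorem_of_calculus)
      fix t assume t: "t \<in> {0..\<theta>}"
      then have "of_real t \<in> S" using inA[of t] AS \<theta> by auto
      from Q'[OF this] have "((\<lambda>t. Q (of_real t)) has_vector_derivative r (of_real t)) (at t within {0..\<theta>})"
        by (rule has_vector_derivative_real_field)
      moreover have "r (of_real t) = of_real (1 / sqrt (1 - k\<^sup>2 * (sin t)\<^sup>2))"
        unfolding r_def h_real using elliptic_integrand_pos[OF k, of t] by (simp add: csqrt_of_real_nonneg)
      ultimately show "((\<lambda>t. Q (of_real t)) has_vector_derivative of_real (1 / sqrt (1 - k\<^sup>2 * (sin t)\<^sup>2))) (at t within {0..\<theta>})"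
        by simp
    qed (use \<theta> in auto)
    moreover have "((\<lambda>t. of_real (1 / sqrt (1 - k\<^sup>2 * (sin t)\<^sup>2))) has_integral complex_of_real (elliptic_F k \<theta>)) {0..\<theta>}"
      unfolding elliptic_F_def
      by (rule has_integral_of_real[OF integrable_integral
            [OF integrable_continuous_real[OF elliptic_integrand_continuous[OF k]]]])
    ultimately have "Q (of_real \<theta>) - Q (of_real 0) = of_real (elliptic_F k \<theta>)"
      by (rule has_integral_unique)
    then show ?thesis by (simp add: \<Psi>_def)
  qed
  have t: "tan (complex_of_real \<theta> / 2) = of_real (tan (\<theta> / 2))"
    using tan_of_real[of "\<theta> / 2", where 'a = complex] by simp
  show "F analytic_on {of_real (elliptic_F k \<theta> / 2)}" "F (of_real (elliptic_F k \<theta> / 2)) = of_real (tan (\<theta> / 2))"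
    using * unfolding \<Psi>\<theta> t by (simp_all add: \<Psi>_def)
qed

section \<open>The period lattice\<close>

lemma elliptic_F_pi_half: "elliptic_F k (pi / 2) = elliptic_K k"
  by (simp add: elliptic_F_def elliptic_K_def)

lemma elliptic_F_continuous:
  assumes "k\<^sup>2 < 1"
  shows "continuous_on {0..pi/2} (elliptic_F k)"
  unfolding elliptic_F_def
  by (intro indefinite_integral_continuous_1 integrable_continuous_real elliptic_integrand_continuous assms)

lemma elliptic_K_pos:
  assumes "k\<^sup>2 < 1"
  shows "0 < elliptic_K k"
proof -
  have "integral {0..pi/2} (\<lambda>\<theta>. 1) \<le> elliptic_K k"
    unfolding elliptic_K_def
  proof (rule integral_le)
    show "(\<lambda>\<theta>. 1 / sqrt (1 - k\<^sup>2 * (sin \<theta>)\<^sup>2)) integrable_on {0..pi/2}"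
      by (intro integrable_continuous_real elliptic_integrand_continuous assms)
    show "1 \<le> 1 / sqrt (1 - k\<^sup>2 * (sin \<theta>)\<^sup>2)" for \<theta>
      using elliptic_integrand_pos[OF assms, of \<theta>] by (simp add: divide_simps)
  qed auto
  then have "pi / 2 \<le> elliptic_K k" by simp
  then show ?thesis using pi_gt_zero by linarith
qed

lemma is_sdc_half_K:
  assumes F: "is_sdc k F" and k: "k\<^sup>2 < 1"
  shows "F (of_real (elliptic_K k / 2)) = 1"
    and "F (of_real (elliptic_K k) + v) = - inverse (F v)"
proof -
  have *: "F analytic_on {of_real (elliptic_K k / 2)}" "F (of_real (elliptic_K k / 2)) = 1"
    using is_sdc_elliptic_F[OF F k, of "pi / 2"]
    by (simp_all add: elliptic_F_pi_half tan_45)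
  show "F (of_real (elliptic_K k / 2)) = 1" by fact
  show "F (of_real (elliptic_K k) + v) = - inverse (F v)"
    using is_sdc_half_period[OF F _ *, of v] k by simp
qed

text \<open>Up to K/2 the point is half an elliptic integral with amplitude in (0, pi/2], by the
  intermediate value theorem, and the half angle tangent is positive. Beyond K/2, F(x) = 1/F(K -
  x).\<close>

lemma is_sdc_nonzero:
  assumes F: "is_sdc k F" and k: "k\<^sup>2 < 1" and x: "0 < x" "x < elliptic_K k"
  shows "F (of_real x) \<noteq> 0"
proof -
  have *: "F (of_real x) \<noteq> 0" if x: "0 < x" "x \<le> elliptic_K k / 2" for x
  proof -
    have "\<exists>\<theta>\<ge>0. \<theta> \<le> pi/2 \<and> elliptic_F k \<theta> = 2 * x"
      using x elliptic_F_continuous[OF k]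
      by (intro IVT') (auto simp: elliptic_F_pi_half elliptic_F_def[of k 0])
    then obtain \<theta> where \<theta>: "\<theta> \<ge> 0" "\<theta> \<le> pi/2" "elliptic_F k \<theta> = 2 * x" by blast
    have "\<theta> \<noteq> 0" using \<theta>(3) x by (auto simp: elliptic_F_def)
    then have "tan (\<theta> / 2) > 0" using \<theta> pi_gt_zero by (intro tan_gt_zero) linarith+
    then show ?thesis using is_sdc_elliptic_F(2)[OF F k, of \<theta>] \<theta> by simp
  qed
  show ?thesis
  proof (cases "x \<le> elliptic_K k / 2")
    case True
    then show ?thesis using * x by simp
  next
    case False
    have "F (of_real x) = - inverse (F (- of_real (elliptic_K k - x)))"
      using is_sdc_half_K(2)[OF F k, of "of_real (x - elliptic_K k)"] by simp
    then have "F (of_real x) = inverse (F (of_real (elliptic_K k - x)))"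
      unfolding is_sdc_odd[OF F] by simp
    moreover have "F (of_real (elliptic_K k - x)) \<noteq> 0"
      using False x by (intro *) auto
    ultimately show ?thesis by simp
  qed
qed

lemma shift_of_int_mult:
  fixes F :: "complex \<Rightarrow> complex"
  assumes "\<And>v. F (c + v) = s * F v" "s \<noteq> 0"
  shows "F (of_int m * c + v) = s powi m * F v"
proof (induction m arbitrary: v rule: int_induct[where k = 0])
  case (step1 i)
  have "F (of_int (i + 1) * c + v) = F (of_int i * c + (c + v))" by (simp add: algebra_simps)
  also have "\<dots> = s powi i * (s * F v)" unfolding step1 assms(1) ..
  finally show ?case using assms(2) by (simp add: power_int_add)
next
  case (step2 i)
  have "s powi i * F v = F (of_int i * c + v)" by (simp add: step2)
  also have "\<dots> = F (c + (of_int (i - 1) * c + v))" by (simp add: algebra_simps)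
  also have "\<dots> = s * F (of_int (i - 1) * c + v)" by (rule assms(1))
  finally show ?case using assms(2) by (simp add: power_int_diff field_simps)
qed simp

text \<open>Reduction modulo 2K leaves a period r in [0, 2K) with F(r) = 0, and \<open>F\<close> has
  no zero in (0, K) or in (K, 2K).\<close>

lemma is_sdc_real_period:
  assumes F: "is_sdc k F" and k: "k\<^sup>2 < 1" and per: "\<And>v. F (of_real x + v) = F v"
  shows "\<exists>m::int. x = 2 * of_int m * elliptic_K k"
proof -
  define K where "K = elliptic_K k"
  have K: "K > 0" unfolding K_def by (rule elliptic_K_pos[OF k])
  have FK: "F (of_real K + v) = - inverse (F v)" for v
    unfolding K_def by (rule is_sdc_half_K(2)[OF F k])
  have F2K: "F (of_real (2 * K) + v) = 1 * F v" for v
  proof -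
    have "of_real (2 * K) + v = of_real K + (of_real K + v)" by simp
    then have "F (of_real (2 * K) + v) = - inverse (- inverse (F v))" by (simp only: FK)
    then show ?thesis by simp
  qed
  have F2K: "F (of_int m * of_real (2 * K) + v) = F v" for m v
    using shift_of_int_mult[of F "of_real (2 * K)" 1 m v, OF F2K] by simp
  define m where "m = \<lfloor>x / (2 * K)\<rfloor>"
  define r where "r = x - 2 * of_int m * K"
  have "of_int m \<le> x / (2 * K)" "x / (2 * K) < of_int m + 1" unfolding m_def by linarith+
  then have r: "0 \<le> r" "r < 2 * K" using K by (auto simp: r_def field_simps)
  have "F (of_real r + v) = F v" for v
  proof -
    have "F (of_real r + v) = F (of_int m * of_real (2 * K) + (of_real r + v))" by (simp only: F2K)
    also have "\<dots> = F (of_real x + v)" by (simp add: r_def algebra_simps)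
    finally show ?thesis by (simp add: per)
  qed
  note Fr = this
  have F0: "F 0 = 0" using F by (simp add: is_sdc_def)
  then have Fr0: "F (of_real r) = 0" using Fr[of 0] by simp
  have "r = 0"
  proof (rule ccontr)
    assume "r \<noteq> 0"
    with r have "0 < r" by simp
    then consider "r < K" | "r = K" | "K < r" by linarith
    then show False
    proof cases
      case 1
      then show False using is_sdc_nonzero[OF F k \<open>0 < r\<close>] Fr0 by (simp add: K_def)
    next
      \<comment> \<open>At the pole K the default value is also 0, so F(r) = 0 excludes nothing
        here. The values at K/2 do: the shift by K takes 1 to -1.\<close>
      case 2
      then show False
        using Fr[of "of_real (K / 2)"] FK[of "of_real (K / 2)"] is_sdc_half_K(1)[OF F k]
        by (simp add: K_def)
    next
      case 3
      then have "F (of_real (r - K)) \<noteq> 0" using is_sdc_nonzero[OF F k, of "r - K"] r by (simp add: K_def)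
      then show False using FK[of "of_real (r - K)"] Fr0 by simp
    qed
  qed
  then show ?thesis by (auto simp: r_def K_def)
qed

locale sdc_function =
  fixes k k' :: real and F :: "complex \<Rightarrow> complex"
  assumes F: "is_sdc k F" and k: "0 < k" "k < 1" and k': "k' = sqrt (1 - k\<^sup>2)"
begin

definition K where "K = elliptic_K k"
definition K' where "K' = elliptic_K k'"
definition \<alpha> where "\<alpha> = Complex K K'"

lemma k_less: "k\<^sup>2 < 1" and k'_less: "k'\<^sup>2 < 1" and k_k': "k\<^sup>2 + k'\<^sup>2 = 1"
proof -
  show "k\<^sup>2 < 1" using k by (simp add: power_less_one_iff)
  then have "k'\<^sup>2 = 1 - k\<^sup>2" using k' by simp
  then show "k'\<^sup>2 < 1" "k\<^sup>2 + k'\<^sup>2 = 1" using k by auto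
qed

lemma K_pos: "0 < K" and K'_pos: "0 < K'"
  unfolding K_def K'_def by (rule elliptic_K_pos[OF k_less], rule elliptic_K_pos[OF k'_less])

lemma sdc_imaginary: "is_sdc k' (\<lambda>u. - \<i> * F (\<i> * u))"
  by (rule is_sdc_imaginary[OF F k_k'])

lemma F_K: "F (of_real K + v) = - inverse (F v)"
  unfolding K_def by (rule is_sdc_half_K[OF F k_less])

text \<open>This is the half period of modulus k' seen through G(u) = -i F(i u). The sign differs
  from that in \<open>F_K\<close> because G -> -1/G reads F -> 1/F.\<close>

lemma F_iK': "F (\<i> * of_real K' + v) = inverse (F v)"
proof -
  have "- \<i> * F (\<i> * (of_real K' + - \<i> * v)) = - inverse (- \<i> * F (\<i> * (- \<i> * v)))"
    unfolding K'_def using is_sdc_half_K(2)[OF sdc_imaginary k'_less] .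
  moreover have "\<i> * (of_real K' + - \<i> * v) = \<i> * of_real K' + v" "\<i> * (- \<i> * v) = v"
    by (simp_all add: algebra_simps)
  ultimately have "- \<i> * F (\<i> * of_real K' + v) = - inverse (- \<i> * F v)"
    by (simp only:)
  also have "\<dots> = - \<i> * inverse (F v)" by (simp add: inverse_mult_distrib)
  finally show ?thesis by (simp only: mult_cancel_left) simp
qed

lemma F_\<alpha>: "F (\<alpha> + v) = - F v"
proof -
  have "F (\<alpha> + v) = F (of_real K + (\<i> * of_real K' + v))"
    by (simp add: \<alpha>_def complex_eq_iff Complex_eq algebra_simps)
  then show ?thesis by (simp add: F_K F_iK')
qed

lemma F_cnj_\<alpha>: "F (cnj \<alpha> + v) = - F v"
proof -
  have "F (\<i> * of_real K' + (- \<i> * of_real K' + v)) = inverse (F (- \<i> * of_real K' + v))"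
    by (rule F_iK')
  then have "F (- \<i> * of_real K' + v) = inverse (F v)" by simp
  moreover have "F (cnj \<alpha> + v) = F (of_real K + (- \<i> * of_real K' + v))"
    by (simp add: \<alpha>_def Complex_eq algebra_simps)
  ultimately show ?thesis by (simp only: F_K inverse_inverse_eq)
qed

lemma F_lattice: "F (of_int j * \<alpha> + of_int l * cnj \<alpha> + v) = (-1) powi (j + l) * F v"
proof -
  have a: "F (\<alpha> + v) = -1 * F v" and b: "F (cnj \<alpha> + v) = -1 * F v" for v
    by (simp_all add: F_\<alpha> F_cnj_\<alpha>)
  have "F (of_int j * \<alpha> + (of_int l * cnj \<alpha> + v)) = (-1) powi j * F (of_int l * cnj \<alpha> + v)"
    by (rule shift_of_int_mult[of F \<alpha> "-1", OF a]) simp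
  also have "F (of_int l * cnj \<alpha> + v) = (-1) powi l * F v"
    by (rule shift_of_int_mult[of F "cnj \<alpha>" "-1", OF b]) simp
  finally show ?thesis by (simp add: power_int_add add.assoc)
qed

text \<open>With \<omega> its conjugate is a period, hence so is 2 Re \<omega>, and the imaginary
  transformation handles 2 Im \<omega>. This gives \<omega> = m K + i n K', and only the parity of m
  - n remains. The converse is not claimed: an odd j + l changes the sign of
  \<open>F\<close>.\<close>

lemma period_lattice:
  assumes per: "\<And>v. F (\<omega> + v) = F v"
  shows "\<exists>j l::int. \<omega> = of_int j * \<alpha> + of_int l * cnj \<alpha>"
proof -
  have "F (cnj \<omega> + v) = F v" for v
  proof -
    have "F (cnj \<omega> + v) = F (cnj (\<omega> + cnj v))" by simp
    also have "\<dots> = cnj (F (cnj v))" by (simp only: is_sdc_cnj[OF F] per)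
    finally show ?thesis by (simp add: is_sdc_cnj[OF F])
  qed
  note per' = this
  have "F (of_real (2 * Re \<omega>) + v) = F v" for v
  proof -
    have "of_real (2 * Re \<omega>) + v = \<omega> + (cnj \<omega> + v)"
      by (simp add: complex_eq_iff)
    then show ?thesis by (simp only: per per')
  qed
  from is_sdc_real_period[OF F k_less this]
  obtain m :: int where m: "Re \<omega> = of_int m * K" by (auto simp: K_def)
  have "F (\<i> * (of_real (2 * Im \<omega>) + v)) = F (\<i> * v)" for v
  proof -
    have "\<i> * (of_real (2 * Im \<omega>) + v) = \<omega> + (- cnj \<omega> + \<i> * v)"
      by (simp add: complex_eq_iff)
    moreover have "F (- cnj \<omega> + \<i> * v) = F (\<i> * v)"
      using per'[of "- cnj \<omega> + \<i> * v"] by simp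
    ultimately show ?thesis by (simp only: per)
  qed
  then have "- \<i> * F (\<i> * (of_real (2 * Im \<omega>) + v)) = - \<i> * F (\<i> * v)" for v by simp
  from is_sdc_real_period[OF sdc_imaginary k'_less this]
  obtain n :: int where n: "Im \<omega> = of_int n * K'" by (auto simp: K'_def)
  have FK2: "F (of_real K / 2) = 1"
    using is_sdc_half_K(1)[OF F k_less] by (simp add: K_def)
  have FK'2: "F (\<i> * of_real K' / 2) = \<i>"
  proof -
    have "- \<i> * F (\<i> * of_real K' / 2) = 1"
      using is_sdc_half_K(1)[OF sdc_imaginary k'_less] by (simp add: K'_def)
    then have "\<i> * (- \<i> * F (\<i> * of_real K' / 2)) = \<i> * 1" by (simp only:)
    then show ?thesis by simp
  qed
  have step: "(-1) powi n * F (of_int (m - n) * of_real K + v) = F v" for v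
  proof -
    have "\<omega> = of_int n * \<alpha> + of_int 0 * cnj \<alpha> + of_int (m - n) * of_real K"
      by (simp add: complex_eq_iff m n \<alpha>_def algebra_simps)
    then show ?thesis using per[of v] F_lattice[of n 0] by (simp add: add.assoc)
  qed
  \<comment> \<open>An odd difference would give F = -(-1)^n / F identically. The values F(K/2) = 1
    and F(i K'/2) = i then demand opposite signs of (-1)^n.\<close>
  have "even (m - n)"
  proof (rule ccontr)
    assume "odd (m - n)"
    then obtain q where q: "m - n = 2 * q + 1" by (elim oddE)
    have "of_int (m - n) * of_real K + v = of_int q * \<alpha> + of_int q * cnj \<alpha> + (of_real K + v)" for v
      by (simp add: q complex_eq_iff \<alpha>_def algebra_simps)
    then have "F (of_int (m - n) * of_real K + v) = (-1) powi (q + q) * - inverse (F v)" for v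
      by (simp only: F_lattice F_K)
    then have "F (of_int (m - n) * of_real K + v) = - inverse (F v)" for v by simp
    then have *: "F v = - ((-1) powi n * inverse (F v))" for v
      using step[of v] by simp
    have "(-1) powi n = (-1 :: complex)" using *[of "of_real K / 2"] by (simp add: FK2 minus_equation_iff)
    moreover have "(-1) powi n = (1 :: complex)" using *[of "\<i> * of_real K' / 2"] by (simp add: FK'2 field_simps)
    ultimately show False by simp
  qed
  then obtain q where q: "m - n = 2 * q" by blast
  then have mq: "real_of_int m = of_int n + 2 * of_int q" by linarith
  have "\<omega> = of_int (n + q) * \<alpha> + of_int q * cnj \<alpha>"
    using mq by (simp add: complex_eq_iff m n \<alpha>_def algebra_simps)
  then show ?thesis by blast
qed

text \<open>Translation by a pole acts as +1/F or -1/F, just as translation by i K' or by K does.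
  The difference of the two translations is a period.\<close>

lemma pole_lattice:
  assumes "is_pole F p"
  shows "\<exists>j l::int. p = of_int j * \<alpha> + of_int l * cnj \<alpha> + of_real K"
proof -
  from is_sdc_pole[OF F assms] show ?thesis
  proof
    assume *: "\<forall>v. F (p + v) = inverse (F v)"
    have "F ((p - \<i> * of_real K') + v) = F v" for v
    proof -
      have "F (\<i> * of_real K' + (- \<i> * of_real K' + v)) = inverse (F (- \<i> * of_real K' + v))"
        by (rule F_iK')
      then have "F (- \<i> * of_real K' + v) = inverse (F v)" by simp
      moreover have "(p - \<i> * of_real K') + v = p + (- \<i> * of_real K' + v)" by simp
      ultimately show ?thesis by (simp only: *[rule_format] inverse_inverse_eq)
    qed
    from period_lattice[OF this] obtain j l :: int
      where "p - \<i> * of_real K' = of_int j * \<alpha> + of_int l * cnj \<alpha>" by blast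
    \<comment> \<open>The index drops by one because i K' = K - cnj \<alpha>.\<close>
    then have "p = of_int j * \<alpha> + of_int (l - 1) * cnj \<alpha> + of_real K"
      by (simp add: complex_eq_iff \<alpha>_def algebra_simps)
    then show ?thesis by blast
  next
    assume *: "\<forall>v. F (p + v) = - inverse (F v)"
    have "F ((p - of_real K) + v) = F v" for v
    proof -
      have "F (p + (v - of_real K)) = - inverse (F (v - of_real K))" using * by blast
      then show ?thesis using F_K[of "v - of_real K"] by (simp add: algebra_simps)
    qed
    from period_lattice[OF this] obtain j l :: int
      where "p - of_real K = of_int j * \<alpha> + of_int l * cnj \<alpha>" by blast
    then have "p = of_int j * \<alpha> + of_int l * cnj \<alpha> + of_real K" by (simp add: algebra_simps)
    then show ?thesis by blast
  qed
qed

end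

section \<open>Taylor coefficients as lattice sums\<close>

text \<open>On this segment z/p stays in the closed first quadrant without 0, so the principal
  branch of Ln(z/p) is a primitive. Each side of a rhombus with diagonals on the axes has this
  shape.\<close>

lemma inverse_contour_integral_right_angle:
  assumes "p \<noteq> 0" "\<rho> > 0"
  shows "((\<lambda>z. 1 / z) has_contour_integral (of_real (ln \<rho>) + \<i> * of_real pi / 2)) (linepath p (\<i> * of_real \<rho> * p))"
proof -
  define S where "S = (\<lambda>z. z / p) -` (- \<real>\<^sub>\<le>\<^sub>0)"
  have "((\<lambda>z. Ln (z / p)) has_field_derivative 1 / z) (at z within S)" if "z \<in> S" for z
  proof -
    have "z / p \<notin> \<real>\<^sub>\<le>\<^sub>0" using that by (simp add: S_def)
    then have "((\<lambda>z. Ln (z / p)) has_field_derivative inverse (z / p) * (1 / p)) (at z)"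
      using assms(1) by (intro DERIV_chain2[of Ln] has_field_derivative_Ln) (auto intro!: derivative_eq_intros)
    then show ?thesis using assms(1) by (auto intro: has_field_derivative_at_within simp: field_simps)
  qed
  moreover have "path_image (linepath p (\<i> * of_real \<rho> * p)) \<subseteq> S"
  proof
    fix z assume "z \<in> path_image (linepath p (\<i> * of_real \<rho> * p))"
    then obtain u where u: "0 \<le> u" "u \<le> 1" "z = (1 - u) *\<^sub>R p + u *\<^sub>R (\<i> * of_real \<rho> * p)"
      by (auto simp: closed_segment_def)
    have "z / p = Complex (1 - u) (u * \<rho>)"
      unfolding u(3) using assms(1) by (simp add: scaleR_conv_of_real add_divide_distrib Complex_eq)
    then show "z \<in> S" using u assms(2) by (auto simp: S_def complex_nonpos_Reals_iff)
  qed
  ultimately have "((\<lambda>z. 1 / z) has_contour_integral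
      (Ln (pathfinish (linepath p (\<i> * of_real \<rho> * p)) / p) - Ln (pathstart (linepath p (\<i> * of_real \<rho> * p)) / p)))
      (linepath p (\<i> * of_real \<rho> * p))"
    by (intro contour_integral_primitive[where S = S]) auto
  moreover have "Ln (\<i> * of_real \<rho>) = of_real (ln \<rho>) + \<i> * of_real pi / 2"
    using Ln_times_ii[of "of_real \<rho>"] assms(2) by (simp add: Ln_of_real mult.commute)
  ultimately show ?thesis using assms(1) by simp
qed

text \<open>The vertices lie on the axes and are traversed counterclockwise; the sides are parallel
  to \<open>Complex a b\<close> and its conjugate.\<close>

definition rhombus_path :: "real \<Rightarrow> real \<Rightarrow> real \<Rightarrow> complex" where
  "rhombus_path a b = linepath (of_real a) (\<i> * of_real b) +++ linepath (\<i> * of_real b) (- of_real a) +++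
     linepath (- of_real a) (- \<i> * of_real b) +++ linepath (- \<i> * of_real b) (of_real a)"

lemma rhombus_path_simps [simp]:
  "valid_path (rhombus_path a b)" "path (rhombus_path a b)"
  "pathfinish (rhombus_path a b) = pathstart (rhombus_path a b)"
  by (auto simp: rhombus_path_def intro!: valid_path_join)

text \<open>Every side subtends a right angle at 0 and contributes i pi/2; the logarithms of the
  side ratios cancel in pairs.\<close>

lemma winding_number_rhombus_0:
  assumes "a > 0" "b > 0"
  shows "winding_number (rhombus_path a b) 0 = 1"
proof -
  have *: "((\<lambda>z. 1 / z) has_contour_integral (of_real (ln (y / x)) + \<i> * of_real pi / 2)) (linepath (s * of_real x) (\<i> * s * of_real y))"
    if "x > 0" "y > 0" "s \<noteq> 0" for x y s
  proof -
    have "\<i> * of_real (y / x) * (s * of_real x) = \<i> * s * of_real y" using that by simp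
    then show ?thesis
      using inverse_contour_integral_right_angle[of "s * of_real x" "y / x"] that by (simp add: mult_ac)
  qed
  have "((\<lambda>z. 1 / z) has_contour_integral
     ((of_real (ln (b / a)) + \<i> * of_real pi / 2) + ((of_real (ln (a / b)) + \<i> * of_real pi / 2) +
      ((of_real (ln (b / a)) + \<i> * of_real pi / 2) + (of_real (ln (a / b)) + \<i> * of_real pi / 2))))) (rhombus_path a b)"
    unfolding rhombus_path_def
    by (intro has_contour_integral_join valid_path_join)
       (use *[of a b 1] *[of b a \<i>] *[of a b "-1"] *[of b a "-\<i>"] assms in simp_all)
  moreover have "ln (a / b) = - ln (b / a)" using assms by (simp add: ln_div)
  ultimately have ci: "((\<lambda>z. 1 / z) has_contour_integral 2 * of_real pi * \<i>) (rhombus_path a b)"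
    by (simp add: mult_ac)
  have "0 \<notin> path_image (rhombus_path a b)"
    using assms by (auto simp: rhombus_path_def path_image_join closed_segment_def complex_eq_iff)
  then show ?thesis
    using contour_integral_unique[OF ci] by (subst winding_number_valid_path) auto
qed

lemma path_image_rhombus:
  "path_image (rhombus_path a b) = closed_segment (of_real a) (\<i> * of_real b) \<union> closed_segment (\<i> * of_real b) (- of_real a) \<union>
     closed_segment (- of_real a) (- \<i> * of_real b) \<union> closed_segment (- \<i> * of_real b) (of_real a)"
  by (simp add: rhombus_path_def path_image_join Un_assoc)

text \<open>The two expressions are twice the coordinates of \<open>z\<close> in the basis
  \<open>Complex a b\<close>, \<open>Complex a (-b)\<close>, in which the rhombus is a
  square.\<close>

definition rhombus :: "real \<Rightarrow> real \<Rightarrow> complex set" where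
  "rhombus a b = {z. \<bar>Re z / a + Im z / b\<bar> < 1 \<and> \<bar>Re z / a - Im z / b\<bar> < 1}"

lemma convex_open_rhombus: "convex (rhombus a b)" "open (rhombus a b)"
proof -
  have *: "rhombus a b = {z. Complex (1/a) (1/b) \<bullet> z < 1} \<inter> {z. Complex (1/a) (1/b) \<bullet> z > -1} \<inter>
      {z. Complex (1/a) (-1/b) \<bullet> z < 1} \<inter> {z. Complex (1/a) (-1/b) \<bullet> z > -1}"
    by (auto simp: rhombus_def inner_complex_def abs_less_iff)
  show "convex (rhombus a b)"
    unfolding * by (intro convex_Int convex_halfspace_lt convex_halfspace_gt)
  show "open (rhombus a b)"
    unfolding * by (intro open_Int open_halfspace_lt open_halfspace_gt)
qed

lemma rhombus_path_boundary:
  assumes "a > 0" "b > 0" "z \<in> path_image (rhombus_path a b)"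
  shows "\<bar>Re z / a + Im z / b\<bar> = 1 \<or> \<bar>Re z / a - Im z / b\<bar> = 1"
proof -
    from assms(3) consider
       u where "z = (1 - u) *\<^sub>R (of_real a) + u *\<^sub>R (\<i> * of_real b)"
     | u where "z = (1 - u) *\<^sub>R (\<i> * of_real b) + u *\<^sub>R (- of_real a)"
     | u where "z = (1 - u) *\<^sub>R (- of_real a) + u *\<^sub>R (- \<i> * of_real b)"
     | u where "z = (1 - u) *\<^sub>R (- \<i> * of_real b) + u *\<^sub>R (of_real a)"
      unfolding path_image_rhombus closed_segment_def by blast
    then show ?thesis by cases (use assms(1,2) in simp_all)
qed

lemma rhombus_path_disjoint:
  assumes "a > 0" "b > 0"
  shows "rhombus a b \<inter> path_image (rhombus_path a b) = {}"
  using rhombus_path_boundary[OF assms] by (fastforce simp: rhombus_def)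

lemma winding_number_rhombus:
  assumes "a > 0" "b > 0" "z \<in> rhombus a b"
  shows "winding_number (rhombus_path a b) z = 1"
proof -
  have "winding_number (rhombus_path a b) z = winding_number (rhombus_path a b) 0"
    using assms rhombus_path_disjoint by (intro winding_number_eq[of _ _ "rhombus a b"] convex_connected convex_open_rhombus)
      (auto simp: rhombus_def)
  then show ?thesis using winding_number_rhombus_0[OF assms(1,2)] by simp
qed

lemma contour_integral_rhombus_bound:
  assumes f: "f contour_integrable_on rhombus_path a b"
    and B: "\<And>z. z \<in> path_image (rhombus_path a b) \<Longrightarrow> norm (f z) \<le> B" and ab: "a > 0" "b > 0"
  shows "norm (contour_integral (rhombus_path a b) f) \<le> 4 * (B * (a + b))"
proof -
  have "0 \<le> norm (f (of_real a))" by simp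
  also have "\<dots> \<le> B" by (rule B) (simp add: path_image_rhombus)
  finally have B0: "B \<ge> 0" .
  have seg: "norm (contour_integral (linepath p q) f) \<le> B * (a + b)"
    if "f contour_integrable_on linepath p q" "closed_segment p q \<subseteq> path_image (rhombus_path a b)" "norm (q - p) \<le> a + b" for p q
  proof -
    have "norm (contour_integral (linepath p q) f) \<le> B * norm (q - p)"
      using that B0 B by (intro contour_integral_bound_linepath) auto
    also have "\<dots> \<le> B * (a + b)" using that(3) B0 by (intro mult_left_mono)
    finally show ?thesis .
  qed
  have len: "norm (\<i> * of_real b - of_real a) \<le> a + b" "norm (- of_real a - \<i> * of_real b) \<le> a + b"
    "norm (- \<i> * of_real b - - of_real a) \<le> a + b" "norm (of_real a - - \<i> * of_real b) \<le> a + b"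
    using ab by (auto intro!: order.trans[OF norm_triangle_ineq4] order.trans[OF norm_triangle_ineq] simp: norm_mult)
  have ints: "f contour_integrable_on linepath (of_real a) (\<i> * of_real b)"
     "f contour_integrable_on linepath (\<i> * of_real b) (- of_real a)"
     "f contour_integrable_on linepath (- of_real a) (- \<i> * of_real b)"
     "f contour_integrable_on linepath (- \<i> * of_real b) (of_real a)"
    using f unfolding rhombus_path_def by (auto simp: valid_path_join)
  have "contour_integral (rhombus_path a b) f =
      contour_integral (linepath (of_real a) (\<i> * of_real b)) f + (contour_integral (linepath (\<i> * of_real b) (- of_real a)) f +
      (contour_integral (linepath (- of_real a) (- \<i> * of_real b)) f + contour_integral (linepath (- \<i> * of_real b) (of_real a)) f))"
    unfolding rhombus_path_def using ints by (simp add: valid_path_join)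
  also have "norm \<dots> \<le> B * (a + b) + (B * (a + b) + (B * (a + b) + B * (a + b)))"
    by (intro norm_triangle_mono seg ints len) (auto simp: path_image_rhombus)
  finally show ?thesis by simp
qed

section \<open>Poles, residues and bounds of F\<close>

context sdc_function
begin

text \<open>K is half of \<alpha> + cnj \<alpha>, which is where the half integers come
  from.\<close>

definition w :: "int \<Rightarrow> int \<Rightarrow> complex" where
  "w j l = of_int j * \<alpha> + of_int l * cnj \<alpha> + of_real K"

lemma Re_w: "Re (w j l) = (of_int j + of_int l + 1) * K" and Im_w: "Im (w j l) = (of_int j - of_int l) * K'"
  by (simp_all add: w_def \<alpha>_def algebra_simps)

text \<open>In the side coordinates of a rhombus of size \<open>r\<close> the poles form a grid of
  half integers divided by \<open>r\<close>. For r = 1 this recovers the indices.\<close>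

lemma w_coords: "Re (w j l) / (2 * r * K) + Im (w j l) / (2 * r * K') = (of_int j + 1/2) / r"
   "Re (w j l) / (2 * r * K) - Im (w j l) / (2 * r * K') = (of_int l + 1/2) / r"
proof -
  have "Re (w j l) / (2 * r * K) = (of_int j + of_int l + 1) / (2 * r)"
    "Im (w j l) / (2 * r * K') = (of_int j - of_int l) / (2 * r)"
    using K_pos K'_pos by (simp_all add: Re_w Im_w)
  then show "Re (w j l) / (2 * r * K) + Im (w j l) / (2 * r * K') = (of_int j + 1/2) / r"
   "Re (w j l) / (2 * r * K) - Im (w j l) / (2 * r * K') = (of_int l + 1/2) / r"
    by (cases "r = 0"; simp add: field_simps)+
qed

lemma w_in_rhombus: "r > 0 \<Longrightarrow> w j l \<in> rhombus (2 * r * K) (2 * r * K') \<longleftrightarrow> \<bar>of_int j + 1/2\<bar> < r \<and> \<bar>of_int l + 1/2\<bar> < r"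
  unfolding rhombus_def mem_Collect_eq w_coords by (simp add: field_simps)

lemma w_eq_iff: "w j l = w j' l' \<longleftrightarrow> j = j' \<and> l = l'"
proof
  assume "w j l = w j' l'"
  then have "(of_int j + 1/2) / 1 = (of_int j' + 1/2) / (1::real)" "(of_int l + 1/2) / 1 = (of_int l' + 1/2) / (1::real)"
    using w_coords[of j l 1] w_coords[of j' l' 1] by auto
  then show "j = j' \<and> l = l'" by simp
qed auto

lemma w_nonzero: "w j l \<noteq> 0"
proof
  assume "w j l = 0"
  then have "(of_int j + 1/2) / 1 = (0::real)" using w_coords(1)[of j l 1] by simp
  then have "real_of_int (2 * j + 1) = of_int 0" by simp
  then show False unfolding of_int_eq_iff by presburger
qed

lemma F_w: "F (w j l + v) = - ((-1) powi (j + l) * inverse (F v))"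
  using F_lattice[of j l "of_real K + v"] by (simp add: F_K w_def add.assoc)

lemma F_analytic: "(\<And>j l. z \<noteq> w j l) \<Longrightarrow> F analytic_on {z}"
  using pole_lattice[of z] F by (auto simp: w_def is_sdc_def intro: nicely_meromorphic_on_imp_analytic_at)

text \<open>The modulus of \<open>F\<close> has period 1 along the line, so a compact segment
  suffices. The line contains no pole, since one of the pole coordinates would be both 0 and a half
  integer.\<close>

lemma F_bounded_line: "\<exists>C. \<forall>x. norm (F (of_real x * \<alpha>)) \<le> C \<and> norm (F (of_real x * cnj \<alpha>)) \<le> C"
proof -
  have an: "F analytic_on {of_real x * \<alpha>}" for x
  proof (rule F_analytic)
    fix j l show "of_real x * \<alpha> \<noteq> w j l"
    proof
      assume eq: "of_real x * \<alpha> = w j l"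
      have "(of_int l + 1/2) / 1 = (0::real)" using w_coords(2)[of j l 1] K_pos K'_pos
        unfolding eq[symmetric] by (simp add: \<alpha>_def)
      then have "real_of_int (2 * l + 1) = of_int 0" by simp
      then show False unfolding of_int_eq_iff by presburger
    qed
  qed
  have "continuous_on {0..1} (\<lambda>x. F (of_real x * \<alpha>))"
  proof (rule continuous_at_imp_continuous_on, rule ballI)
    fix x :: real
    have "isCont F (of_real x * \<alpha>)" by (rule analytic_at_imp_isCont[OF an])
    moreover have "isCont (\<lambda>x. of_real x * \<alpha>) x" by (intro continuous_intros)
    ultimately show "isCont (\<lambda>x. F (of_real x * \<alpha>)) x"
      using isCont_o2[of x "\<lambda>x. of_real x * \<alpha>" F] by blast
  qed
  then have "bounded ((\<lambda>x. F (of_real x * \<alpha>)) ` {0..1})"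
    by (intro compact_imp_bounded compact_continuous_image) auto
  then obtain C where C: "\<And>x. x \<in> {0..1} \<Longrightarrow> norm (F (of_real x * \<alpha>)) \<le> C"
    unfolding bounded_iff by blast
  have 1: "norm (F (of_real x * \<alpha>)) \<le> C" for x
  proof -
    have "of_real x * \<alpha> = of_int \<lfloor>x\<rfloor> * \<alpha> + of_int 0 * cnj \<alpha> + of_real (frac x) * \<alpha>"
      by (simp add: frac_def algebra_simps)
    then have "norm (F (of_real x * \<alpha>)) = norm (F (of_real (frac x) * \<alpha>))"
      by (simp only: F_lattice norm_mult norm_power_int) simp
    then show ?thesis using C[of "frac x"] by (simp add: frac_ge_0 frac_lt_1 less_imp_le)
  qed
  have "norm (F (of_real x * cnj \<alpha>)) \<le> C" for x
    using 1[of x] is_sdc_cnj[OF F, of "of_real x * \<alpha>"] by simp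
  with 1 show ?thesis by blast
qed

text \<open>The sides lie on integer translates, by \<alpha> or cnj \<alpha>, of the two lines of
  \<open>F_bounded_line\<close>, so the bound does not depend on N.\<close>

lemma F_bounded_rhombus_path:
  "\<exists>C. \<forall>N::nat. \<forall>z \<in> path_image (rhombus_path (2 * real N * K) (2 * real N * K')). norm (F z) \<le> C"
proof -
  obtain C where C: "\<And>x. norm (F (of_real x * \<alpha>)) \<le> C" "\<And>x. norm (F (of_real x * cnj \<alpha>)) \<le> C"
    using F_bounded_line by blast
  have 1: "norm (F (of_int j * \<alpha> + of_real x * cnj \<alpha>)) \<le> C" for j x
    using F_lattice[of j 0 "of_real x * cnj \<alpha>"] C(2)[of x] by (simp add: norm_mult norm_power_int)
  have 2: "norm (F (of_int l * cnj \<alpha> + of_real x * \<alpha>)) \<le> C" for l x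
    using F_lattice[of 0 l "of_real x * \<alpha>"] C(1)[of x] by (simp add: norm_mult norm_power_int)
  have "norm (F z) \<le> C" if "z \<in> path_image (rhombus_path (2 * real N * K) (2 * real N * K'))" for z N
  proof -
    from that consider
       u where "z = (1 - u) *\<^sub>R (of_real (2 * real N * K)) + u *\<^sub>R (\<i> * of_real (2 * real N * K'))"
     | u where "z = (1 - u) *\<^sub>R (\<i> * of_real (2 * real N * K')) + u *\<^sub>R (- of_real (2 * real N * K))"
     | u where "z = (1 - u) *\<^sub>R (- of_real (2 * real N * K)) + u *\<^sub>R (- \<i> * of_real (2 * real N * K'))"
     | u where "z = (1 - u) *\<^sub>R (- \<i> * of_real (2 * real N * K')) + u *\<^sub>R (of_real (2 * real N * K))"
      unfolding path_image_rhombus closed_segment_def by blast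
    then show ?thesis
    proof cases
      case 1
      \<comment> \<open>In coordinates with respect to \<alpha>, cnj \<alpha> this side runs from
        (N, N) to (N, -N); the other three are similar.\<close>
      then have "z = of_int (int N) * \<alpha> + of_real (real N * (1 - 2 * u)) * cnj \<alpha>"
        by (simp add: complex_eq_iff \<alpha>_def algebra_simps)
      then show ?thesis by (simp only: \<open>\<And>j x. norm (F (of_int j * \<alpha> + of_real x * cnj \<alpha>)) \<le> C\<close>)
    next
      case 2
      then have "z = of_int (- int N) * cnj \<alpha> + of_real (real N * (1 - 2 * u)) * \<alpha>"
        by (simp add: complex_eq_iff \<alpha>_def algebra_simps)
      then show ?thesis by (simp only: \<open>\<And>l x. norm (F (of_int l * cnj \<alpha> + of_real x * \<alpha>)) \<le> C\<close>)
    next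
      case 3
      then have "z = of_int (- int N) * \<alpha> + of_real (real N * (2 * u - 1)) * cnj \<alpha>"
        by (simp add: complex_eq_iff \<alpha>_def algebra_simps)
      then show ?thesis by (simp only: \<open>\<And>j x. norm (F (of_int j * \<alpha> + of_real x * cnj \<alpha>)) \<le> C\<close>)
    next
      case 4
      then have "z = of_int (int N) * cnj \<alpha> + of_real (real N * (2 * u - 1)) * \<alpha>"
        by (simp add: complex_eq_iff \<alpha>_def algebra_simps)
      then show ?thesis by (simp only: \<open>\<And>l x. norm (F (of_int l * cnj \<alpha> + of_real x * \<alpha>)) \<le> C\<close>)
    qed
  qed
  then show ?thesis by blast
qed

lemma F_over_self: "((\<lambda>v. v / F v) \<longlongrightarrow> 1) (at 0)"
proof -
  have "(F has_field_derivative 1) (at 0)"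
    using F unfolding is_sdc_def
    by (metis analytic_on_imp_differentiable_at field_differentiable_derivI singletonI)
  then have "((\<lambda>v. F v / v) \<longlongrightarrow> 1) (at 0)"
    using F by (simp add: has_field_derivative_iff is_sdc_def)
  from tendsto_inverse[OF this] show ?thesis by simp
qed

text \<open>By \<open>F_w\<close> the function near the pole is a sign times 1/F(v), and v/F(v)
  tends to 1; so the pole is simple and the power of z enters only by its value.\<close>

lemma residue_w:
  "residue (\<lambda>z. F z / z ^ Suc p) (w j l) = - ((-1) powi (j + l) / w j l ^ Suc p)"
proof -
  define f where "f = (\<lambda>z. F z / z ^ Suc p)"
  have "isolated_singularity_at F (w j l)"
    using F by (auto simp: is_sdc_def nicely_meromorphic_on_def meromorphic_on_altdef)
  then obtain r where r: "r > 0" "F analytic_on ball (w j l) r - {w j l}"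
    by (auto simp: isolated_singularity_at_def)
  \<comment> \<open>The radius is at most |w|, which keeps the pole of the power at 0
    outside.\<close>
  define S where "S = ball (w j l) (min r (norm (w j l)))"
  have "open S" "w j l \<in> S" using r(1) w_nonzero by (auto simp: S_def)
  moreover have "f holomorphic_on S - {w j l}"
  proof (rule analytic_imp_holomorphic)
    have "F analytic_on S - {w j l}" using r(2) by (rule analytic_on_subset) (auto simp: S_def)
    then show "f analytic_on S - {w j l}"
      unfolding f_def by (intro analytic_on_divide analytic_on_power analytic_on_ident) (auto simp: S_def)
  qed
  moreover have "((\<lambda>z. f z * (z - w j l)) \<longlongrightarrow> - ((-1) powi (j + l) / w j l ^ Suc p)) (at (w j l))"
  proof -
    have "((\<lambda>v. - ((-1) powi (j + l) * (v / F v) / (v + w j l) ^ Suc p)) \<longlongrightarrow>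
        - ((-1) powi (j + l) * 1 / (0 + w j l) ^ Suc p)) (at 0)"
      by (intro tendsto_intros F_over_self) (simp add: w_nonzero)
    moreover have "f (v + w j l) * v = - ((-1) powi (j + l) * (v / F v) / (v + w j l) ^ Suc p)" for v
      using F_w[of j l v] by (simp add: f_def add.commute divide_inverse mult_ac)
    ultimately have "((\<lambda>v. f (v + w j l) * v) \<longlongrightarrow> - ((-1) powi (j + l) / w j l ^ Suc p)) (at 0)" by simp
    then show ?thesis
      unfolding at_to_0[of "w j l"] by (simp add: filterlim_filtermap)
  qed
  ultimately have "residue f (w j l) = - ((-1) powi (j + l) / w j l ^ Suc p)"
    by (rule residue_simple')
  then show ?thesis by (simp add: f_def)
qed

end

context sdc_function
begin

text \<open>Residue theorem for F(z)/z^(p+1): the residue at 0 is the Taylor coefficient, and the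
  others are the negatives of the lattice terms, so the error is the contour integral over 2 pi
  i.\<close>

lemma lattice_sum_error:
  assumes N: "N \<ge> 1"
    and C: "\<And>z. z \<in> path_image (rhombus_path (2 * real N * K) (2 * real N * K')) \<Longrightarrow> norm (F z) \<le> C"
  shows "norm ((deriv ^^ p) F 0 / fact p - (\<Sum>(j,l)\<in>{-int N..<int N}\<times>{-int N..<int N}. (-1) powi (j + l) / w j l ^ Suc p))
     \<le> 4 * (C * ((1 / (2 * K) + 1 / (2 * K')) / real N) ^ Suc p * (2 * real N * (K + K'))) / (2 * pi)"
proof -
  define f where "f = (\<lambda>z. F z / z ^ Suc p)"
  define a where "a = 2 * real N * K"
  define b where "b = 2 * real N * K'"
  have ab: "a > 0" "b > 0" using N K_pos K'_pos by (simp_all add: a_def b_def)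
  define I where "I = {-int N..<int N} \<times> {-int N..<int N}"
  define W where "W = (\<lambda>(j,l). w j l) ` I"
  \<comment> \<open>The slack 1/4 makes the domain contain the path without admitting new poles:
    pole coordinates jump from N - 1/2 to N + 1/2.\<close>
  define S where "S = rhombus (2 * (real N + 1/4) * K) (2 * (real N + 1/4) * K')"
  have W_in: "W \<subseteq> rhombus a b"
  proof
    fix z assume "z \<in> W"
    then obtain j l where jl: "-int N \<le> j" "j < int N" "-int N \<le> l" "l < int N" "z = w j l"
      by (auto simp: W_def I_def)
    then show "z \<in> rhombus a b" unfolding a_def b_def jl(5) using N by (subst w_in_rhombus) (simp, linarith)
  qed
  have W_if: "w j l \<in> W" if "w j l \<in> S" for j l
  proof -
    have "\<bar>of_int j + 1/2\<bar> < real N + 1/4" "\<bar>of_int l + 1/2\<bar> < real N + 1/4"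
      using that w_in_rhombus[of "real N + 1/4" j l] by (simp_all add: S_def)
    then have "-int N \<le> j" "j < int N" "-int N \<le> l" "l < int N" by linarith+
    then show ?thesis unfolding W_def I_def by (intro image_eqI[of _ _ "(j, l)"]) auto
  qed
  have fin: "finite (insert 0 W)" by (simp add: W_def I_def)
  have sub: "path_image (rhombus_path a b) \<subseteq> S"
  proof -
    define M where "M = real N + 1/4"
    define P Q where "P = 2 * M * K" and "Q = 2 * M * K'"
    define t where "t = real N / M"
    have "a / P = t" "b / Q = t" using K_pos K'_pos by (simp_all add: a_def b_def P_def Q_def t_def)
    moreover have "0 \<le> t" "t < 1" by (simp_all add: t_def M_def)
    moreover have "S = rhombus P Q" by (simp add: S_def P_def Q_def M_def)
    ultimately have "{of_real a, \<i> * of_real b, - of_real a, - \<i> * of_real b} \<subseteq> S"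
      by (auto simp: rhombus_def)
    then show ?thesis
      unfolding path_image_rhombus
      by (intro Un_least closed_segment_subset) (auto simp: S_def convex_open_rhombus)
  qed
  have in_rhombus: "insert 0 W \<subseteq> rhombus a b" using W_in by (auto simp: rhombus_def)
  then have sub': "path_image (rhombus_path a b) \<subseteq> S - insert 0 W"
    using sub rhombus_path_disjoint[OF ab] by blast
  have fhol: "f holomorphic_on S - insert 0 W"
  proof (rule analytic_imp_holomorphic, subst analytic_on_analytic_at, rule ballI)
    fix z assume z: "z \<in> S - insert 0 W"
    then have "F analytic_on {z}" using W_if by (intro F_analytic) auto
    then show "f analytic_on {z}"
      unfolding f_def using z by (intro analytic_on_divide analytic_on_power analytic_on_ident) auto
  qed
  have S: "open S" "convex S" by (simp_all add: S_def convex_open_rhombus)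
  have "contour_integral (rhombus_path a b) f =
      2 * pi * \<i> * (\<Sum>z\<in>insert 0 W. winding_number (rhombus_path a b) z * residue f z)"
  proof (rule Residue_theorem[OF S(1) convex_connected[OF S(2)] fin fhol])
    show "\<forall>z. z \<notin> S \<longrightarrow> winding_number (rhombus_path a b) z = 0"
      using winding_number_zero_outside[OF _ S(2) _ _ sub] by simp
  qed (use sub' in auto)
  also have "(\<Sum>z\<in>insert 0 W. winding_number (rhombus_path a b) z * residue f z) = (\<Sum>z\<in>insert 0 W. residue f z)"
    using in_rhombus winding_number_rhombus[OF ab] by (intro sum.cong) (auto simp: subset_iff)
  also have "\<dots> = residue f 0 + (\<Sum>z\<in>W. residue f z)"
    using fin w_nonzero by (intro sum.insert) (auto simp: W_def)
  also have "(\<Sum>z\<in>W. residue f z) = (\<Sum>(j,l)\<in>I. residue f (w j l))"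
    unfolding W_def by (subst sum.reindex) (auto simp: inj_on_def w_eq_iff case_prod_unfold o_def intro!: sum.cong)
  also have "\<dots> = - (\<Sum>(j,l)\<in>I. (-1) powi (j + l) / w j l ^ Suc p)"
    unfolding f_def residue_w by (simp add: sum_negf case_prod_unfold)
  also have "residue f 0 = (deriv ^^ p) F 0 / fact p"
  proof -
    obtain A where "open A" "0 \<in> A" "F holomorphic_on A"
      using F by (auto simp: is_sdc_def analytic_at)
    then show ?thesis unfolding f_def by (rule residue_holomorphic_over_power')
  qed
  finally have ci: "contour_integral (rhombus_path a b) f = 2 * of_real pi * \<i> *
     ((deriv ^^ p) F 0 / fact p - (\<Sum>(j,l)\<in>I. (-1) powi (j + l) / w j l ^ Suc p))" by simp
  \<comment> \<open>m/N is 1/a + 1/b; on the boundary |Re z|/a + |Im z|/b is at least 1, so |z| is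
    at least N/m.\<close>
  define m where "m = 1 / (2 * K) + 1 / (2 * K')"
  have m: "m > 0" using K_pos K'_pos by (simp add: m_def add_pos_pos)
  have fint: "f contour_integrable_on rhombus_path a b"
    by (rule contour_integrable_holomorphic_simple[OF fhol _ _ sub'])
       (use S fin in \<open>auto intro!: open_Diff finite_imp_closed\<close>)
  have "norm (contour_integral (rhombus_path a b) f) \<le> 4 * ((C * (m / real N) ^ Suc p) * (a + b))"
  proof (rule contour_integral_rhombus_bound[OF fint _ ab])
    fix z assume z: "z \<in> path_image (rhombus_path a b)"
    from rhombus_path_boundary[OF ab z]
    have "1 \<le> \<bar>Re z / a\<bar> + \<bar>Im z / b\<bar>" by linarith
    also have "\<dots> \<le> norm z / a + norm z / b"
      using ab abs_Re_le_cmod[of z] abs_Im_le_cmod[of z] by (intro add_mono) (auto simp: abs_divide divide_right_mono)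
    also have "\<dots> = norm z * (m / real N)"
      using N K_pos K'_pos by (simp add: a_def b_def m_def field_simps)
    finally have *: "1 \<le> norm z * (m / real N)" .
    have "z \<noteq> 0" using sub' z by auto
    have "1 \<le> (norm z * (m / real N)) ^ Suc p" using * by (rule one_le_power)
    then have "1 / norm z ^ Suc p \<le> (m / real N) ^ Suc p"
      using \<open>z \<noteq> 0\<close> unfolding power_mult_distrib by (simp add: divide_le_eq mult.commute del: power_Suc)
    moreover have FC: "norm (F z) \<le> C" using C[of z] z by (simp add: a_def b_def)
    moreover have "0 \<le> C" using order.trans[OF norm_ge_zero FC] .
    ultimately have "norm (F z) * (1 / norm z ^ Suc p) \<le> C * (m / real N) ^ Suc p"
      by (intro mult_mono) simp_all
    then show "norm (f z) \<le> C * (m / real N) ^ Suc p"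
      by (simp add: f_def norm_divide norm_power norm_mult)
  qed
  then have "2 * pi * norm ((deriv ^^ p) F 0 / fact p - (\<Sum>(j,l)\<in>I. (-1) powi (j + l) / w j l ^ Suc p))
      \<le> 4 * (C * (m / real N) ^ Suc p * (2 * real N * (K + K')))"
    unfolding ci by (simp add: norm_mult a_def b_def distrib_left)
  then have "norm ((deriv ^^ p) F 0 / fact p - (\<Sum>(j,l)\<in>I. (-1) powi (j + l) / w j l ^ Suc p)) * (2 * pi)
      \<le> 4 * (C * (m / real N) ^ Suc p * (2 * real N * (K + K')))"
    by (simp only: mult.commute)
  then show ?thesis
    unfolding I_def m_def by (rule mult_imp_le_div_pos[rotated]) simp
qed

text \<open>The integrand is of order N^(-p-1) on a path of length of order N, so the error is of
  order N^(-p); this tends to 0 from p = 1 on.\<close>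

theorem lattice_sum_limit:
  assumes p: "p \<ge> 1"
  shows "(\<lambda>N. \<Sum>(j,l)\<in>{-int N..<int N}\<times>{-int N..<int N}. (-1) powi (j + l) / w j l ^ Suc p)
     \<longlonglongrightarrow> (deriv ^^ p) F 0 / fact p"
proof -
  obtain C where C: "\<And>N z. z \<in> path_image (rhombus_path (2 * real N * K) (2 * real N * K')) \<Longrightarrow> norm (F z) \<le> C"
    using F_bounded_rhombus_path by blast
  define m where "m = 1 / (2 * K) + 1 / (2 * K')"
  define B where "B = (\<lambda>N. 4 * (C * (m / real N) ^ Suc p * (2 * real N * (K + K'))) / (2 * pi))"
  have "B \<longlonglongrightarrow> 0"
  proof -
    obtain q where q: "p = Suc q" using p by (cases p) auto
    have "(\<lambda>N. 4 * C * m * (K + K') / pi * (m / real N) ^ p) \<longlonglongrightarrow> 4 * C * m * (K + K') / pi * 0 ^ p"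
      by (intro tendsto_intros lim_const_over_n)
    moreover have "eventually (\<lambda>N. 4 * C * m * (K + K') / pi * (m / real N) ^ p = B N) sequentially"
      using eventually_gt_at_top[of 0] by eventually_elim (simp add: B_def field_simps)
    ultimately show ?thesis using q by (simp add: tendsto_cong)
  qed
  then have "(\<lambda>N. (deriv ^^ p) F 0 / fact p -
      (\<Sum>(j,l)\<in>{-int N..<int N}\<times>{-int N..<int N}. (-1) powi (j + l) / w j l ^ Suc p)) \<longlonglongrightarrow> 0"
  proof (rule Lim_null_comparison[rotated])
    show "eventually (\<lambda>N. norm ((deriv ^^ p) F 0 / fact p -
      (\<Sum>(j,l)\<in>{-int N..<int N}\<times>{-int N..<int N}. (-1) powi (j + l) / w j l ^ Suc p)) \<le> B N) sequentially"
      using eventually_ge_at_top[of 1]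
      by eventually_elim (unfold B_def m_def, rule lattice_sum_error[OF _ C])
  qed
  from tendsto_diff[OF tendsto_const[of "(deriv ^^ p) F 0 / fact p"] this] show ?thesis by simp
qed

end

section \<open>The integral as a lattice sum\<close>

lemma tendsto_power_mult_exp_neg:
  assumes "c > (0::real)"
  shows "((\<lambda>x. x ^ m * exp (- (c * x))) \<longlongrightarrow> 0) at_top"
proof -
  have "filterlim (\<lambda>x. c * x) at_top at_top"
    using assms by (intro filterlim_tendsto_pos_mult_at_top[OF tendsto_const] filterlim_ident)
  from filterlim_compose[OF tendsto_power_div_exp_0 this]
  have "((\<lambda>x. (c * x) ^ m / exp (c * x)) \<longlongrightarrow> 0) at_top" .
  then have "((\<lambda>x. (1 / c ^ m) * ((c * x) ^ m / exp (c * x))) \<longlongrightarrow> (1 / c ^ m) * 0) at_top"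
    by (intro tendsto_intros)
  moreover have "(1 / c ^ m) * ((c * x) ^ m / exp (c * x)) = x ^ m * exp (- (c * x))" for x
    using assms by (simp add: power_mult_distrib exp_minus field_simps)
  ultimately show ?thesis by simp
qed

text \<open>The primitive is normalised to vanish at infinity, so that -G(0) is the Laplace integral
  m!/w^(m+1). The induction is integration by parts.\<close>

lemma power_exp_antiderivative:
  fixes w :: complex
  assumes w: "Re w > 0"
  shows "\<exists>G. (\<forall>y. (G has_field_derivative y ^ m * exp (- (w * y))) (at y)) \<and> G 0 = - fact m / w ^ Suc m \<and>
     ((\<lambda>x::real. G (of_real x)) \<longlongrightarrow> 0) at_top"
proof -
  have w0: "w \<noteq> 0" using w by auto
  have lim: "((\<lambda>x. of_real x ^ m * exp (- (w * of_real x))) \<longlongrightarrow> 0) at_top" for m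
  proof (rule tendsto_norm_zero_cancel)
    have "eventually (\<lambda>x. x ^ m * exp (- (Re w * x)) = norm (of_real x ^ m * exp (- (w * of_real x)))) at_top"
      using eventually_ge_at_top[of 0] by eventually_elim (simp add: norm_mult norm_power)
    then show "((\<lambda>x. norm (of_real x ^ m * exp (- (w * of_real x)))) \<longlongrightarrow> 0) at_top"
      using tendsto_power_mult_exp_neg[OF w, of m] by (simp add: tendsto_cong)
  qed
  show ?thesis
  proof (induction m)
    case 0
    have "((\<lambda>y. - exp (- (w * y)) / w) has_field_derivative y ^ 0 * exp (- (w * y))) (at y)" for y
      using w0 by (auto intro!: derivative_eq_intros simp: field_simps)
    moreover have "((\<lambda>x::real. - exp (- (w * of_real x)) / w) \<longlongrightarrow> - 0 / w) at_top"
      using lim[of 0] w0 by (intro tendsto_intros) auto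
    ultimately show ?case by (intro exI[of _ "\<lambda>y. - exp (- (w * y)) / w"]) simp
  next
    case (Suc m)
    then obtain G where G: "\<And>y. (G has_field_derivative y ^ m * exp (- (w * y))) (at y)" "G 0 = - fact m / w ^ Suc m"
     "((\<lambda>x::real. G (of_real x)) \<longlongrightarrow> 0) at_top" by blast
    define H where "H = (\<lambda>y. of_nat (Suc m) / w * G y - y ^ Suc m * exp (- (w * y)) / w)"
    have E: "((\<lambda>y. exp (- (w * y))) has_field_derivative exp (- (w * y)) * - w) (at y)" for y
      by (auto intro!: derivative_eq_intros)
    have P: "((\<lambda>y. y ^ Suc m) has_field_derivative of_nat (Suc m) * y ^ m) (at y)" for y :: complex
      by (rule derivative_eq_intros refl)+ simp
    have "(H has_field_derivative of_nat (Suc m) / w * (y ^ m * exp (- (w * y))) -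
        (of_nat (Suc m) * y ^ m * exp (- (w * y)) + y ^ Suc m * (exp (- (w * y)) * - w)) / w) (at y)" for y
      unfolding H_def using DERIV_diff[OF DERIV_cmult[OF G(1)] DERIV_cdivide[OF DERIV_mult'[OF P E]]]
      by (simp only: add.commute)
    moreover have "of_nat (Suc m) / w * (y ^ m * exp (- (w * y))) -
        (of_nat (Suc m) * y ^ m * exp (- (w * y)) + y ^ Suc m * (exp (- (w * y)) * - w)) / w = y ^ Suc m * exp (- (w * y))" for y
      using w0 by (simp add: field_simps)
    moreover have "H 0 = - fact (Suc m) / w ^ Suc (Suc m)"
      using w0 by (simp add: H_def G(2) field_simps)
    moreover have "((\<lambda>x::real. H (of_real x)) \<longlongrightarrow> of_nat (Suc m) / w * 0 - 0 / w) at_top"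
      unfolding H_def using w0 by (intro tendsto_intros G(3) lim)
    ultimately show ?case by (intro exI[of _ H]) simp
  qed
qed

text \<open>Substituting x = y^2 turns x^n dx into 2 y^(2n+1) dy, which accounts for the factor 2
  and the odd exponent.\<close>

lemma sqrt_laplace_antiderivative:
  assumes w: "Re w > 0"
  shows "\<exists>\<Phi> :: real \<Rightarrow> complex. (\<forall>x>0. (\<Phi> has_vector_derivative of_real x ^ n * exp (- (w * of_real (sqrt x)))) (at x)) \<and>
    (\<Phi> \<longlongrightarrow> - 2 * fact (2*n+1) / w ^ (2*n+2)) (at_right 0) \<and> (\<Phi> \<longlongrightarrow> 0) at_top"
proof -
  obtain G where G: "\<And>y. (G has_field_derivative y ^ (2*n+1) * exp (- (w * y))) (at y)" "G 0 = - fact (2*n+1) / w ^ Suc (2*n+1)"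
     "((\<lambda>x::real. G (of_real x)) \<longlongrightarrow> 0) at_top"
    using power_exp_antiderivative[OF w, of "2*n+1"] by blast
  define \<Phi> where "\<Phi> = (\<lambda>x. 2 * G (of_real (sqrt x)))"
  have "(\<Phi> has_vector_derivative of_real x ^ n * exp (- (w * of_real (sqrt x)))) (at x)" if x: "x > 0" for x
  proof -
    have "((\<lambda>x. G (of_real (sqrt x))) has_vector_derivative
        of_real (inverse (sqrt x) / 2) * (of_real (sqrt x) ^ (2*n+1) * exp (- (w * of_real (sqrt x))))) (at x)"
      by (rule field_vector_diff_chain_at[OF has_vector_derivative_of_real[OF DERIV_real_sqrt[OF x]] G(1), unfolded o_def])
    then have "(\<Phi> has_vector_derivative 2 * (of_real (inverse (sqrt x) / 2) * (of_real (sqrt x) ^ (2*n+1) * exp (- (w * of_real (sqrt x)))))) (at x)"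
      unfolding \<Phi>_def by (rule has_vector_derivative_mult_right)
    moreover have "2 * (of_real (inverse (sqrt x) / 2) * (of_real (sqrt x) ^ (2*n+1) * exp (- (w * of_real (sqrt x))))) =
       of_real x ^ n * exp (- (w * of_real (sqrt x)))"
    proof -
      have "2 * (inverse (sqrt x) / 2) * sqrt x ^ (2*n+1) = x ^ n"
        using x by (simp add: power_mult)
      then have "complex_of_real (2 * (inverse (sqrt x) / 2) * sqrt x ^ (2*n+1)) = of_real (x ^ n)" by (simp only:)
      then show ?thesis by (simp add: mult.assoc)
    qed
    ultimately show ?thesis by (simp only:)
  qed
  moreover have "(\<Phi> \<longlongrightarrow> 2 * G (of_real (sqrt 0))) (at_right 0)"
    unfolding \<Phi>_def
  proof (intro tendsto_intros isCont_tendsto_compose[of _ G])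
    show "isCont G (of_real (sqrt 0))" using G(1) by (rule DERIV_isCont)
  qed
  moreover have "(\<Phi> \<longlongrightarrow> 2 * 0) at_top"
    unfolding \<Phi>_def by (intro tendsto_intros filterlim_compose[OF G(3)] sqrt_at_top)
  ultimately show ?thesis by (intro exI[of _ \<Phi>]) (simp add: G(2))
qed

text \<open>Integrability comes from the nonnegative integrand with exponent Re w, which is the
  modulus of the complex one; the value then follows from the fundamental theorem.\<close>

lemma sqrt_laplace:
  assumes w: "Re w > 0"
  shows "set_integrable lborel {0<..} (\<lambda>x. of_real x ^ n * exp (- (w * of_real (sqrt x))))"
    and "(LBINT x:{0<..}. of_real x ^ n * exp (- (w * of_real (sqrt x)))) = 2 * fact (2*n+1) / w ^ (2*n+2)"
proof -
  have ein: "einterval (ereal 0) \<infinity> = {0<..}" by (simp add: einterval_eq)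
  have real_int: "set_integrable lborel {0<..} (\<lambda>x. x ^ n * exp (- (Re w * sqrt x)))"
  proof -
    have "Re (complex_of_real (Re w)) > 0" using w by simp
    from sqrt_laplace_antiderivative[OF this, of n]
    obtain \<Phi> :: "real \<Rightarrow> complex" where \<Phi>: "\<forall>x>0. (\<Phi> has_vector_derivative of_real x ^ n * exp (- (of_real (Re w) * of_real (sqrt x)))) (at x)"
      "(\<Phi> \<longlongrightarrow> - 2 * fact (2*n+1) / of_real (Re w) ^ (2*n+2)) (at_right 0)" "(\<Phi> \<longlongrightarrow> 0) at_top"
      by (elim exE conjE) (rule that)
    have "set_integrable lborel (einterval (ereal 0) \<infinity>) (\<lambda>x. x ^ n * exp (- (Re w * sqrt x)))"
    proof (rule interval_integral_FTC_nonneg(1)[where F = "\<lambda>x. Re (\<Phi> x)"])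
      fix x assume "ereal 0 < ereal x"
      then have "x > 0" by simp
      from bounded_linear.has_vector_derivative[OF bounded_linear_Re \<Phi>(1)[rule_format, OF this]]
      have "((\<lambda>x. Re (\<Phi> x)) has_vector_derivative Re (of_real (x ^ n * exp (- (Re w * sqrt x))))) (at x)"
        by (simp flip: exp_of_real)
      then show "((\<lambda>x. Re (\<Phi> x)) has_field_derivative x ^ n * exp (- (Re w * sqrt x))) (at x)"
        by (simp add: has_real_derivative_iff_has_vector_derivative)
      show "isCont (\<lambda>x. x ^ n * exp (- (Re w * sqrt x))) x" by (intro continuous_intros)
    next
      show "(((\<lambda>x. Re (\<Phi> x)) \<circ> real_of_ereal) \<longlongrightarrow> Re (- 2 * fact (2*n+1) / of_real (Re w) ^ (2*n+2))) (at_right (ereal 0))"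
        using tendsto_Re[OF \<Phi>(2)] by (simp only: ereal_tendsto_simps)
      show "(((\<lambda>x. Re (\<Phi> x)) \<circ> real_of_ereal) \<longlongrightarrow> Re 0) (at_left \<infinity>)"
        using tendsto_Re[OF \<Phi>(3)] by (simp only: ereal_tendsto_simps)
    qed (auto intro!: AE_I2)
    then show ?thesis unfolding ein .
  qed
  show int: "set_integrable lborel {0<..} (\<lambda>x. of_real x ^ n * exp (- (w * of_real (sqrt x))))"
  proof (rule set_integrable_bound[OF real_int])
    show "set_borel_measurable lborel {0<..} (\<lambda>x. of_real x ^ n * exp (- (w * of_real (sqrt x))))"
      unfolding set_borel_measurable_def by measurable
    show "AE x in lborel. x \<in> {0<..} \<longrightarrow> norm (of_real x ^ n * exp (- (w * of_real (sqrt x)))) \<le> norm (x ^ n * exp (- (Re w * sqrt x)))"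
      by (auto simp: norm_mult norm_power)
  qed
  obtain \<Phi> where \<Phi>: "\<And>x. x > 0 \<Longrightarrow> (\<Phi> has_vector_derivative of_real x ^ n * exp (- (w * of_real (sqrt x)))) (at x)"
      "(\<Phi> \<longlongrightarrow> - 2 * fact (2*n+1) / w ^ (2*n+2)) (at_right 0)" "(\<Phi> \<longlongrightarrow> 0) at_top"
    using sqrt_laplace_antiderivative[OF w, of n] by blast
  have "(LBINT x=ereal 0..\<infinity>. of_real x ^ n * exp (- (w * of_real (sqrt x)))) = 0 - (- 2 * fact (2*n+1) / w ^ (2*n+2))"
  proof (rule interval_integral_FTC_integrable)
    show "(\<Phi> has_vector_derivative of_real x ^ n * exp (- (w * of_real (sqrt x)))) (at x)" if "ereal 0 < ereal x" for x
      using that by (intro \<Phi>(1)) simp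
    show "isCont (\<lambda>x. of_real x ^ n * exp (- (w * of_real (sqrt x)))) x" for x
      by (intro continuous_intros)
    show "set_integrable lborel (einterval (ereal 0) \<infinity>) (\<lambda>x. of_real x ^ n * exp (- (w * of_real (sqrt x))))"
      unfolding ein by (rule int)
    show "((\<Phi> \<circ> real_of_ereal) \<longlongrightarrow> - 2 * fact (2*n+1) / w ^ (2*n+2)) (at_right (ereal 0))"
      using \<Phi>(2) by (simp only: ereal_tendsto_simps)
    show "((\<Phi> \<circ> real_of_ereal) \<longlongrightarrow> 0) (at_left \<infinity>)"
      using \<Phi>(3) by (simp only: ereal_tendsto_simps)
  qed auto
  then show "(LBINT x:{0<..}. of_real x ^ n * exp (- (w * of_real (sqrt x)))) = 2 * fact (2*n+1) / w ^ (2*n+2)"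
    by (simp add: interval_lebesgue_integral_def einterval_eq)
qed

lemma cosh_plus_cos_pos:
  assumes "K > 0"
  shows "cosh (y * K) + cos (y * K') > (0::real)"
proof (cases "y = 0")
  case False
  then have "cosh (y * K) > 1"
    using assms cosh_real_ge_1[of "y * K"] cosh_real_one_iff[of "y * K"] by (simp add: less_le)
  then show ?thesis using cos_ge_minus_one[of "y * K'"] by linarith
qed simp

text \<open>A minimum over a compact interval covers small y, exponential growth the rest. The bound
  yields the integrable majorant in \<open>cosh_cos_moment\<close>.\<close>

lemma cosh_plus_cos_lower_bound:
  assumes K: "K > 0"
  shows "\<exists>c>0. \<forall>y\<ge>0. c * exp (y * K) \<le> cosh (y * K) + cos (y * K' :: real)"
proof -
  define h where "h = (\<lambda>y. (cosh (y * K) + cos (y * K')) / exp (y * K))"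
  have hpos: "h y > 0" for y unfolding h_def using cosh_plus_cos_pos[OF K] by simp
  \<comment> \<open>From here on E = exp(y K) is at least 4, so E/2 - 1 is at least E/4.\<close>
  define Y where "Y = ln 4 / K"
  have "Y \<ge> 0" using K by (simp add: Y_def)
  moreover have "continuous_on {0..Y} h" unfolding h_def by (intro continuous_intros) auto
  ultimately obtain y0 where y0: "\<And>y. y \<in> {0..Y} \<Longrightarrow> h y0 \<le> h y"
    using continuous_attains_inf[of "{0..Y}" h] by (metis atLeastAtMost_iff compact_Icc empty_iff order_refl)
  have "min (1/4) (h y0) * exp (y * K) \<le> cosh (y * K) + cos (y * K')" if "y \<ge> 0" for y
  proof (cases "y \<le> Y")
    case True
    then have "min (1/4) (h y0) \<le> h y" using y0[of y] that by simp
    then have "min (1/4) (h y0) * exp (y * K) \<le> h y * exp (y * K)" by (intro mult_right_mono) auto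
    then show ?thesis by (simp add: h_def)
  next
    case False
    then have "ln 4 \<le> y * K" using K by (simp add: Y_def field_simps)
    then have e4: "4 \<le> exp (y * K)" by (metis exp_le_cancel_iff exp_ln zero_less_numeral)
    have "min (1/4) (h y0) * exp (y * K) \<le> 1/4 * exp (y * K)" by (intro mult_right_mono) auto
    also have "\<dots> \<le> exp (y * K) / 2 - 1" using e4 by simp
    also have "\<dots> \<le> cosh (y * K) + cos (y * K')"
      using cos_ge_minus_one[of "y * K'"] exp_gt_zero[of "- (y * K)"]
      unfolding cosh_field_def add_divide_distrib by linarith
    finally show ?thesis .
  qed
  then show ?thesis using hpos[of y0] by (intro exI[of _ "min (1/4) (h y0)"]) auto
qed

section \<open>Geometric expansion of the integrand\<close>

lemma cosh_of_real: "cosh (of_real x :: complex) = of_real (cosh x)"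
  by (simp add: cosh_field_def flip: exp_of_real)

lemma set_integral_sum:
  fixes f :: "'i \<Rightarrow> 'a \<Rightarrow> 'b :: {banach, second_countable_topology}"
  assumes "\<And>i. i \<in> I \<Longrightarrow> set_integrable M A (f i)"
  shows "set_integrable M A (\<lambda>x. \<Sum>i\<in>I. f i x)"
    and "(LINT x:A|M. (\<Sum>i\<in>I. f i x)) = (\<Sum>i\<in>I. LINT x:A|M. f i x)"
  using assms unfolding set_integrable_def set_lebesgue_integral_def
  by (simp_all add: scaleR_sum_right)

lemma two_cosh_cosh_cnj:
  "2 * cosh (\<alpha> / 2 * of_real c) * cosh (cnj \<alpha> / 2 * of_real c) = of_real (cosh (c * Re \<alpha>) + cos (c * Im \<alpha>))"
proof -
  have "2 * cosh (\<alpha> / 2 * of_real c) * cosh (cnj \<alpha> / 2 * of_real c) =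
      cosh (\<alpha> / 2 * of_real c + cnj \<alpha> / 2 * of_real c) + cosh (\<alpha> / 2 * of_real c - cnj \<alpha> / 2 * of_real c)"
    by (simp add: cosh_add cosh_diff)
  also have "\<alpha> / 2 * of_real c + cnj \<alpha> / 2 * of_real c = of_real (c * Re \<alpha>)"
    by (simp add: complex_eq_iff)
  also have "\<alpha> / 2 * of_real c - cnj \<alpha> / 2 * of_real c = \<i> * of_real (c * Im \<alpha>)"
    by (simp add: complex_eq_iff)
  finally show ?thesis
    by (simp only: cosh_of_real cos_conv_cosh[symmetric] cos_of_real of_real_add)
qed

text \<open>1/(2 cosh z) = exp(-z) / (1 + exp(-2z)); the prefactor exp(-z) creates the half
  integers.\<close>

lemma geometric_half_sum:
  fixes z :: complex
  assumes "1 + exp (- 2 * z) \<noteq> 0"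
  shows "(\<Sum>j<N. (-1) ^ j * exp (- (2 * (of_nat j + 1/2) * z))) = (1 - (- exp (- 2 * z)) ^ N) / (2 * cosh z)"
proof -
  have "(\<Sum>j<N. (-1) ^ j * exp (- (2 * (of_nat j + 1/2) * z))) = (\<Sum>j<N. exp (- z) * (- exp (- 2 * z)) ^ j)"
  proof (intro sum.cong refl)
    fix j
    have "exp (- (2 * (of_nat j + 1/2) * z)) = exp (- z + of_nat j * (- 2 * z))"
      by (simp add: algebra_simps)
    also have "\<dots> = exp (- z) * exp (- 2 * z) ^ j" by (simp only: exp_add exp_of_nat_mult)
    finally show "(-1) ^ j * exp (- (2 * (of_nat j + 1/2) * z)) = exp (- z) * (- exp (- 2 * z)) ^ j"
      by (subst power_minus) simp
  qed
  also have "\<dots> = exp (- z) * (\<Sum>j<N. (- exp (- 2 * z)) ^ j)" by (simp add: sum_distrib_left)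
  also have "(\<Sum>j<N. (- exp (- 2 * z)) ^ j) = (1 - (- exp (- 2 * z)) ^ N) / (1 + exp (- 2 * z))"
  proof -
    have "- exp (- 2 * z) \<noteq> 1"
    proof
      assume "- exp (- 2 * z) = 1"
      then have "1 + exp (- 2 * z) = - exp (- 2 * z) + exp (- 2 * z)" by (simp only:)
      then show False using assms by simp
    qed
    then show ?thesis by (simp add: sum_gp_strict)
  qed
  also have "exp (- z) * ((1 - (- exp (- 2 * z)) ^ N) / (1 + exp (- 2 * z))) = (1 - (- exp (- 2 * z)) ^ N) / (2 * cosh z)"
  proof -
    have "2 * cosh z * exp (- z) = 1 + exp (- 2 * z)"
      by (simp add: cosh_field_def algebra_simps flip: exp_add)
    then have "1 / (2 * cosh z) = exp (- z) / (1 + exp (- 2 * z))"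
      using assms by (cases "cosh z = 0") (auto simp: field_simps)
    then have "(1 - (- exp (- 2 * z)) ^ N) * (1 / (2 * cosh z)) = (1 - (- exp (- 2 * z)) ^ N) * (exp (- z) / (1 + exp (- 2 * z)))"
      by (simp only:)
    then show ?thesis by (simp add: mult.commute)
  qed
  finally show ?thesis .
qed

lemma exp_double_sum:
  assumes \<alpha>: "Re \<alpha> > 0" and c: "c > 0"
  defines "q \<equiv> exp (- (\<alpha> * of_real c))"
  shows "(\<Sum>(j,l)\<in>{..<N}\<times>{..<N}. (-1) ^ (j + l) * exp (- (((of_nat j + 1/2) * \<alpha> + (of_nat l + 1/2) * cnj \<alpha>) * of_real c))) =
     (1 - (- q) ^ N) * (1 - (- cnj q) ^ N) / (2 * of_real (cosh (c * Re \<alpha>) + cos (c * Im \<alpha>)))"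
proof -
  have q1: "norm q < 1" unfolding q_def using assms by simp
  have nz: "1 + q \<noteq> 0" "1 + cnj q \<noteq> 0"
    using q1 by (auto simp: add_eq_0_iff2 add_eq_0_iff dest: arg_cong[of _ _ norm])
  have q: "exp (- 2 * (\<alpha> / 2 * of_real c)) = q" "exp (- 2 * (cnj \<alpha> / 2 * of_real c)) = cnj q"
    by (simp_all add: q_def exp_cnj)
  have "(\<Sum>(j,l)\<in>{..<N}\<times>{..<N}. (-1) ^ (j + l) * exp (- (((of_nat j + 1/2) * \<alpha> + (of_nat l + 1/2) * cnj \<alpha>) * of_real c)))
     = (\<Sum>(j,l)\<in>{..<N}\<times>{..<N}. ((-1) ^ j * exp (- (2 * (of_nat j + 1/2) * (\<alpha> / 2 * of_real c)))) *
           ((-1) ^ l * exp (- (2 * (of_nat l + 1/2) * (cnj \<alpha> / 2 * of_real c)))))"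
  proof -
    have "exp (- (((of_nat j + 1/2) * \<alpha> + (of_nat l + 1/2) * cnj \<alpha>) * of_real c)) =
        exp (- (2 * (of_nat j + 1/2) * (\<alpha> / 2 * of_real c))) * exp (- (2 * (of_nat l + 1/2) * (cnj \<alpha> / 2 * of_real c)))" for j l
      unfolding exp_add[symmetric] by (rule arg_cong[of _ _ exp]) (simp add: field_simps)
    then show ?thesis by (simp only: power_add mult_ac)
  qed
  also have "\<dots> = (\<Sum>j<N. (-1) ^ j * exp (- (2 * (of_nat j + 1/2) * (\<alpha> / 2 * of_real c)))) *
      (\<Sum>l<N. (-1) ^ l * exp (- (2 * (of_nat l + 1/2) * (cnj \<alpha> / 2 * of_real c))))"
    by (simp only: sum_product sum.cartesian_product)
  also have "\<dots> = ((1 - (- q) ^ N) / (2 * cosh (\<alpha> / 2 * of_real c))) * ((1 - (- cnj q) ^ N) / (2 * cosh (cnj \<alpha> / 2 * of_real c)))"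
    using geometric_half_sum[of "\<alpha> / 2 * of_real c" N, unfolded q, OF nz(1)]
      geometric_half_sum[of "cnj \<alpha> / 2 * of_real c" N, unfolded q, OF nz(2)] by (simp only:)
  also have "\<dots> = (1 - (- q) ^ N) * (1 - (- cnj q) ^ N) / (2 * (2 * cosh (\<alpha> / 2 * of_real c) * cosh (cnj \<alpha> / 2 * of_real c)))"
    by simp
  finally show ?thesis unfolding two_cosh_cosh_cnj .
qed

text \<open>For n = 0 the integrals of the moduli of the terms have a divergent sum, so termwise
  integration is replaced by dominated convergence along squares. The double series sums to half of
  \<open>f\<close>, and each term integrates to twice a factorial over a power: hence the factor
  4.\<close>

lemma cosh_cos_moment:
  fixes K K' :: real and n :: nat
  assumes K: "K > 0"
  defines "\<alpha> \<equiv> Complex K K'"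
  defines "f \<equiv> (\<lambda>x. complex_of_real x ^ n / of_real (cosh (sqrt x * K) + cos (sqrt x * K')))"
  shows "set_integrable lborel {0<..} f"
    and "(\<lambda>N. 4 * fact (2*n+1) * (\<Sum>(j,l)\<in>{..<N}\<times>{..<N}. (-1) ^ (j + l) / ((of_nat j + 1/2) * \<alpha> + (of_nat l + 1/2) * cnj \<alpha>) ^ (2*n+2)))
      \<longlonglongrightarrow> (LBINT x:{0<..}. f x)"
proof -
  define D where "D = (\<lambda>x. cosh (sqrt x * K) + cos (sqrt x * K'))"
  define w where "w = (\<lambda>j l::nat. (of_nat j + 1/2) * \<alpha> + (of_nat l + 1/2) * cnj \<alpha>)"
  have Re_w: "Re (w j l) > 0" for j l
    using K by (simp add: w_def \<alpha>_def add_pos_pos)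
  define S where "S = (\<lambda>N x. \<Sum>(j,l)\<in>{..<N}\<times>{..<N}. (-1) ^ (j + l) * (of_real x ^ n * exp (- (w j l * of_real (sqrt x)))))"
  have S_int: "set_integrable lborel {0<..} (S N)" for N
    unfolding S_def case_prod_unfold by (intro set_integral_sum set_integrable_mult_right sqrt_laplace Re_w)
  have S_val: "(LBINT x:{0<..}. S N x) = (\<Sum>(j,l)\<in>{..<N}\<times>{..<N}. (-1) ^ (j + l) * (2 * fact (2*n+1) / w j l ^ (2*n+2)))" for N
  proof -
    have "(LBINT x:{0<..}. S N x) = (\<Sum>jl\<in>{..<N}\<times>{..<N}. (LBINT x:{0<..}. (-1) ^ (fst jl + snd jl) * (of_real x ^ n * exp (- (w (fst jl) (snd jl) * of_real (sqrt x))))))"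
      unfolding S_def case_prod_unfold by (intro set_integral_sum set_integrable_mult_right sqrt_laplace Re_w)
    then show ?thesis by (simp add: case_prod_unfold sqrt_laplace(2)[OF Re_w] del: fact_Suc power_Suc)
  qed
  have S_eq: "S N x = of_real x ^ n * ((1 - (- exp (- (\<alpha> * of_real (sqrt x)))) ^ N) * (1 - (- cnj (exp (- (\<alpha> * of_real (sqrt x))))) ^ N)) / (2 * of_real (D x))"
    if "x > 0" for N x
  proof -
    have "S N x = of_real x ^ n * (\<Sum>(j,l)\<in>{..<N}\<times>{..<N}. (-1) ^ (j + l) * exp (- (w j l * of_real (sqrt x))))"
      unfolding S_def by (subst sum_distrib_left) (auto intro!: sum.cong simp: mult_ac)
    then show ?thesis
      unfolding w_def using exp_double_sum[of \<alpha> "sqrt x" N] K that by (simp add: \<alpha>_def D_def)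
  qed
  obtain c where c: "c > 0" "\<And>y. y \<ge> 0 \<Longrightarrow> c * exp (y * K) \<le> cosh (y * K) + cos (y * K')"
    using cosh_plus_cos_lower_bound[OF K, of K'] by blast
  have D_ge: "c * exp (K * sqrt x) \<le> D x" if "x > 0" for x
    using c(2)[of "sqrt x"] that by (simp add: D_def mult.commute)
  have D_pos: "D x > 0" if "x > 0" for x
    using D_ge[OF that] c(1) by (smt (verit) exp_gt_zero mult_pos_pos)
  \<comment> \<open>2/c arises as 2 * 2 / (2 * c): each geometric numerator is at most 2, and the
    denominator 2D is at least 2 c exp(K sqrt x).\<close>
  define g where "g = (\<lambda>x. x ^ n * exp (- (K * sqrt x)) * (2 / c))"
  have q_less: "norm (exp (- (\<alpha> * of_real (sqrt x)))) < 1" if "x > 0" for x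
    using K that by (simp add: \<alpha>_def)
  have bound: "norm (S N x) \<le> g x" if "x > 0" for N x
  proof -
    define q where "q = exp (- (\<alpha> * of_real (sqrt x)))"
    have q: "norm q < 1" unfolding q_def by (rule q_less[OF that])
    have *: "norm (1 - (- r) ^ N) \<le> 2" if "norm r < 1" for r :: complex
    proof -
      have "norm (1 - (- r) ^ N) \<le> norm (1::complex) + norm ((- r) ^ N)" by (rule norm_triangle_ineq4)
      moreover have "norm ((- r) ^ N) \<le> 1" using that by (simp add: norm_power power_le_one)
      ultimately show ?thesis by simp
    qed
    have "norm (S N x) = x ^ n * (norm (1 - (- q) ^ N) * norm (1 - (- cnj q) ^ N)) / (2 * D x)"
      using that D_pos[OF that] by (simp add: S_eq norm_mult norm_divide norm_power q_def)
    also have "\<dots> \<le> x ^ n * (2 * 2) / (2 * (c * exp (K * sqrt x)))"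
      using that c D_ge[OF that] *[of q] *[of "cnj q"] q
      by (intro frac_le mult_left_mono mult_mono) auto
    also have "\<dots> = g x" by (simp add: g_def exp_minus field_simps)
    finally show ?thesis .
  qed
  have g_int: "set_integrable lborel {0<..} g"
  proof -
    have "set_integrable lborel {0<..} (\<lambda>x. norm (of_real x ^ n * exp (- (of_real K * of_real (sqrt x))) :: complex))"
      by (rule set_integrable_norm[OF sqrt_laplace(1)]) (use K in simp)
    then have "set_integrable lborel {0<..} (\<lambda>x. x ^ n * exp (- (K * sqrt x)))"
      by (rule set_integrable_cong[THEN iffD1, rotated -1]) (auto simp: norm_mult norm_power)
    then show ?thesis unfolding g_def by (rule set_integrable_mult_left)
  qed
  have lim: "(\<lambda>N. S N x) \<longlonglongrightarrow> f x / 2" if "x > 0" for x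
  proof -
    define q where "q = exp (- (\<alpha> * of_real (sqrt x)))"
    have q: "norm (- q) < 1" "norm (- cnj q) < 1" using q_less[OF that] by (simp_all add: q_def)
    have "(\<lambda>N. of_real x ^ n * ((1 - (- q) ^ N) * (1 - (- cnj q) ^ N)) / (2 * of_real (D x)))
       \<longlonglongrightarrow> of_real x ^ n * ((1 - 0) * (1 - 0)) / (2 * of_real (D x))"
      using D_pos[OF that] by (intro tendsto_intros LIMSEQ_power_zero q) auto
    moreover have "of_real x ^ n * ((1 - 0) * (1 - 0)) / (2 * of_real (D x)) = f x / 2"
      by (simp add: f_def D_def)
    ultimately show ?thesis by (simp only: S_eq[OF that] q_def)
  qed
  have [measurable]: "D \<in> borel_measurable borel"
    unfolding D_def by (intro borel_measurable_continuous_onI continuous_intros)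
  have fD: "f = (\<lambda>x. complex_of_real x ^ n / of_real (D x))" by (simp add: f_def D_def)
  have meas: "(\<lambda>x. indicator {0<..} x *\<^sub>R (f x / 2)) \<in> borel_measurable lborel"
    unfolding fD by measurable
  have dom: "integrable lborel (\<lambda>x. indicator {0<..} x *\<^sub>R (f x / 2))"
    "(\<lambda>N. LBINT x:{0<..}. S N x) \<longlonglongrightarrow> (\<integral>x. indicator {0<..} x *\<^sub>R (f x / 2) \<partial>lborel)"
  proof -
    have m: "(\<lambda>x. indicator {0<..} x *\<^sub>R S N x) \<in> borel_measurable lborel" for N
      using S_int by (auto simp: set_integrable_def)
    have w: "integrable lborel (\<lambda>x. indicator {0<..} x *\<^sub>R g x)"
      using g_int by (simp add: set_integrable_def)
    have l: "AE x in lborel. (\<lambda>N. indicator {0<..} x *\<^sub>R S N x) \<longlonglongrightarrow> indicator {0<..} x *\<^sub>R (f x / 2)"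
      by (intro AE_I2) (auto simp: indicator_def intro: lim)
    have b: "AE x in lborel. norm (indicator {0<..} x *\<^sub>R S N x) \<le> indicator {0<..} x *\<^sub>R g x" for N
      by (intro AE_I2) (auto simp: indicator_def intro: bound)
    show "integrable lborel (\<lambda>x. indicator {0<..} x *\<^sub>R (f x / 2))"
      by (rule integrable_dominated_convergence[OF meas m w l b])
    show "(\<lambda>N. LBINT x:{0<..}. S N x) \<longlonglongrightarrow> (\<integral>x. indicator {0<..} x *\<^sub>R (f x / 2) \<partial>lborel)"
      unfolding set_lebesgue_integral_def by (rule integral_dominated_convergence[OF meas m w l b])
  qed
  have half: "set_integrable lborel {0<..} (\<lambda>x. f x / 2)" using dom(1) by (simp add: set_integrable_def)
  show "set_integrable lborel {0<..} f"
    using set_integrable_mult_right[of 2, OF half] by simp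
  have "(\<lambda>N. 2 * (LBINT x:{0<..}. S N x)) \<longlonglongrightarrow> 2 * (LBINT x:{0<..}. f x / 2)"
    using dom(2) by (intro tendsto_mult_left) (simp only: set_lebesgue_integral_def)
  moreover have "2 * (LBINT x:{0<..}. f x / 2) = (LBINT x:{0<..}. f x)"
    by simp
  moreover have "2 * (LBINT x:{0<..}. S N x) = 4 * fact (2*n+1) * (\<Sum>(j,l)\<in>{..<N}\<times>{..<N}. (-1) ^ (j + l) / w j l ^ (2*n+2))" for N
    unfolding S_val by (simp add: sum_distrib_left case_prod_unfold mult_ac del: fact_Suc power_Suc)
  ultimately show "(\<lambda>N. 4 * fact (2*n+1) * (\<Sum>(j,l)\<in>{..<N}\<times>{..<N}. (-1) ^ (j + l) / ((of_nat j + 1/2) * \<alpha> + (of_nat l + 1/2) * cnj \<alpha>) ^ (2*n+2)))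
      \<longlonglongrightarrow> (LBINT x:{0<..}. f x)" by (simp only: w_def)
qed

section \<open>Comparison\<close>

text \<open>The fraction has the form that the quotient rule gives for the derivative of s d / c.
  Multiplied by c^4, both sides equal (1 - 2ax + ax^2)^2 with x = s^2.\<close>

lemma sn_dn_cn_identity:
  fixes s c d a :: complex
  assumes "s\<^sup>2 + c\<^sup>2 = 1" "a * s\<^sup>2 + d\<^sup>2 = 1" "c \<noteq> 0"
  shows "(((c * d * d + - a * s * c * s) * c - s * d * (- s * d)) / (c * c))\<^sup>2 =
    1 + 2 * (1 - 2 * a) * (s * d / c)\<^sup>2 + (s * d / c) ^ 4"
proof -
  define x where "x = s\<^sup>2"
  have c2: "c\<^sup>2 = 1 - x" and d2: "d\<^sup>2 = 1 - a * x"
    using assms(1,2) by (auto simp: x_def algebra_simps)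
  have "(c * d * d + - a * s * c * s) * c - s * d * (- s * d) = c\<^sup>2 * d\<^sup>2 - a * x * c\<^sup>2 + x * d\<^sup>2"
    by (simp add: x_def algebra_simps power2_eq_square)
  also have "\<dots> = 1 - 2 * a * x + a * x\<^sup>2"
    unfolding c2 d2 by (simp add: algebra_simps power2_eq_square)
  finally have 1: "((c * d * d + - a * s * c * s) * c - s * d * (- s * d))\<^sup>2 = (1 - 2 * a * x + a * x\<^sup>2)\<^sup>2" by simp
  have "(1 + 2 * (1 - 2 * a) * (s * d / c)\<^sup>2 + (s * d / c) ^ 4) * (c\<^sup>2)\<^sup>2 =
      (c\<^sup>2)\<^sup>2 + 2 * (1 - 2 * a) * (x * d\<^sup>2) * c\<^sup>2 + x\<^sup>2 * (d\<^sup>2)\<^sup>2"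
    using assms(3) by (simp add: x_def field_simps power2_eq_square power4_eq_xxxx)
  also have "\<dots> = (1 - 2 * a * x + a * x\<^sup>2)\<^sup>2"
    unfolding c2 d2 by (simp add: algebra_simps power2_eq_square)
  finally have 2: "(1 + 2 * (1 - 2 * a) * (s * d / c)\<^sup>2 + (s * d / c) ^ 4) * (c\<^sup>2)\<^sup>2 = (1 - 2 * a * x + a * x\<^sup>2)\<^sup>2" .
  have "(c\<^sup>2)\<^sup>2 \<noteq> 0" using assms(3) by simp
  then show ?thesis
    unfolding power2_eq_square[of c, symmetric] power_divide[of _ "c\<^sup>2"] 1 2[symmetric]
    by (rule nonzero_mult_div_cancel_right)
qed

text \<open>Both quantities are first integrals of the differential system, so they keep their value
  at 0.\<close>

lemma jacobi_pythagoras: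
  assumes "is_jacobi_triple k s c d"
  shows "eventually (\<lambda>u. (s u)\<^sup>2 + (c u)\<^sup>2 = 1 \<and> (of_real k)\<^sup>2 * (s u)\<^sup>2 + (d u)\<^sup>2 = 1) (nhds 0)"
proof -
  obtain r where r: "r > 0" "\<And>u. u \<in> ball 0 r \<Longrightarrow> jacobi_ode k s c d u"
    using is_jacobi_triple_ode_nhds[OF assms] unfolding eventually_nhds_metric by (auto simp: dist_commute)
  have init: "s 0 = 0" "c 0 = 1" "d 0 = 1" using assms by (auto simp: is_jacobi_triple_def)
  define f where "f = (\<lambda>u. (s u)\<^sup>2 + (c u)\<^sup>2)"
  define g where "g = (\<lambda>u. (of_real k)\<^sup>2 * (s u)\<^sup>2 + (d u)\<^sup>2)"
  have D: "(f has_field_derivative 0) (at u)" "(g has_field_derivative 0) (at u)" if "u \<in> ball 0 r" for u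
  proof -
    have o: "(s has_field_derivative c u * d u) (at u)" "(c has_field_derivative - s u * d u) (at u)"
        "(d has_field_derivative - (of_real k)\<^sup>2 * s u * c u) (at u)"
      using r(2)[OF that] by (auto simp: jacobi_ode_def)
    show "(f has_field_derivative 0) (at u)" unfolding f_def
      by (rule derivative_eq_intros o refl)+ (simp add: algebra_simps)
    show "(g has_field_derivative 0) (at u)" unfolding g_def
      by (rule derivative_eq_intros o refl)+ (simp add: algebra_simps)
  qed
  have "f constant_on ball 0 r" "g constant_on ball 0 r"
    using D by (intro has_field_derivative_0_imp_constant_on; simp)+
  then have "f u = f 0" "g u = g 0" if "u \<in> ball 0 r" for u
    using that r(1) unfolding constant_on_def by (metis centre_in_ball)+
  then show ?thesis
    using r(1) init unfolding eventually_nhds_metric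
    by (intro exI[of _ r]) (auto simp: f_def g_def dist_commute)
qed

text \<open>\<open>remove_sings\<close> makes the quotient nicely meromorphic without changing its
  germ at 0, which is all that the derivatives at 0 see.\<close>

lemma is_sdc_jacobi:
  assumes J: "is_jacobi_triple k s c d"
  defines "F \<equiv> remove_sings (\<lambda>u. s u * d u / c u)"
  shows "is_sdc k F" and "eventually (\<lambda>u. F u = s u * d u / c u) (nhds 0)"
proof -
  define f where "f = (\<lambda>u. s u * d u / c u)"
  have init: "s 0 = 0" "c 0 = 1" "d 0 = 1" using J by (auto simp: is_jacobi_triple_def)
  have ode: "eventually (jacobi_ode k s c d) (nhds 0)" by (rule is_jacobi_triple_ode_nhds[OF J])
  then have an: "s analytic_on {0}" "c analytic_on {0}" "d analytic_on {0}"
    unfolding jacobi_ode_def eventually_conj_iff by (auto dest: eventually_deriv_imp_analytic)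
  have "eventually (\<lambda>u. c u \<noteq> 0) (nhds 0)"
    using tendsto_imp_eventually_ne[of c 1 "at 0" 0] analytic_at_imp_isCont[OF an(2)] init
    by (simp add: isCont_def eventually_nhds_conv_at)
  then have ev: "eventually (\<lambda>u. c u \<noteq> 0 \<and> jacobi_ode k s c d u \<and>
      (s u)\<^sup>2 + (c u)\<^sup>2 = 1 \<and> (of_real k)\<^sup>2 * (s u)\<^sup>2 + (d u)\<^sup>2 = 1) (nhds 0)"
    using ode jacobi_pythagoras[OF J] by eventually_elim auto
  have df: "(f has_field_derivative ((c u * d u * d u + - (of_real k)\<^sup>2 * s u * c u * s u) * c u - s u * d u * (- s u * d u)) / (c u * c u)) (at u)"
    if "c u \<noteq> 0" "jacobi_ode k s c d u" for u
  proof -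
    have o: "(s has_field_derivative c u * d u) (at u)" "(c has_field_derivative - s u * d u) (at u)"
        "(d has_field_derivative - (of_real k)\<^sup>2 * s u * c u) (at u)"
      using that(2) by (auto simp: jacobi_ode_def)
    show ?thesis unfolding f_def by (rule DERIV_divide[OF DERIV_mult[OF o(1,3)] o(2) that(1)])
  qed
  have fan: "f analytic_on {0}" unfolding f_def by (intro analytic_intros an) (simp add: init)
  have "eventually (\<lambda>u. f analytic_on {u}) (nhds 0)" by (rule eventually_analytic_nhds[OF fan])
  then have Ff: "eventually (\<lambda>u. F u = f u) (nhds 0)"
    by eventually_elim (simp add: F_def flip: f_def)
  then show "eventually (\<lambda>u. F u = s u * d u / c u) (nhds 0)" by (simp add: f_def)
  have Fan: "F analytic_on {0}"
    using fan analytic_at_cong[OF Ff refl] by simp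
  have "f meromorphic_on UNIV"
    unfolding f_def using J by (auto simp: is_jacobi_triple_def nicely_meromorphic_on_def intro!: meromorphic_intros)
  then have Fnm: "F nicely_meromorphic_on UNIV"
    unfolding F_def f_def by (rule remove_sings_nicely_meromorphic)
  have dF: "eventually (\<lambda>u. deriv F u = deriv f u) (nhds 0)"
  proof -
    have "eventually (\<lambda>u. eventually (\<lambda>v. F v = f v) (nhds u)) (nhds 0)"
      using Ff by (simp add: eventually_eventually)
    then show ?thesis by eventually_elim (rule deriv_cong_ev, auto)
  qed
  have "eventually (\<lambda>u. (deriv F u)\<^sup>2 = sdc_poly k (F u)) (nhds 0)"
    using ev Ff dF
  proof eventually_elim
    case (elim u)
    then have "(deriv F u)\<^sup>2 = (((c u * d u * d u + - (of_real k)\<^sup>2 * s u * c u * s u) * c u - s u * d u * (- s u * d u)) / (c u * c u))\<^sup>2"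
      using DERIV_imp_deriv[OF df[of u]] by simp
    then show ?case
      using elim sn_dn_cn_identity[of "s u" "c u" "(of_real k)\<^sup>2" "d u"] by (simp add: sdc_poly_def f_def)
  qed
  moreover have "deriv F 0 = 1"
    using eventually_nhds_x_imp_x[OF dF] DERIV_imp_deriv[OF df[of 0]] eventually_nhds_x_imp_x[OF ode] by (simp add: init)
  moreover have "F 0 = 0" using eventually_nhds_x_imp_x[OF Ff] by (simp add: f_def init)
  ultimately show "is_sdc k F" using Fnm Fan by (simp add: is_sdc_def)
qed

section \<open>Folding the lattice sum into quadrants\<close>

lemma sum_int_symmetric:
  fixes g :: "int \<Rightarrow> 'a::comm_monoid_add"
  shows "(\<Sum>j\<in>{- int N..<int N}. g j) = (\<Sum>j<N. g (int j) + g (- 1 - int j))"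
proof (induction N)
  case (Suc N)
  have "{- int (Suc N)..<int (Suc N)} = insert (int N) (insert (- 1 - int N) {- int N..<int N})" by auto
  then show ?case using Suc by (simp add: add_ac)
qed simp

lemma neg_one_powi: "(- 1 :: complex) powi m = (if even m then 1 else - 1)"
  by (simp add: power_int_minus_left)

context sdc_function
begin

text \<open>The index -1 - j reflects j + 1/2 to its negative. Opposite quadrants agree because the
  exponent is even; the mixed ones become quadrants for the exchanged pair K', K after rotation by
  i.\<close>

lemma lattice_sum_quadrants:
  fixes n :: nat
  defines "u \<equiv> \<lambda>\<beta> j l. (of_nat j + 1/2) * \<beta> + (of_nat l + 1/2) * cnj \<beta>"
  defines "S \<equiv> \<lambda>\<beta> N. \<Sum>(j,l)\<in>{..<N}\<times>{..<N}. (-1) ^ (j + l) / u \<beta> j l ^ (2*n+2)"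
  shows "(\<Sum>(j,l)\<in>{-int N..<int N}\<times>{-int N..<int N}. (-1) powi (j + l) / w j l ^ (2*n+2)) =
     2 * S \<alpha> N + 2 * (-1) ^ n * S (Complex K' K) N"
proof -
  define h where "h = (\<lambda>j l. (-1) powi (j + l) / w j l ^ (2*n+2))"
  define p where "p = (\<lambda>\<beta> j l. (-1) ^ (j + l) / u \<beta> j l ^ (2*n+2))"
  have pp: "h (int j) (int l) = p \<alpha> j l" for j l
  proof -
    have "w (int j) (int l) = u \<alpha> j l" by (simp add: w_def u_def \<alpha>_def complex_eq_iff algebra_simps)
    then show ?thesis by (simp add: h_def p_def neg_one_powi uminus_power_if)
  qed
  have mm: "h (- 1 - int j) (- 1 - int l) = p \<alpha> j l" for j l
  proof -
    have "w (- 1 - int j) (- 1 - int l) = - u \<alpha> j l" by (simp add: w_def u_def \<alpha>_def complex_eq_iff algebra_simps)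
    then show ?thesis by (simp add: h_def p_def neg_one_powi uminus_power_if)
  qed
  have ipow: "(\<i> * z) ^ (2*n+2) = - ((-1) ^ n) * z ^ (2*n+2)" "(- \<i> * z) ^ (2*n+2) = - ((-1) ^ n) * z ^ (2*n+2)" for z
  proof -
    have "2 * n + 2 = 2 * Suc n" by simp
    then have *: "x ^ (2*n+2) = (x\<^sup>2) ^ Suc n" for x :: complex
      by (simp only: power_mult)
    have "(- y) ^ Suc n = - ((-1) ^ n) * y ^ Suc n" for y :: complex
      by (subst power_minus) simp
    then show "(\<i> * z) ^ (2*n+2) = - ((-1) ^ n) * z ^ (2*n+2)" "(- \<i> * z) ^ (2*n+2) = - ((-1) ^ n) * z ^ (2*n+2)"
      unfolding * by (simp_all add: power_mult_distrib del: power_Suc)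
  qed
  have sgn: "(-1 :: complex) ^ n * (-1) ^ n = 1" by (simp flip: power_mult_distrib)
  \<comment> \<open>The rotation contributes i^(2n+2) = -(-1)^n, and the index shift by one
    contributes another minus sign; together they leave (-1)^n. The rotation also swaps the two
    indices.\<close>
  have pm: "h (int j) (- 1 - int l) = (-1) ^ n * p (Complex K' K) l j" for j l
  proof -
    have "w (int j) (- 1 - int l) = \<i> * u (Complex K' K) l j" by (simp add: w_def u_def \<alpha>_def complex_eq_iff algebra_simps)
    then show ?thesis using sgn by (simp add: h_def p_def neg_one_powi uminus_power_if ipow field_simps del: power_Suc)
  qed
  have mp: "h (- 1 - int j) (int l) = (-1) ^ n * p (Complex K' K) l j" for j l
  proof -
    have "w (- 1 - int j) (int l) = - \<i> * u (Complex K' K) l j" by (simp add: w_def u_def \<alpha>_def complex_eq_iff algebra_simps)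
    then show ?thesis using sgn by (simp add: h_def p_def neg_one_powi uminus_power_if ipow field_simps del: power_Suc)
  qed
  have "(\<Sum>(j,l)\<in>{-int N..<int N}\<times>{-int N..<int N}. h j l) = (\<Sum>j<N. \<Sum>l<N. h (int j) (int l) + h (int j) (- 1 - int l)
        + (h (- 1 - int j) (int l) + h (- 1 - int j) (- 1 - int l)))"
    by (simp only: sum.cartesian_product[symmetric] sum_int_symmetric sum.distrib add_ac)
  also have "\<dots> = (\<Sum>j<N. \<Sum>l<N. 2 * p \<alpha> j l + 2 * (-1) ^ n * p (Complex K' K) l j)"
    by (intro sum.cong refl) (simp add: pp mm pm mp)
  also have "\<dots> = 2 * (\<Sum>j<N. \<Sum>l<N. p \<alpha> j l) + 2 * (-1) ^ n * (\<Sum>j<N. \<Sum>l<N. p (Complex K' K) l j)"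
    by (simp add: sum.distrib sum_distrib_left)
  also have "(\<Sum>j<N. \<Sum>l<N. p (Complex K' K) l j) = (\<Sum>l<N. \<Sum>j<N. p (Complex K' K) l j)"
    by (rule sum.swap)
  finally show ?thesis by (simp only: h_def p_def S_def sum.cartesian_product)
qed

lemma deriv_eq_moments:
  fixes n :: nat
  defines "M \<equiv> \<lambda>a b. LBINT x:{0<..}. complex_of_real x ^ n / of_real (cosh (sqrt x * a) + cos (sqrt x * b))"
  shows "(deriv ^^ (2*n+1)) F 0 = (M K K' + (-1) ^ n * M K' K) / 2"
proof -
  define u where "u = (\<lambda>\<beta> j l. (of_nat j + 1/2) * \<beta> + (of_nat l + 1/2) * cnj \<beta>)"
  define S where "S = (\<lambda>\<beta> N. \<Sum>(j,l)\<in>{..<N}\<times>{..<N}. (-1) ^ (j + l) / u \<beta> j l ^ (2*n+2))"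
  have 1: "(\<lambda>N. 4 * fact (2*n+1) * S \<alpha> N) \<longlonglongrightarrow> M K K'"
    unfolding M_def S_def u_def \<alpha>_def by (rule cosh_cos_moment(2)[OF K_pos])
  have 2: "(\<lambda>N. 4 * fact (2*n+1) * S (Complex K' K) N) \<longlonglongrightarrow> M K' K"
    unfolding M_def S_def u_def by (rule cosh_cos_moment(2)[OF K'_pos])
  have "(\<lambda>N. \<Sum>(j,l)\<in>{-int N..<int N}\<times>{-int N..<int N}. (-1) powi (j + l) / w j l ^ Suc (2*n+1))
      \<longlonglongrightarrow> (deriv ^^ (2*n+1)) F 0 / fact (2*n+1)"
    by (rule lattice_sum_limit) simp
  then have "(\<lambda>N. 2 * S \<alpha> N + 2 * (-1) ^ n * S (Complex K' K) N) \<longlonglongrightarrow> (deriv ^^ (2*n+1)) F 0 / fact (2*n+1)"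
    unfolding S_def u_def lattice_sum_quadrants[symmetric] by (simp only: add_Suc_right One_nat_def add_0_right numeral_2_eq_2)
  \<comment> \<open>This factor turns the 2 before each quadrant sum into the normalisation
    \<open>4 * fact (2*n+1)\<close> of the moments.\<close>
  from tendsto_mult_left[OF this, of "2 * fact (2*n+1)"]
  have 3: "(\<lambda>N. 2 * fact (2*n+1) * (2 * S \<alpha> N + 2 * (-1) ^ n * S (Complex K' K) N)) \<longlonglongrightarrow> 2 * (deriv ^^ (2*n+1)) F 0"
    by (simp del: fact_Suc)
  have "(\<lambda>N. 4 * fact (2*n+1) * S \<alpha> N + (-1) ^ n * (4 * fact (2*n+1) * S (Complex K' K) N)) \<longlonglongrightarrow> M K K' + (-1) ^ n * M K' K"
    by (intro tendsto_intros 1 2)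
  moreover have "4 * fact (2*n+1) * S \<alpha> N + (-1) ^ n * (4 * fact (2*n+1) * S (Complex K' K) N) =
      2 * fact (2*n+1) * (2 * S \<alpha> N + 2 * (-1) ^ n * S (Complex K' K) N)" for N
    by (simp add: algebra_simps del: fact_Suc)
  ultimately have "2 * (deriv ^^ (2*n+1)) F 0 = M K K' + (-1) ^ n * M K' K"
    using LIMSEQ_unique[OF 3] by simp
  then have "2 * (deriv ^^ (2*n+1)) F 0 / 2 = (M K K' + (-1) ^ n * M K' K) / 2" by (simp only:)
  then show ?thesis by simp
qed

end

section \<open>Splitting the integral at the origin\<close>

lemma integral_split_half_lines:
  fixes f g h :: "real \<Rightarrow> complex"
  assumes g: "set_integrable lborel {0<..} g" "\<And>x. x > 0 \<Longrightarrow> f x = g x"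
    and h: "set_integrable lborel {0<..} h" "\<And>x. x > 0 \<Longrightarrow> f (- x) = h x"
  shows "integrable lborel f" "integral\<^sup>L lborel f = (LBINT x:{0<..}. g x) + (LBINT x:{0<..}. h x)"
proof -
  \<comment> \<open>The value at 0 is carried separately as a null function, and
    \<open>0 + (-1) * x\<close> is written to match the affine substitution rule.\<close>
  have f_eq: "f = (\<lambda>x. indicator {0<..} x *\<^sub>R g x + indicator {0<..} (0 + (-1) * x) *\<^sub>R h (0 + (-1) * x) + indicator {0} x *\<^sub>R f 0)"
  proof
    fix x :: real
    consider "x > 0" | "x = 0" | "x < 0" by linarith
    then show "f x = indicator {0<..} x *\<^sub>R g x + indicator {0<..} (0 + (-1) * x) *\<^sub>R h (0 + (-1) * x) + indicator {0} x *\<^sub>R f 0"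
      by cases (use g(2)[of x] h(2)[of "-x"] in auto)
  qed
  have ig: "integrable lborel (\<lambda>x. indicator {0<..} x *\<^sub>R g x)" using g by (simp add: set_integrable_def)
  have ih': "integrable lborel (\<lambda>x. indicator {0<..} x *\<^sub>R h x)" using h by (simp add: set_integrable_def)
  have ih: "integrable lborel (\<lambda>x. indicator {0<..} (0 + (-1) * x) *\<^sub>R h (0 + (-1) * x))"
    by (rule lborel_integrable_real_affine[OF ih']) simp
  have i0: "integrable lborel (\<lambda>x::real. indicator {0} x *\<^sub>R f 0)"
    by (intro integrable_scaleR_left) simp
  have e0: "(LINT x|lborel. indicator {0::real} x *\<^sub>R f 0) = 0" by simp
  show "integrable lborel f"
    by (subst f_eq) (intro Bochner_Integration.integrable_add ig ih i0)
  have "integral\<^sup>L lborel f = (LINT x|lborel. indicator {0<..} x *\<^sub>R g x) + (LINT x|lborel. indicator {0<..} (0 + (-1) * x) *\<^sub>R h (0 + (-1) * x))"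
    by (subst f_eq) (simp only: Bochner_Integration.integral_add Bochner_Integration.integrable_add ig ih i0 e0 add_0_right)
  also have "(LINT x|lborel. indicator {0<..} (0 + (-1) * x) *\<^sub>R h (0 + (-1) * x)) = (LINT x|lborel. indicator {0<..} x *\<^sub>R h x)"
    using lborel_integral_real_affine[of "-1" "\<lambda>x. indicator {0<..} x *\<^sub>R h x" 0] by simp
  finally show "integral\<^sup>L lborel f = (LBINT x:{0<..}. g x) + (LBINT x:{0<..}. h x)"
    by (simp add: set_lebesgue_integral_def)
qed

theorem corollary1:
  fixes k k' K K' :: real and n :: nat
  assumes "0 < k" and "k < 1"
    and "k' = sqrt (1 - k\<^sup>2)"
    and "K = elliptic_K k" and "K' = elliptic_K k'"
  shows "integrable lborel (\<lambda>x::real. complex_of_real x ^ n /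
             (cos (csqrt (of_real x) * of_real K) + cosh (csqrt (of_real x) * of_real K'))) \<and>
         1 / 2 * (LINT x|lborel. complex_of_real x ^ n /
             (cos (csqrt (of_real x) * of_real K) + cosh (csqrt (of_real x) * of_real K'))) =
         (-1) ^ n * (deriv ^^ (2 * n + 1)) (\<lambda>u. jacobi_sn u k / jacobi_cd u k) 0"
proof -
  define F where "F = remove_sings (\<lambda>u. jacobi_sn u k * jacobi_dn u k / jacobi_cn u k)"
  interpret sdc: sdc_function k k' F
    using is_sdc_jacobi(1)[OF is_jacobi_triple_jacobi[of k]] assms by unfold_locales (simp_all add: F_def)
  have KK: "sdc.K = K" "sdc.K' = K'" by (simp_all only: sdc.K_def sdc.K'_def assms(4,5))
  have Kpos: "K > 0" "K' > 0" using sdc.K_pos sdc.K'_pos by (simp_all add: KK)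
  define f where "f = (\<lambda>x::real. complex_of_real x ^ n /
             (cos (csqrt (of_real x) * of_real K) + cosh (csqrt (of_real x) * of_real K')))"
  define g where "g = (\<lambda>a b x. complex_of_real x ^ n / of_real (cosh (sqrt x * a) + cos (sqrt x * b)))"
  \<comment> \<open>On the positive half line K' sits in cosh and K in cos, so the moment appears
    with the two periods exchanged.\<close>
  have pos: "f x = g K' K x" if "x > 0" for x
    using that by (simp add: f_def g_def csqrt_of_real add.commute cos_of_real cosh_of_real flip: of_real_mult)
  \<comment> \<open>The square root is imaginary here, which exchanges cos and cosh and restores the
    order K, K'.\<close>
  have neg: "f (- x) = (-1) ^ n * g K K' x" if "x > 0" for x
  proof -
    have "csqrt (of_real (- x)) = \<i> * of_real (sqrt x)" using that by (subst csqrt_of_real') simp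
    then have "f (- x) = (- of_real x) ^ n / (cos (\<i> * of_real (sqrt x * K)) + cosh (\<i> * of_real (sqrt x * K')))"
      by (simp add: f_def mult.assoc)
    then show ?thesis
      by (simp only: g_def cosh_conv_cos[symmetric] cos_conv_cosh[symmetric] cosh_of_real cos_of_real of_real_add power_minus[of "of_real x"] times_divide_eq_right)
  qed
  have int: "set_integrable lborel {0<..} (g K K')" "set_integrable lborel {0<..} (g K' K)"
    unfolding g_def by (rule cosh_cos_moment(1)[OF Kpos(1)], rule cosh_cos_moment(1)[OF Kpos(2)])
  have split: "integrable lborel f"
      "integral\<^sup>L lborel f = (LBINT x:{0<..}. g K' K x) + (-1) ^ n * (LBINT x:{0<..}. g K K' x)"
    using integral_split_half_lines[of "g K' K" f "\<lambda>x. (-1) ^ n * g K K' x"] int pos neg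
    by (simp_all add: set_integrable_mult_right)
  have "(deriv ^^ (2*n+1)) (\<lambda>u. jacobi_sn u k / jacobi_cd u k) 0 = (deriv ^^ (2*n+1)) F 0"
  proof (rule higher_deriv_cong_ev)
    have "eventually (\<lambda>u. F u = jacobi_sn u k * jacobi_dn u k / jacobi_cn u k) (nhds 0)"
      unfolding F_def by (rule is_sdc_jacobi(2)[OF is_jacobi_triple_jacobi])
    then show "eventually (\<lambda>u. jacobi_sn u k / jacobi_cd u k = F u) (nhds 0)"
      by eventually_elim (simp add: jacobi_cd_def)
  qed simp
  also have "\<dots> = ((LBINT x:{0<..}. g K K' x) + (-1) ^ n * (LBINT x:{0<..}. g K' K x)) / 2"
    using sdc.deriv_eq_moments[of n] by (simp only: KK g_def)
  finally have D: "(deriv ^^ (2*n+1)) (\<lambda>u. jacobi_sn u k / jacobi_cd u k) 0 =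
      ((LBINT x:{0<..}. g K K' x) + (-1) ^ n * (LBINT x:{0<..}. g K' K x)) / 2" .
  \<comment> \<open>As (-1)^n squares to 1, multiplying by it moves the sign from one half line
    moment to the other.\<close>
  have "1 / 2 * integral\<^sup>L lborel f = (-1) ^ n * (deriv ^^ (2*n+1)) (\<lambda>u. jacobi_sn u k / jacobi_cd u k) 0"
    unfolding split(2) D by (cases "even n") (simp_all add: field_simps)
  then show ?thesis using split(1) by (simp only: f_def)
qed

end
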